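(* Let $I\subset S_L=L[x_1,\ldots,x_n]$ be a graded ideal. Then there exist finitely many (possibly empty) polyhedral complexes $\mathcal{F}_1,\ldots,\mathcal{F}_t$ in $\mathbb{R}^n$ such that for every $g\in\mathrm{GL}_n(K)$ we have $T(g(I))=\mathcal{F}_k$ for some $k\in\{1,\ldots,t\}$.
   Context: $K$ is an algebraically closed field. $L=K\{\!\{t\}\!\}$ is the field of generalized power series over $K$: formal sums $f=\sum_{\nu\in\mathbb{R}}c_\nu t^\nu$ with $c_\nu\in K$ and $\{\nu: c_\nu\neq 0\}$ well-ordered, with addition and multiplication as for polynomials. It is algebraically closed and has the valuation $v(f)=\min\{\nu: c_\nu\ne 0\}$ for $f\neq 0$, $v(0)=\infty$. Let $R_L=\{a\in L: v(a)\ge 0\}$; for $a\in R_L$ let $\overline a$ be its image in the residue field of $R_L$, which is identified with $K$ (so $\overline a$ is the coefficient of $t^0$). $S_L=L[x_1,\ldots,x_n]$ and $S_K=K[x_1,\ldots,x_n]$ carry the standard $\mathbb{Z}$-grading; "graded ideal" refers to this grading. For $0\neq f=\sum_\nu a_\nu x^\nu\in S_L$ and $\omega\in\mathbb{R}^n$ put $W=\min_\nu\{v(a_\nu)+\omega\cdot\nu\}$ and $\mathrm{in}_\omega(f)=\overline{t^{-W}f(x_1t^{\omega_1},\ldots,x_nt^{\omega_n})}\in S_K$ (residue taken coefficientwise); $\mathrm{in}_\omega(0)=0$. For a graded ideal $I\subset S_L$, $\mathrm{in}_\omega(I)\subset S_K$ is the ideal generated by all $\mathrm{in}_\omega(f)$,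 $f\in I$. For a graded ideal $I\subset S_L$ each set $\{\omega'\in\mathbb{R}^n: \mathrm{in}_{\omega'}(I)=\mathrm{in}_\omega(I)\}$ is the relative interior of a polyhedron, and the closures of these sets form a polyhedral complex in $\mathbb{R}^n$, the Gröbner complex $\mathrm{GC}(I)$. The tropical variety $T(I)$ is the (possibly empty) subcomplex of $\mathrm{GC}(I)$ with underlying set $\{\omega\in\mathbb{R}^n: \mathrm{in}_\omega(I)\text{ contains no monomial}\}$. An element $g=(g_{ij})\in \mathrm{GL}_n(K)$ is identified with the $L$-algebra automorphism of $S_L$ given by $x_i\mapsto\sum_{j=1}^n g_{ji}x_j$, and $g(I)$ is the image of $I$. *)

theory Defs
  imports
    "HOL-Analysis.Analysis"
    "HOL-Library.Poly_Mapping"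
    "HOL-Computational_Algebra.Polynomial"
begin

section \<open>Generalized power series with real exponents\<close>

subsection \<open>Well-ordered sets of reals\<close>

lemma wo_real_iff:
  "wfp_on A ((<) :: real \<Rightarrow> real \<Rightarrow> bool) \<longleftrightarrow> (\<forall>B\<subseteq>A. B \<noteq> {} \<longrightarrow> (\<exists>m\<in>B. \<forall>y\<in>B. m \<le> y))"
  unfolding wfp_on_iff_ex_minimal by (meson not_less)

lemma wo_real_Min:
  assumes "wfp_on A ((<) :: real \<Rightarrow> real \<Rightarrow> bool)" "B \<subseteq> A" "B \<noteq> {}"
  obtains m where "m \<in> B" "\<And>y. y \<in> B \<Longrightarrow> m \<le> y"
  using assms unfolding wo_real_iff by meson

lemma wo_real_no_desc:
  assumes "wfp_on A ((<) :: real \<Rightarrow> real \<Rightarrow> bool)" "\<And>n. s n \<in> A" "\<And>n::nat. s (Suc n) < s n"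
  shows False
proof -
  obtain m where "m \<in> range s" "\<And>y. y \<in> range s \<Longrightarrow> m \<le> y"
    by (rule wo_real_Min[OF assms(1), of "range s"]) (use assms(2) in auto)
  then show False
    using assms(3) by (metis not_less rangeE rangeI)
qed

lemma wo_real_Un:
  assumes "wfp_on A ((<) :: real \<Rightarrow> real \<Rightarrow> bool)" "wfp_on B (<)"
  shows "wfp_on (A \<union> B) ((<) :: real \<Rightarrow> real \<Rightarrow> bool)"
  unfolding wo_real_iff
proof (intro allI impI)
  fix C assume C: "C \<subseteq> A \<union> B" "C \<noteq> {}"
  show "\<exists>m\<in>C. \<forall>y\<in>C. m \<le> y"
  proof (cases "C \<inter> A = {} \<or> C \<inter> B = {}")
    case True
    then have "C \<subseteq> A \<or> C \<subseteq> B" using C by auto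
    then show ?thesis using assms C unfolding wo_real_iff by auto
  next
    case False
    obtain a where a: "a \<in> C \<inter> A" "\<And>y. y \<in> C \<inter> A \<Longrightarrow> a \<le> y"
      using wo_real_Min[OF assms(1), of "C \<inter> A"] False by (metis Int_lower2)
    obtain b where b: "b \<in> C \<inter> B" "\<And>y. y \<in> C \<inter> B \<Longrightarrow> b \<le> y"
      using wo_real_Min[OF assms(2), of "C \<inter> B"] False by (metis Int_lower2)
    have "min a b \<in> C" using a b by (auto simp: min_def)
    moreover have "\<forall>y\<in>C. min a b \<le> y" using a(2) b(2) C by fastforce
    ultimately show ?thesis by blast
  qed
qed

lemma wo_real_finite: "finite A \<Longrightarrow> wfp_on A ((<) :: real \<Rightarrow> real \<Rightarrow> bool)"
  unfolding wo_real_iff by (metis Min_in Min_le finite_subset)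

lemma wo_real_finite_decomp:
  assumes A: "wfp_on A ((<) :: real \<Rightarrow> real \<Rightarrow> bool)" and B: "wfp_on B (<)"
  shows "finite {a\<in>A. \<nu> - a \<in> B}"
proof (rule ccontr)
  assume "infinite {a\<in>A. \<nu> - a \<in> B}"
  then obtain s :: "nat \<Rightarrow> real" where s: "inj s" "range s \<subseteq> {a\<in>A. \<nu> - a \<in> B}"
    using infinite_countable_subset by blast
  obtain f where f: "strict_mono f" "monoseq (\<lambda>n. s (f n))" using seq_monosub by blast
  have neq: "s (f (Suc n)) \<noteq> s (f n)" for n
    using s(1) strict_mono_less[OF f(1), of n "Suc n"] by (metis inj_def less_irrefl lessI)
  consider "\<And>n. s (f n) \<le> s (f (Suc n))" | "\<And>n. s (f (Suc n)) \<le> s (f n)"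
    using f(2) by (meson monoseq_Suc)
  then show False
  proof cases
    case 1
    then have "\<nu> - s (f (Suc n)) < \<nu> - s (f n)" for n using neq[of n] by (simp add: order_less_le)
    then show False using s(2) by (intro wo_real_no_desc[OF B, of "\<lambda>n. \<nu> - s (f n)"]) auto
  next
    case 2
    then have "s (f (Suc n)) < s (f n)" for n using neq[of n] by (simp add: order_less_le)
    then show False using s(2) by (intro wo_real_no_desc[OF A, of "\<lambda>n. s (f n)"]) auto
  qed
qed

lemma wo_real_plus:
  assumes A: "wfp_on A ((<) :: real \<Rightarrow> real \<Rightarrow> bool)" and B: "wfp_on B (<)"
  shows "wfp_on {a + b | a b. a \<in> A \<and> b \<in> B} ((<) :: real \<Rightarrow> real \<Rightarrow> bool)"
proof (rule ccontr)
  assume "\<not> ?thesis"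
  then obtain C where C: "C \<subseteq> {a + b | a b. a \<in> A \<and> b \<in> B}" "C \<noteq> {}"
    "\<forall>m\<in>C. \<exists>y\<in>C. y < m" unfolding wo_real_iff by (meson not_le)
  obtain c0 where "c0 \<in> C" using C by blast
  obtain s where s: "\<And>n. s n \<in> C" "\<And>n::nat. s (Suc n) < s n"
    using dependent_nat_choice[of "\<lambda>_ x. x \<in> C" "\<lambda>_ x y. y < x"] \<open>c0 \<in> C\<close> C(3) by metis
  have "\<forall>n. \<exists>a b. s n = a + b \<and> a \<in> A \<and> b \<in> B" using s(1) C(1) by blast
  then obtain a b where ab: "\<And>n. s n = a n + b n" "\<And>n. a n \<in> A" "\<And>n. b n \<in> B" by metis
  obtain f where f: "strict_mono f" "monoseq (\<lambda>n. a (f n))" using seq_monosub by blast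
  have sf: "s (f m) < s (f n)" if "n < m" for m n
    by (rule lift_Suc_mono_less[of "\<lambda>n. - s n", simplified])
       (use s(2) f(1) that in \<open>auto simp: strict_mono_less\<close>)
  obtain N where N: "\<And>n. n \<ge> N \<Longrightarrow> a (f n) \<le> a (f (Suc n))"
  proof (cases "\<forall>n. a (f n) \<le> a (f (Suc n))")
    case True then show ?thesis using that by blast
  next
    case False
    then have dec: "\<And>m n. m \<le> n \<Longrightarrow> a (f n) \<le> a (f m)"
      using f(2) unfolding monoseq_def by (meson le_SucI order_refl)
    obtain m where m: "m \<in> range (\<lambda>n. a (f n))" "\<And>y. y \<in> range (\<lambda>n. a (f n)) \<Longrightarrow> m \<le> y"
      by (rule wo_real_Min[OF A, of "range (\<lambda>n. a (f n))"]) (use ab(2) in auto)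
    then obtain N where "m = a (f N)" by blast
    then show ?thesis using that[of N] m(2) dec by (meson order_trans rangeI)
  qed
  have "b (f (N + Suc n)) < b (f (N + n))" for n
    using N[of "N + n"] sf[of "N + n" "N + Suc n"] by (simp add: ab(1))
  then show False using wo_real_no_desc[OF B, of "\<lambda>n. b (f (N + n))"] ab(3) by blast
qed

subsection \<open>The ring of generalized power series\<close>

typedef (overloaded) 'a hahn = "{f :: real \<Rightarrow> 'a::zero. wfp_on {\<nu>. f \<nu> \<noteq> 0} (<)}"
  morphisms hcoeff Abs_hahn
  by (rule exI[of _ "\<lambda>_. 0"]) (simp add: wo_real_finite)

setup_lifting type_definition_hahn

lemma hahn_eq_iff: "f = g \<longleftrightarrow> (\<forall>\<nu>. hcoeff f \<nu> = hcoeff g \<nu>)"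
  by (simp add: hcoeff_inject[symmetric] fun_eq_iff)

lemma wo_hcoeff: "wfp_on {\<nu>. hcoeff f \<nu> \<noteq> 0} (<)"
  using hcoeff[of f] by simp

lift_definition hsingle :: "real \<Rightarrow> 'a::zero \<Rightarrow> 'a hahn" is "\<lambda>r c \<nu>. if \<nu> = r then c else 0"
  subgoal for r c by (rule wfp_on_subset[OF wo_real_finite[of "{r}"]]) auto
  done

abbreviation tpow :: "real \<Rightarrow> 'a::zero_neq_one hahn"
  where "tpow r \<equiv> hsingle r 1"

instantiation hahn :: (zero) zero
begin
lift_definition zero_hahn :: "'a hahn" is "\<lambda>_. 0" by (simp add: wo_real_finite)
instance ..
end

instantiation hahn :: (zero_neq_one) one
begin
definition one_hahn :: "'a hahn" where "one_hahn = tpow 0"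
instance ..
end

instantiation hahn :: (comm_monoid_add) plus
begin
lift_definition plus_hahn :: "'a hahn \<Rightarrow> 'a hahn \<Rightarrow> 'a hahn" is "\<lambda>f g \<nu>. f \<nu> + g \<nu>"
  subgoal for f g
    by (rule wfp_on_subset[OF wo_real_Un[of "{\<nu>. f \<nu> \<noteq> 0}" "{\<nu>. g \<nu> \<noteq> 0}"]]) auto
  done
instance ..
end

instantiation hahn :: (ab_group_add) "{uminus, minus}"
begin
lift_definition uminus_hahn :: "'a hahn \<Rightarrow> 'a hahn" is "\<lambda>f \<nu>. - f \<nu>" by simp
definition minus_hahn :: "'a hahn \<Rightarrow> 'a hahn \<Rightarrow> 'a hahn" where "minus_hahn f g = f + - g"
instance ..
end

text \<open>The sum below is finite because both supports are well-ordered, see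
  \<open>finite_hahn_decomp\<close>.\<close>

instantiation hahn :: (semiring_0) times
begin
lift_definition times_hahn :: "'a hahn \<Rightarrow> 'a hahn \<Rightarrow> 'a hahn"
  is "\<lambda>f g \<nu>. \<Sum>a | f a \<noteq> 0 \<and> g (\<nu> - a) \<noteq> 0. f a * g (\<nu> - a)"
  subgoal premises prems for f g
  proof (rule wfp_on_subset[OF wo_real_plus[OF prems]], rule subsetI)
    fix \<nu> assume "\<nu> \<in> {\<nu>. (\<Sum>a | f a \<noteq> 0 \<and> g (\<nu> - a) \<noteq> 0. f a * g (\<nu> - a)) \<noteq> 0}"
    then have "{a. f a \<noteq> 0 \<and> g (\<nu> - a) \<noteq> 0} \<noteq> {}"
      by (intro notI) (simp only: mem_Collect_eq sum.empty simp_thms)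
    then obtain a where "f a \<noteq> 0" "g (\<nu> - a) \<noteq> 0" by blast
    then have "\<nu> = a + (\<nu> - a) \<and> a \<in> {\<nu>. f \<nu> \<noteq> 0} \<and> \<nu> - a \<in> {\<nu>. g \<nu> \<noteq> 0}" by simp
    then show "\<nu> \<in> {a + b | a b. a \<in> {\<nu>. f \<nu> \<noteq> 0} \<and> b \<in> {\<nu>. g \<nu> \<noteq> 0}}" by blast
  qed
  done
instance ..
end

lemma hcoeff_0 [simp]: "hcoeff 0 \<nu> = 0" by transfer simp
lemma hcoeff_single: "hcoeff (hsingle r c) \<nu> = (if \<nu> = r then c else 0)" by transfer simp
lemma hcoeff_1: "hcoeff 1 \<nu> = (if \<nu> = 0 then 1 else 0)" by (simp add: one_hahn_def hcoeff_single)
lemma hcoeff_add [simp]: "hcoeff (f + g) \<nu> = hcoeff f \<nu> + hcoeff g \<nu>" by transfer simp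
lemma hcoeff_uminus [simp]: "hcoeff (- f) \<nu> = - hcoeff f \<nu>" by transfer simp
lemma hcoeff_diff [simp]: "hcoeff (f - g) \<nu> = hcoeff f \<nu> - hcoeff g \<nu>" by (simp add: minus_hahn_def)

lemma hcoeff_mult:
  "hcoeff (f * g) \<nu> = (\<Sum>a | hcoeff f a \<noteq> 0 \<and> hcoeff g (\<nu> - a) \<noteq> 0. hcoeff f a * hcoeff g (\<nu> - a))"
  by transfer simp

lemma finite_hahn_decomp: "finite {a. hcoeff f a \<noteq> 0 \<and> hcoeff g (\<nu> - a) \<noteq> 0}"
  using wo_real_finite_decomp[OF wo_hcoeff[of f] wo_hcoeff[of g], of \<nu>] by simp

lemma hcoeff_mult':
  assumes "finite T" "{a. hcoeff f a \<noteq> 0 \<and> hcoeff g (\<nu> - a) \<noteq> 0} \<subseteq> T"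
  shows "hcoeff (f * g) \<nu> = (\<Sum>a\<in>T. hcoeff f a * hcoeff g (\<nu> - a))"
  unfolding hcoeff_mult using assms by (intro sum.mono_neutral_left) auto

lemma hcoeff_mult_nonzero:
  assumes "hcoeff (f * g) \<nu> \<noteq> 0"
  obtains a where "hcoeff f a \<noteq> 0" "hcoeff g (\<nu> - a) \<noteq> 0"
proof -
  have "{a. hcoeff f a \<noteq> 0 \<and> hcoeff g (\<nu> - a) \<noteq> 0} \<noteq> {}"
    using assms by (intro notI) (simp only: hcoeff_mult sum.empty simp_thms)
  then show ?thesis using that by blast
qed

lemma hcoeff_mult_single_left:
  "hcoeff (hsingle r c * f) \<nu> = c * hcoeff f (\<nu> - r)"
  by (subst hcoeff_mult'[of "{r}"]) (auto simp: hcoeff_single split: if_splits)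

lemma hahn_mult_assoc: "(f * g) * h = f * (g * (h :: 'a::semiring_0 hahn))"
proof (unfold hahn_eq_iff, rule allI)
  fix \<nu>
  let ?A = "{\<nu>. hcoeff f \<nu> \<noteq> 0}" and ?B = "{\<nu>. hcoeff g \<nu> \<noteq> 0}" and ?C = "{\<nu>. hcoeff h \<nu> \<noteq> 0}"
  define P where "P = {c \<in> {a + b | a b. a \<in> ?A \<and> b \<in> ?B}. \<nu> - c \<in> ?C}"
  define Q where "Q = {a \<in> ?A. \<nu> - a \<in> {b + c | b c. b \<in> ?B \<and> c \<in> ?C}}"
  define X where "X = (\<lambda>c. {a. hcoeff f a \<noteq> 0 \<and> hcoeff g (c - a) \<noteq> 0})"
  define Y where "Y = (\<lambda>a. {b. hcoeff g b \<noteq> 0 \<and> hcoeff h (\<nu> - a - b) \<noteq> 0})"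
  have finP: "finite P" unfolding P_def
    by (intro wo_real_finite_decomp wo_real_plus wo_hcoeff)
  have finQ: "finite Q" unfolding Q_def
    by (intro wo_real_finite_decomp wo_real_plus wo_hcoeff)
  have finX: "finite (X c)" for c unfolding X_def by (rule finite_hahn_decomp)
  have finY: "finite (Y a)" for a unfolding Y_def by (rule finite_hahn_decomp)
  have subP: "{c. hcoeff (f * g) c \<noteq> 0 \<and> hcoeff h (\<nu> - c) \<noteq> 0} \<subseteq> P"
  proof
    fix c assume c: "c \<in> {c. hcoeff (f * g) c \<noteq> 0 \<and> hcoeff h (\<nu> - c) \<noteq> 0}"
    then obtain a where "hcoeff f a \<noteq> 0" "hcoeff g (c - a) \<noteq> 0"
      using hcoeff_mult_nonzero by blast
    then have "c = a + (c - a) \<and> a \<in> ?A \<and> c - a \<in> ?B" by simp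
    then show "c \<in> P" unfolding P_def using c by blast
  qed
  have subQ: "{a. hcoeff f a \<noteq> 0 \<and> hcoeff (g * h) (\<nu> - a) \<noteq> 0} \<subseteq> Q"
  proof
    fix a assume a: "a \<in> {a. hcoeff f a \<noteq> 0 \<and> hcoeff (g * h) (\<nu> - a) \<noteq> 0}"
    then obtain b where "hcoeff g b \<noteq> 0" "hcoeff h (\<nu> - a - b) \<noteq> 0"
      using hcoeff_mult_nonzero by blast
    then have "\<nu> - a = b + (\<nu> - a - b) \<and> b \<in> ?B \<and> \<nu> - a - b \<in> ?C" by simp
    then show "a \<in> Q" unfolding Q_def using a by blast
  qed
  have "hcoeff (f * g * h) \<nu> = (\<Sum>c\<in>P. \<Sum>a\<in>X c. hcoeff f a * hcoeff g (c - a) * hcoeff h (\<nu> - c))"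
    by (subst hcoeff_mult'[OF finP subP]) (simp add: hcoeff_mult X_def sum_distrib_right)
  also have "\<dots> = (\<Sum>(c, a)\<in>Sigma P X. hcoeff f a * hcoeff g (c - a) * hcoeff h (\<nu> - c))"
    by (rule sum.Sigma) (use finP finX in auto)
  also have "\<dots> = (\<Sum>(a, b)\<in>Sigma Q Y. hcoeff f a * (hcoeff g b * hcoeff h (\<nu> - a - b)))"
  proof (rule sum.reindex_bij_witness[of _ "\<lambda>(a, b). (a + b, a)" "\<lambda>(c, a). (a, c - a)"], goal_cases)
    case (2 p)
    obtain c a where p: "p = (c, a)" by (cases p)
    have 1: "hcoeff f a \<noteq> 0" "hcoeff g (c - a) \<noteq> 0" "hcoeff h (\<nu> - c) \<noteq> 0"
      using 2 by (auto simp: p P_def X_def)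
    have "\<nu> - a = (c - a) + (\<nu> - c) \<and> c - a \<in> ?B \<and> \<nu> - c \<in> ?C" using 1 by simp
    then have "a \<in> Q" unfolding Q_def using 1 by blast
    then show ?case using 1 by (simp add: p Y_def)
  next
    case (4 p)
    obtain a b where p: "p = (a, b)" by (cases p)
    have 1: "hcoeff f a \<noteq> 0" "hcoeff g b \<noteq> 0" "hcoeff h (\<nu> - (a + b)) \<noteq> 0"
      using 4 by (auto simp: p Q_def Y_def diff_diff_eq)
    have "a + b \<in> P" unfolding P_def using 1 by blast
    then show ?case using 1 by (simp add: p X_def)
  qed (auto simp: mult.assoc)
  also have "\<dots> = (\<Sum>a\<in>Q. \<Sum>b\<in>Y a. hcoeff f a * (hcoeff g b * hcoeff h (\<nu> - a - b)))"
    by (rule sum.Sigma[symmetric]) (use finQ finY in auto)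
  also have "\<dots> = hcoeff (f * (g * h)) \<nu>"
    by (subst hcoeff_mult'[OF finQ subQ]) (simp add: hcoeff_mult Y_def sum_distrib_left)
  finally show "hcoeff (f * g * h) \<nu> = hcoeff (f * (g * h)) \<nu>" .
qed

lemma hahn_mult_commute: "f * g = g * (f :: 'a::comm_semiring_0 hahn)"
  unfolding hahn_eq_iff hcoeff_mult
  by (intro allI sum.reindex_bij_witness[of _ "\<lambda>a. \<nu> - a" "\<lambda>a. \<nu> - a" for \<nu>])
     (auto simp: mult.commute)

lemma hahn_distrib_right: "(f + g) * h = f * h + g * (h :: 'a::semiring_0 hahn)"
proof (unfold hahn_eq_iff, rule allI)
  fix \<nu>
  let ?T = "{a. hcoeff f a \<noteq> 0 \<and> hcoeff h (\<nu> - a) \<noteq> 0} \<union> {a. hcoeff g a \<noteq> 0 \<and> hcoeff h (\<nu> - a) \<noteq> 0}"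
  have T: "finite ?T" by (simp add: finite_hahn_decomp)
  have "hcoeff ((f + g) * h) \<nu> = (\<Sum>a\<in>?T. hcoeff (f + g) a * hcoeff h (\<nu> - a))"
    by (rule hcoeff_mult'[OF T]) auto
  moreover have "hcoeff (f * h) \<nu> = (\<Sum>a\<in>?T. hcoeff f a * hcoeff h (\<nu> - a))"
    by (rule hcoeff_mult'[OF T]) auto
  moreover have "hcoeff (g * h) \<nu> = (\<Sum>a\<in>?T. hcoeff g a * hcoeff h (\<nu> - a))"
    by (rule hcoeff_mult'[OF T]) auto
  ultimately show "hcoeff ((f + g) * h) \<nu> = hcoeff (f * h + g * h) \<nu>"
    by (simp only: hcoeff_add distrib_right sum.distrib)
qed

instance hahn :: (comm_ring_1) comm_ring_1
proof
  fix f g h :: "'a hahn"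
  show "f * g * h = f * (g * h)" by (rule hahn_mult_assoc)
  show "f * g = g * f" by (rule hahn_mult_commute)
  show "1 * f = f" by (simp add: hahn_eq_iff one_hahn_def hcoeff_mult_single_left)
  show "(f + g) * h = f * h + g * h" by (rule hahn_distrib_right)
  show "(0::'a hahn) \<noteq> 1" by (auto simp: hahn_eq_iff hcoeff_1)
  show "f + g + h = f + (g + h)" by (simp add: hahn_eq_iff add.assoc)
  show "f + g = g + f" by (simp add: hahn_eq_iff add.commute)
  show "0 + f = f" "- f + f = 0" "f - g = f + - g" by (simp_all add: hahn_eq_iff)
qed

text \<open>The valuation of a nonzero series; the value at \<open>0\<close>, which would be infinite, is
  never used.\<close>

definition hval :: "'a::zero hahn \<Rightarrow> real"
  where "hval f = (LEAST \<nu>. hcoeff f \<nu> \<noteq> 0)"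

lemma hval_props:
  assumes "f \<noteq> 0"
  shows "hcoeff f (hval f) \<noteq> 0" "hcoeff f \<nu> \<noteq> 0 \<Longrightarrow> hval f \<le> \<nu>"
proof -
  have ne: "{\<nu>. hcoeff f \<nu> \<noteq> 0} \<noteq> {}" using assms by (simp add: hahn_eq_iff)
  obtain m where m: "m \<in> {\<nu>. hcoeff f \<nu> \<noteq> 0}" "\<And>y. y \<in> {\<nu>. hcoeff f \<nu> \<noteq> 0} \<Longrightarrow> m \<le> y"
    using wo_hcoeff[of f, unfolded wo_real_iff, rule_format, OF subset_refl ne] by blast
  then have "hval f = m" unfolding hval_def by (intro Least_equality) simp_all
  with m show "hcoeff f (hval f) \<noteq> 0" "hcoeff f \<nu> \<noteq> 0 \<Longrightarrow> hval f \<le> \<nu>" by simp_all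
qed

subsection \<open>Field structure\<close>

lemma hcoeff_sum: "hcoeff (sum f A) \<nu> = (\<Sum>x\<in>A. hcoeff (f x) \<nu>)"
  for f :: "_ \<Rightarrow> 'a::comm_ring_1 hahn"
  by (induction A rule: infinite_finite_induct) auto

lemma hcoeff_power_bound:
  fixes h :: "'a::comm_ring_1 hahn"
  assumes h: "\<And>\<nu>. hcoeff h \<nu> \<noteq> 0 \<Longrightarrow> a \<le> \<nu>" and "hcoeff (h ^ k) \<nu> \<noteq> 0"
  shows "real k * a \<le> \<nu>"
  using assms(2)
proof (induction k arbitrary: \<nu>)
  case 0
  then show ?case by (auto simp: hcoeff_1 split: if_splits)
next
  case (Suc k)
  then have "hcoeff (h * h ^ k) \<nu> \<noteq> 0" by simp
  then obtain b where "hcoeff h b \<noteq> 0" "hcoeff (h ^ k) (\<nu> - b) \<noteq> 0"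
    by (rule hcoeff_mult_nonzero)
  then have "a \<le> b" "real k * a \<le> \<nu> - b" using h Suc.IH by auto
  then show ?case by (simp add: algebra_simps)
qed

lemma hahn_geometric_inverse:
  fixes h :: "'a::comm_ring_1 hahn"
  assumes a: "a > 0" and h: "\<And>\<nu>. hcoeff h \<nu> \<noteq> 0 \<Longrightarrow> a \<le> \<nu>"
  shows "\<exists>g. (1 - h) * g = 1"
proof -
  define N where "N = (\<lambda>\<nu>. Suc (nat \<lfloor>\<nu> / a\<rfloor>))"
  define G where "G = (\<lambda>M. \<Sum>k<M. h ^ k)"
  have zero: "hcoeff (h ^ k) \<nu> = 0" if "N \<nu> \<le> k" for k \<nu>
  proof (rule ccontr)
    assume "hcoeff (h ^ k) \<nu> \<noteq> 0"
    then have "real k * a \<le> \<nu>" using hcoeff_power_bound[OF h] by blast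
    then have "real k \<le> \<nu> / a" using a by (simp add: field_simps)
    then have "k \<le> nat \<lfloor>\<nu> / a\<rfloor>" by linarith
    then show False using that by (simp add: N_def)
  qed
  have stab: "hcoeff (G M) \<nu> = hcoeff (G (N \<nu>)) \<nu>" if "N \<nu> \<le> M" for M \<nu>
    unfolding G_def hcoeff_sum
    by (rule sum.mono_neutral_right) (use that zero in auto)
  have N_mono: "N \<mu> \<le> N \<nu>" if "\<mu> \<le> \<nu>" for \<mu> \<nu>
    using that a by (simp add: N_def nat_mono floor_mono divide_right_mono)
  have "wfp_on {\<nu>. hcoeff (G (N \<nu>)) \<nu> \<noteq> 0} (<)"
    unfolding wo_real_iff
  proof (intro allI impI)
    fix B assume B: "B \<subseteq> {\<nu>. hcoeff (G (N \<nu>)) \<nu> \<noteq> 0}" "B \<noteq> {}"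
    then obtain c where c: "c \<in> B" by blast
    have sub: "B \<inter> {..c} \<subseteq> {\<nu>. hcoeff (G (N c)) \<nu> \<noteq> 0}"
    proof
      fix y assume y: "y \<in> B \<inter> {..c}"
      then have "hcoeff (G (N c)) y = hcoeff (G (N y)) y" by (intro stab N_mono) simp
      with y B(1) show "y \<in> {\<nu>. hcoeff (G (N c)) \<nu> \<noteq> 0}" by auto
    qed
    obtain m where m: "m \<in> B \<inter> {..c}" "\<And>y. y \<in> B \<inter> {..c} \<Longrightarrow> m \<le> y"
      using wo_hcoeff[of "G (N c)", unfolded wo_real_iff, rule_format, OF sub] c by blast
    have "m \<le> y" if "y \<in> B" for y using that m by (cases "y \<le> c") force+
    then show "\<exists>m\<in>B. \<forall>y\<in>B. m \<le> y" using m(1) by blast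
  qed
  then have "hcoeff (Abs_hahn (\<lambda>\<nu>. hcoeff (G (N \<nu>)) \<nu>)) = (\<lambda>\<nu>. hcoeff (G (N \<nu>)) \<nu>)"
    by (intro Abs_hahn_inverse CollectI)
  then obtain g where g: "\<And>\<nu>. hcoeff g \<nu> = hcoeff (G (N \<nu>)) \<nu>"
    by (metis (no_types))
  have "(1 - h) * g = 1"
  proof (unfold hahn_eq_iff, rule allI)
    fix \<nu>
    have nonneg: "0 \<le> b" if "hcoeff (1 - h) b \<noteq> 0" for b
      using that h[of b] a by (cases "b = 0") (auto simp: hcoeff_1)
    have eq: "hcoeff g (\<nu> - b) = hcoeff (G (N \<nu>)) (\<nu> - b)" if "hcoeff (1 - h) b \<noteq> 0" for b
      unfolding g by (rule stab[symmetric], rule N_mono) (use nonneg[OF that] in simp)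
    have "hcoeff ((1 - h) * g) \<nu> = hcoeff ((1 - h) * G (N \<nu>)) \<nu>"
      unfolding hcoeff_mult by (rule sum.cong) (use eq in auto)
    also have "(1 - h) * G (N \<nu>) = 1 - h ^ N \<nu>"
      unfolding G_def by (rule one_diff_power_eq[symmetric])
    also have "hcoeff (1 - h ^ N \<nu>) \<nu> = hcoeff 1 \<nu>" using zero[of \<nu> "N \<nu>"] by simp
    finally show "hcoeff ((1 - h) * g) \<nu> = hcoeff 1 \<nu>" .
  qed
  then show ?thesis by blast
qed

lemma hahn_inverse_exists:
  fixes f :: "'a::field hahn"
  assumes "f \<noteq> 0"
  shows "\<exists>g. g * f = 1"
proof -
  define u where "u = hsingle (- hval f) (inverse (hcoeff f (hval f)))"
  define h where "h = 1 - u * f"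
  have nz: "hcoeff f (hval f) \<noteq> 0" using hval_props[OF assms] by blast
  have uf: "hcoeff (u * f) \<nu> = inverse (hcoeff f (hval f)) * hcoeff f (\<nu> + hval f)" for \<nu>
    by (simp add: u_def hcoeff_mult_single_left)
  have pos: "0 < \<nu>" if "hcoeff h \<nu> \<noteq> 0" for \<nu>
  proof (rule ccontr)
    assume "\<not> 0 < \<nu>"
    then consider "\<nu> = 0" | "\<nu> < 0" by linarith
    then show False
      using that nz hval_props(2)[OF assms, of "\<nu> + hval f"]
      by cases (auto simp: h_def uf hcoeff_1)
  qed
  obtain a where "a > 0" "\<And>\<nu>. hcoeff h \<nu> \<noteq> 0 \<Longrightarrow> a \<le> \<nu>"
  proof (cases "h = 0")
    case True then show ?thesis using that[of 1] by simp
  next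
    case False then show ?thesis using that[of "hval h"] hval_props[OF False] pos by blast
  qed
  then obtain g where "(1 - h) * g = 1" using hahn_geometric_inverse by blast
  then have "(u * g) * f = 1" by (simp add: h_def mult_ac)
  then show ?thesis by blast
qed

instantiation hahn :: (field) field
begin
definition inverse_hahn :: "'a hahn \<Rightarrow> 'a hahn"
  where "inverse_hahn f = (if f = 0 then 0 else SOME g. g * f = 1)"
definition divide_hahn :: "'a hahn \<Rightarrow> 'a hahn \<Rightarrow> 'a hahn"
  where "divide_hahn f g = f * inverse g"
instance
proof
  fix f g :: "'a hahn"
  show "inverse f * f = 1" if "f \<noteq> 0"
    using someI_ex[OF hahn_inverse_exists[OF that]] that by (simp add: inverse_hahn_def)
  show "f div g = f * inverse g" by (simp add: divide_hahn_def)
  show "inverse (0::'a hahn) = 0" by (simp add: inverse_hahn_def)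
qed
end

section \<open>Polynomials, ideals and initial ideals\<close>

text \<open>The variables are indexed by a finite type \<open>'n\<close>. A polynomial maps exponent vectors
  \<open>\<nu> :: 'n \<Rightarrow>\<^sub>0 nat\<close> to coefficients; multiplication is the convolution of
  \<^theory>\<open>HOL-Library.Poly_Mapping\<close>.\<close>

type_synonym ('n, 'a) mpoly = "('n \<Rightarrow>\<^sub>0 nat) \<Rightarrow>\<^sub>0 'a"

definition mconst :: "'a::zero \<Rightarrow> ('n, 'a) mpoly"
  where "mconst c = Poly_Mapping.single 0 c"

definition mvar :: "'n \<Rightarrow> ('n, 'a::zero_neq_one) mpoly"
  where "mvar i = Poly_Mapping.single (Poly_Mapping.single i 1) 1"

text \<open>\<open>msubst s\<close> is the \<open>'a\<close>-algebra endomorphism mapping the variable \<open>i\<close> to \<open>s i\<close>.\<close>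

definition msubst ::
    "('n::finite \<Rightarrow> ('n, 'a::comm_ring_1) mpoly) \<Rightarrow> ('n, 'a) mpoly \<Rightarrow> ('n, 'a) mpoly"
  where "msubst s f =
    (\<Sum>\<nu>\<in>Poly_Mapping.keys f. mconst (Poly_Mapping.lookup f \<nu>) * (\<Prod>i\<in>UNIV. s i ^ Poly_Mapping.lookup \<nu> i))"

text \<open>The ideals of a commutative ring are its submodules: \<open>ideal.subspace J\<close> says that
  \<open>J\<close> is an ideal, and \<open>ideal.span A\<close> is the ideal generated by \<open>A\<close>.\<close>

interpretation ideal: module "(*) :: 'a::comm_ring_1 \<Rightarrow> 'a \<Rightarrow> 'a"
  by unfold_locales (simp_all add: algebra_simps)

definition hom_component :: "nat \<Rightarrow> ('n::finite, 'a::zero) mpoly \<Rightarrow> ('n, 'a) mpoly"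
  where "hom_component d =
    Poly_Mapping.mapp (\<lambda>\<nu> c. if (\<Sum>i\<in>UNIV. Poly_Mapping.lookup \<nu> i) = d then c else 0)"

definition graded_ideal :: "('n::finite, 'a::comm_ring_1) mpoly set \<Rightarrow> bool"
  where "graded_ideal J \<longleftrightarrow> ideal.subspace J \<and> (\<forall>f\<in>J. \<forall>d. hom_component d f \<in> J)"

definition contains_monomial :: "('n, 'a::zero_neq_one) mpoly set \<Rightarrow> bool"
  where "contains_monomial J \<longleftrightarrow> (\<exists>\<nu>. Poly_Mapping.single \<nu> 1 \<in> J)"

text \<open>The minimum \<open>W\<close> only needs to range over the terms of \<open>f\<close> that occur, since the others
  have infinite valuation. The residue of an element of the valuation ring is its coefficient
  at \<open>t^0\<close>.\<close>

definition tropical_weight :: "real ^ 'n \<Rightarrow> ('n::finite, 'k::field hahn) mpoly \<Rightarrow> real"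
  where "tropical_weight \<omega> f =
    Min ((\<lambda>\<nu>. hval (Poly_Mapping.lookup f \<nu>) + (\<Sum>i\<in>UNIV. \<omega> $ i * real (Poly_Mapping.lookup \<nu> i)))
      ` Poly_Mapping.keys f)"

definition initial_form :: "real ^ 'n \<Rightarrow> ('n::finite, 'k::field hahn) mpoly \<Rightarrow> ('n, 'k) mpoly"
  where "initial_form \<omega> f = (if f = 0 then 0 else
    Poly_Mapping.map (\<lambda>a. hcoeff a 0)
      (mconst (tpow (- tropical_weight \<omega> f)) * msubst (\<lambda>i. mconst (tpow (\<omega> $ i)) * mvar i) f))"

definition initial_ideal ::
    "real ^ 'n \<Rightarrow> ('n::finite, 'k::field hahn) mpoly set \<Rightarrow> ('n, 'k) mpoly set"
  where "initial_ideal \<omega> I = ideal.span (initial_form \<omega> ` I)"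

section \<open>Polyhedral complexes and tropical varieties\<close>

text \<open>Cells are nonempty, whereas the library counts the empty set among the polyhedra and among
  the faces of every polyhedron. The empty family is a polyhedral complex.\<close>

definition polyhedral_complex :: "'a::euclidean_space set set \<Rightarrow> bool"
  where "polyhedral_complex \<F> \<longleftrightarrow>
    finite \<F> \<and>
    (\<forall>P\<in>\<F>. polyhedron P \<and> P \<noteq> {}) \<and>
    (\<forall>P\<in>\<F>. \<forall>F. F face_of P \<and> F \<noteq> {} \<longrightarrow> F \<in> \<F>) \<and>
    (\<forall>P\<in>\<F>. \<forall>Q\<in>\<F>. P \<inter> Q face_of P \<and> P \<inter> Q face_of Q)"

definition groebner_complex ::
    "('n::finite, 'k::field hahn) mpoly set \<Rightarrow> (real ^ 'n) set set"
  where "groebner_complex I =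
    {closure {\<omega>'. initial_ideal \<omega>' I = initial_ideal \<omega> I} | \<omega>. True}"

text \<open>A subcomplex with underlying set \<open>X\<close> consists of all cells contained in \<open>X\<close>.\<close>

definition tropical_variety ::
    "('n::finite, 'k::field hahn) mpoly set \<Rightarrow> (real ^ 'n) set set"
  where "tropical_variety I =
    {C \<in> groebner_complex I. C \<subseteq> {\<omega>. \<not> contains_monomial (initial_ideal \<omega> I)}}"

text \<open>The automorphism of \<open>L[x]\<close> given by \<open>g\<close> uses column \<open>i\<close> of \<open>g\<close> for the image of
  \<open>x\<^sub>i\<close>; the entries are constant series.\<close>

definition linear_action ::
    "'k::field ^ 'n ^ 'n \<Rightarrow> ('n::finite, 'k hahn) mpoly \<Rightarrow> ('n, 'k hahn) mpoly"
  where "linear_action g = msubst (\<lambda>i. \<Sum>j\<in>UNIV. mconst (hsingle 0 (g $ j $ i)) * mvar j)"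

end

theory Submission
  imports Defs "Jordan_Normal_Form.Determinant"
begin

text \<open>
Fix a graded ideal \<open>I\<close> and a constant invertible matrix \<open>g\<close>, and let \<open>V\<close> be the part of \<open>g(I)\<close> of degree
at most \<open>d\<close>, a finite-dimensional space over the field of series.

An initial ideal is the image of the ideal under a partially defined ring homomorphism: \<open>reduce \<omega>\<close> reads
off residues after the substitution \<open>x\<^sub>i \<mapsto> t^\<omega>\<^sub>i x\<^sub>i\<close> and is defined where these exist
(\<open>initial_ideal_eq_reduce\<close>). In degrees up to \<open>d\<close> the initial ideal is therefore the reduction of a lattice
in \<open>V\<close>, and the Pluecker coordinates of the reduction are, after scaling, the residues of those of \<open>V\<close>. The coordinate
\<open>p\<^sub>J\<close>, belonging to the monomials \<open>J\<close>, survives exactly if the affine function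
\<open>v(p\<^sub>J) + \<omega> \<cdot> \<Sum>J\<close> of \<open>\<omega>\<close> is minimal among all of them. So two weights give the same reduction if and
only if they have the same minimisers (\<open>reduction_eq_iff\<close>), and the closures of the classes of such weights
are the cells of the polyhedral complex on which a minimum of finitely many affine functions is
linear (\<open>polyhedral_complex_cells\<close>).

One degree bound \<open>D\<close> suffices for all \<open>\<omega>\<close> and all \<open>g\<close>. Reduction keeps the dimension, and \<open>g\<close> keeps degrees, so
all initial ideals of all \<open>g(I)\<close> have the Hilbert function of \<open>I\<close>. Ideals with a given Hilbert function
are generated in degrees bounded in terms of this function (\<open>ideals_determined_up_to_degree\<close>): passing
to leading monomials turns this into a statement about upward closed sets of exponents, which
follows from Dickson's lemma and a compactness argument (\<open>upset_generation_degree_bound\<close>).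

Hence the Groebner complex of \<open>g(I)\<close> depends only on which Pluecker coordinates of \<open>V\<close> vanish and on the
valuations of the others. Since \<open>g\<close> has constant entries, all these coordinates lie in one
finite-dimensional space over \<open>K\<close> that does not depend on \<open>g\<close>, and the nonzero elements of such a space
have only finitely many valuations (\<open>finite_hval_span\<close>). This leaves finitely many Groebner complexes,
each with finitely many subcomplexes, and the tropical varieties are among these.
\<close>

section \<open>Bounded generation of monomial sets\<close>

definition mdeg :: "('n::finite \<Rightarrow>\<^sub>0 nat) \<Rightarrow> nat"
  where "mdeg \<nu> = (\<Sum>i\<in>UNIV. Poly_Mapping.lookup \<nu> i)"

definition monos_upto :: "nat \<Rightarrow> ('n::finite \<Rightarrow>\<^sub>0 nat) set"
  where "monos_upto d = {\<nu>. mdeg \<nu> \<le> d}"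

lemma mdeg_add: "mdeg (\<alpha> + \<beta>) = mdeg \<alpha> + mdeg \<beta>"
  by (simp add: mdeg_def lookup_add sum.distrib)

lemma monos_upto_mono: "d \<le> e \<Longrightarrow> monos_upto d \<subseteq> monos_upto e"
  by (auto simp: monos_upto_def)

lemma finite_monos_upto: "finite (monos_upto d :: ('n::finite \<Rightarrow>\<^sub>0 nat) set)"
proof -
  have "Poly_Mapping.lookup \<nu> i \<le> d" if "\<nu> \<in> monos_upto d" for \<nu> :: "'n \<Rightarrow>\<^sub>0 nat" and i
  proof -
    have "Poly_Mapping.lookup \<nu> i \<le> mdeg \<nu>"
      unfolding mdeg_def by (rule member_le_sum) auto
    with that show ?thesis by (simp add: monos_upto_def)
  qed
  then have "Poly_Mapping.lookup ` (monos_upto d :: ('n \<Rightarrow>\<^sub>0 nat) set) \<subseteq> PiE UNIV (\<lambda>_. {..d})" by auto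
  then have "finite (Poly_Mapping.lookup ` (monos_upto d :: ('n \<Rightarrow>\<^sub>0 nat) set))"
    by (rule finite_subset) (intro finite_PiE, auto)
  then show ?thesis
    by (rule finite_imageD) (auto simp: inj_on_def intro: poly_mapping_eqI)
qed

text \<open>A decreasing sequence of natural numbers is eventually constant, so the monotone subsequence that
  every sequence has can be made nondecreasing by dropping an initial part.\<close>

lemma nat_seq_mono_subseq:
  fixes s :: "nat \<Rightarrow> nat"
  shows "\<exists>f :: nat \<Rightarrow> nat. strict_mono f \<and> mono (\<lambda>k. s (f k))"
proof -
  obtain f where f: "strict_mono f" "monoseq (\<lambda>n. s (f n))" using seq_monosub by blast
  show ?thesis
  proof (cases "mono (\<lambda>n. s (f n))")
    case False
    then have dec: "\<And>m n. m \<le> n \<Longrightarrow> s (f n) \<le> s (f m)"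
      using f(2) unfolding monoseq_def mono_def by blast
    obtain N where N: "\<And>n. s (f N) \<le> s (f n)"
      using ex_has_least_nat[of "\<lambda>_. True" _ "\<lambda>n. s (f n)"] by auto
    have "mono (\<lambda>k. s (f (N + k)))"
      using N dec by (auto simp: mono_def) (meson le_add1 order_trans)
    moreover have "strict_mono (\<lambda>k. f (N + k))" using f(1) by (simp add: strict_mono_def)
    ultimately show ?thesis by blast
  qed (use f in blast)
qed

lemma coordinatewise_mono_subseq:
  fixes s :: "nat \<Rightarrow> 'i \<Rightarrow> nat"
  assumes "finite S"
  shows "\<exists>f :: nat \<Rightarrow> nat. strict_mono f \<and> (\<forall>i\<in>S. mono (\<lambda>k. s (f k) i))"
  using assms
proof (induction S)
  case empty
  show ?case by (auto intro!: exI[of _ id] strict_mono_id)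
next
  case (insert i S)
  obtain f :: "nat \<Rightarrow> nat" where f: "strict_mono f" "\<And>i. i \<in> S \<Longrightarrow> mono (\<lambda>k. s (f k) i)" using insert.IH by blast
  obtain g :: "nat \<Rightarrow> nat" where g: "strict_mono g" "mono (\<lambda>k. s (f (g k)) i)"
    using nat_seq_mono_subseq[of "\<lambda>k. s (f k) i"] by blast
  have "mono g" using g(1) by (rule strict_mono_mono)
  then have "mono (\<lambda>k. s (f (g k)) j)" if "j \<in> insert i S" for j
    using that g(2) f(2)[of j] by (auto simp: mono_def)
  moreover have "strict_mono (\<lambda>k. f (g k))" using f(1) g(1) by (simp add: strict_mono_def)
  ultimately show ?case by blast
qed

text \<open>The witness consists of the minimal exponents for divisibility. Were there infinitely many, a
  coordinatewise nondecreasing subsequence would contain two of them that are comparable.\<close>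

lemma dickson:
  fixes M :: "('n::finite \<Rightarrow>\<^sub>0 nat) set"
  shows "\<exists>B. finite B \<and> B \<subseteq> M \<and> (\<forall>\<alpha>\<in>M. \<exists>\<beta>\<in>B. \<exists>\<gamma>. \<alpha> = \<beta> + \<gamma>)"
proof -
  define le :: "('n \<Rightarrow>\<^sub>0 nat) \<Rightarrow> ('n \<Rightarrow>\<^sub>0 nat) \<Rightarrow> bool"
    where "le \<beta> \<alpha> \<longleftrightarrow> (\<forall>i. Poly_Mapping.lookup \<beta> i \<le> Poly_Mapping.lookup \<alpha> i)" for \<beta> \<alpha>
  have le_trans: "le \<alpha> \<gamma>" if "le \<alpha> \<beta>" "le \<beta> \<gamma>" for \<alpha> \<beta> \<gamma>
    using that unfolding le_def by (metis order.trans)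
  have le_add: "\<alpha> = \<beta> + (\<alpha> - \<beta>)" if "le \<beta> \<alpha>" for \<alpha> \<beta>
    using that by (intro poly_mapping_eqI) (simp add: le_def lookup_add lookup_minus)
  have le_deg: "mdeg \<beta> < mdeg \<alpha>" if "le \<beta> \<alpha>" "\<beta> \<noteq> \<alpha>" for \<alpha> \<beta>
  proof -
    obtain i where i: "Poly_Mapping.lookup \<beta> i \<noteq> Poly_Mapping.lookup \<alpha> i"
      using \<open>\<beta> \<noteq> \<alpha>\<close> by (auto simp: poly_mapping_eq_iff fun_eq_iff)
    have less: "Poly_Mapping.lookup \<beta> i < Poly_Mapping.lookup \<alpha> i"
      using i \<open>le \<beta> \<alpha>\<close> by (simp add: le_def le_neq_implies_less)
    show ?thesis unfolding mdeg_def
    proof (rule sum_strict_mono_ex1)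
      show "\<forall>i\<in>UNIV. Poly_Mapping.lookup \<beta> i \<le> Poly_Mapping.lookup \<alpha> i"
        using \<open>le \<beta> \<alpha>\<close> by (simp add: le_def)
    qed (use less in auto)
  qed
  define B where "B = {\<beta> \<in> M. \<forall>\<alpha>\<in>M. le \<alpha> \<beta> \<longrightarrow> \<alpha> = \<beta>}"
  have "finite B"
  proof (rule ccontr)
    assume "infinite B"
    then obtain s :: "nat \<Rightarrow> ('n \<Rightarrow>\<^sub>0 nat)" where s: "inj s" "range s \<subseteq> B"
      using infinite_countable_subset by blast
    obtain f :: "nat \<Rightarrow> nat" where f: "strict_mono f" "\<And>i. mono (\<lambda>k. Poly_Mapping.lookup (s (f k)) i)"
      using coordinatewise_mono_subseq[of UNIV "\<lambda>k. Poly_Mapping.lookup (s k)"] by auto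
    have "le (s (f 0)) (s (f 1))" using f(2) by (auto simp: le_def mono_def)
    moreover have "s (f 0) \<in> M" "s (f 1) \<in> B" using s(2) by (auto simp: B_def)
    ultimately have "s (f 0) = s (f 1)" unfolding B_def by blast
    then have "f 0 = f 1" using s(1) by (simp add: inj_def)
    then show False using strict_mono_less[OF f(1), of 0 1] by simp
  qed
  moreover have "\<exists>\<beta>\<in>B. \<exists>\<gamma>. \<alpha> = \<beta> + \<gamma>" if \<alpha>: "\<alpha> \<in> M" for \<alpha>
  proof -
    have "\<alpha> \<in> M \<and> le \<alpha> \<alpha>" using \<alpha> by (simp add: le_def)
    from ex_has_least_nat[of "\<lambda>\<beta>. \<beta> \<in> M \<and> le \<beta> \<alpha>", OF this, of mdeg]
    obtain \<beta> where \<beta>: "\<beta> \<in> M \<and> le \<beta> \<alpha>" and min: "\<And>\<gamma>. \<gamma> \<in> M \<and> le \<gamma> \<alpha> \<Longrightarrow> mdeg \<beta> \<le> mdeg \<gamma>"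
      by blast
    have "\<beta> \<in> B" unfolding B_def
    proof (intro CollectI conjI ballI impI)
      fix \<gamma> assume \<gamma>: "\<gamma> \<in> M" "le \<gamma> \<beta>"
      then have "le \<gamma> \<alpha>" using \<beta> le_trans by blast
      then have "\<not> mdeg \<gamma> < mdeg \<beta>" using min[of \<gamma>] \<gamma>(1) by simp
      then show "\<gamma> = \<beta>" using \<gamma>(2) le_deg by blast
    qed (use \<beta> in simp)
    then show ?thesis using le_add[of \<beta> \<alpha>] \<beta> by blast
  qed
  moreover have "B \<subseteq> M" by (auto simp: B_def)
  ultimately show ?thesis by blast
qed

definition upset :: "('n::finite \<Rightarrow>\<^sub>0 nat) set \<Rightarrow> bool"
  where "upset M \<longleftrightarrow> (\<forall>\<alpha>\<in>M. \<forall>\<beta>. \<alpha> + \<beta> \<in> M)"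

text \<open>Suppose that for every \<open>D\<close> some set \<open>M D\<close> with Hilbert function \<open>H\<close> needs generators of degree greater than
  \<open>D\<close>. There are finitely many candidates for the part of a set in each degree range, so by Koenig's lemma
  there is a limit \<open>L\<close> such that every finite part of \<open>L\<close> is shared by infinitely many \<open>M D\<close>. The limit is
  finitely generated by Dickson's lemma. An \<open>M D\<close> that agrees with \<open>L\<close> up to the degree of these
  generators contains \<open>L\<close>, and the equality of Hilbert functions forces \<open>M D = L\<close>, so \<open>M D\<close> is generated in
  low degree after all.\<close>

theorem upset_generation_degree_bound:
  fixes H :: "nat \<Rightarrow> nat"
  shows "\<exists>D. \<forall>M :: ('n::finite \<Rightarrow>\<^sub>0 nat) set. upset M \<and> (\<forall>d. card (M \<inter> monos_upto d) = H d) \<longrightarrow>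
    (\<forall>\<alpha>\<in>M. \<exists>\<beta>\<in>M \<inter> monos_upto D. \<exists>\<gamma>. \<alpha> = \<beta> + \<gamma>)"
proof (rule ccontr)
  assume "\<not> ?thesis"
  then have "\<forall>D. \<exists>M :: ('n \<Rightarrow>\<^sub>0 nat) set. upset M \<and> (\<forall>d. card (M \<inter> monos_upto d) = H d) \<and>
    \<not> (\<forall>\<alpha>\<in>M. \<exists>\<beta>\<in>M \<inter> monos_upto D. \<exists>\<gamma>. \<alpha> = \<beta> + \<gamma>)"
    by (simp only: not_ex not_all not_imp conj_assoc simp_thms)
  then obtain M :: "nat \<Rightarrow> ('n \<Rightarrow>\<^sub>0 nat) set" where *: "\<forall>D. upset (M D) \<and>
      (\<forall>d. card (M D \<inter> monos_upto d) = H d) \<and>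
      \<not> (\<forall>\<alpha>\<in>M D. \<exists>\<beta>\<in>M D \<inter> monos_upto D. \<exists>\<gamma>. \<alpha> = \<beta> + \<gamma>)"
    by (rule choice[THEN exE])
  have M: "upset (M D)" "card (M D \<inter> monos_upto d) = H d"
      "\<not> (\<forall>\<alpha>\<in>M D. \<exists>\<beta>\<in>M D \<inter> monos_upto D. \<exists>\<gamma>. \<alpha> = \<beta> + \<gamma>)" for D d
    using *[rule_format, of D] by simp_all
  define good where "good d T \<longleftrightarrow> infinite {D. M D \<inter> monos_upto d = T}" for d T
  have refine: "\<exists>T'. infinite {D \<in> A. M D \<inter> monos_upto d = T'}" if "infinite A" for A d
  proof -
    have "finite ((\<lambda>D. M D \<inter> monos_upto d) ` A)"
      by (rule finite_subset[of _ "Pow (monos_upto d)"]) (auto simp: finite_monos_upto)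
    from pigeonhole_infinite[OF that this] show ?thesis by blast
  qed
  have "\<exists>T. \<forall>d. good d (T d) \<and> T (Suc d) \<inter> monos_upto d = T d"
  proof (rule dependent_nat_choice)
    show "\<exists>T. good 0 T" using refine[OF infinite_UNIV_nat, of 0] by (simp add: good_def)
  next
    fix T d assume "good d T"
    then have "infinite {D. M D \<inter> monos_upto d = T}" by (simp add: good_def)
    from refine[OF this, of "Suc d"]
    obtain T' where T': "infinite {D \<in> {D. M D \<inter> monos_upto d = T}. M D \<inter> monos_upto (Suc d) = T'}"
      by (rule exE)
    have "{D \<in> {D. M D \<inter> monos_upto d = T}. M D \<inter> monos_upto (Suc d) = T'}
        \<subseteq> {D. M D \<inter> monos_upto (Suc d) = T'}" by blast
    from infinite_super[OF this T'] have "good (Suc d) T'" by (simp add: good_def)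
    moreover obtain D where "M D \<inter> monos_upto d = T" "M D \<inter> monos_upto (Suc d) = T'"
      using infinite_imp_nonempty[OF T'] by blast
    then have "T' \<inter> monos_upto d = T" using monos_upto_mono[OF le_SucI[OF order_refl], of d] by blast
    ultimately show "\<exists>T'. good (Suc d) T' \<and> T' \<inter> monos_upto d = T" by blast
  qed
  then obtain T where T: "\<And>d. good d (T d)" "\<And>d. T (Suc d) \<inter> monos_upto d = T d" by blast
  have T_restrict: "T (d + k) \<inter> monos_upto d = T d" for d k
  proof (induction k)
    case 0
    obtain D where "M D \<inter> monos_upto d = T d"
      using infinite_imp_nonempty[OF T(1)[of d, unfolded good_def]] by blast
    then show ?case by auto
  next
    case (Suc k)
    have "monos_upto d \<subseteq> (monos_upto (d + k) :: ('n \<Rightarrow>\<^sub>0 nat) set)" by (rule monos_upto_mono) simp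
    then show ?case using T(2)[of "d + k"] Suc by auto
  qed
  define L where "L = (\<Union>d. T d)"
  have L: "L \<inter> monos_upto d = T d" for d
  proof
    show "T d \<subseteq> L \<inter> monos_upto d" using T_restrict[of d 0] by (auto simp: L_def)
    show "L \<inter> monos_upto d \<subseteq> T d"
    proof
      fix \<nu> assume "\<nu> \<in> L \<inter> monos_upto d"
      then obtain e where e: "\<nu> \<in> T e" "\<nu> \<in> monos_upto d" by (auto simp: L_def)
      show "\<nu> \<in> T d"
      proof (cases "d \<le> e")
        case True
        then show ?thesis using T_restrict[of d "e - d"] e by auto
      next
        case False
        then show ?thesis using T_restrict[of e "d - e"] e by auto
      qed
    qed
  qed
  have witness: "\<exists>D\<ge>D0. M D \<inter> monos_upto d = L \<inter> monos_upto d" for d D0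
  proof -
    have "infinite ({D. M D \<inter> monos_upto d = T d} - {..<D0})"
      using T(1)[of d] by (auto simp: good_def)
    then obtain D where "D \<in> {D. M D \<inter> monos_upto d = T d} - {..<D0}"
      using infinite_imp_nonempty by blast
    then show ?thesis using L by (intro exI[of _ D]) auto
  qed
  obtain B where B: "finite B" "B \<subseteq> L" "\<And>\<alpha>. \<alpha> \<in> L \<Longrightarrow> \<exists>\<beta>\<in>B. \<exists>\<gamma>. \<alpha> = \<beta> + \<gamma>"
    using dickson[of L] by blast
  define d where "d = Max (insert 0 (mdeg ` B))"
  have Bd: "B \<subseteq> monos_upto d" using B(1) by (auto simp: d_def monos_upto_def)
  obtain D where D: "D \<ge> d" "M D \<inter> monos_upto d = L \<inter> monos_upto d" using witness by blast
  have sub: "L \<subseteq> M D"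
  proof
    fix \<alpha> assume "\<alpha> \<in> L"
    then obtain \<beta> \<gamma> where "\<beta> \<in> B" "\<alpha> = \<beta> + \<gamma>" using B(3) by blast
    moreover from this have "\<beta> \<in> M D" using B(2) Bd D(2) by blast
    ultimately show "\<alpha> \<in> M D" using M(1) by (auto simp: upset_def)
  qed
  have "M D \<subseteq> L"
  proof
    fix \<alpha> assume \<alpha>: "\<alpha> \<in> M D"
    obtain D' where D': "M D' \<inter> monos_upto (mdeg \<alpha>) = L \<inter> monos_upto (mdeg \<alpha>)" using witness by blast
    have "card (L \<inter> monos_upto (mdeg \<alpha>)) = card (M D \<inter> monos_upto (mdeg \<alpha>))"
      using M(2)[of D] M(2)[of D' "mdeg \<alpha>"] D' by simp
    then have "L \<inter> monos_upto (mdeg \<alpha>) = M D \<inter> monos_upto (mdeg \<alpha>)"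
      using sub by (intro card_subset_eq) (auto simp: finite_monos_upto)
    then show "\<alpha> \<in> L" using \<alpha> by (auto simp: monos_upto_def)
  qed
  moreover have "B \<subseteq> M D \<inter> monos_upto D"
    using B(2) sub Bd monos_upto_mono[OF D(1)] by blast
  ultimately have "\<forall>\<alpha>\<in>M D. \<exists>\<beta>\<in>M D \<inter> monos_upto D. \<exists>\<gamma>. \<alpha> = \<beta> + \<gamma>"
    using B(3) by (meson subsetD)
  then show False using M(3) by blast
qed

section \<open>Bases of polynomial spaces and Pluecker coordinates\<close>

lemma lookup_mconst_mult:
  "Poly_Mapping.lookup (mconst c * f) \<nu> = (c :: 'a::comm_ring_1) * Poly_Mapping.lookup f \<nu>"
  unfolding mconst_def mult_map_scale_conv_mult[symmetric]
  by (simp add: map.rep_eq when_def)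

lemma vector_space_mpoly:
  "vector_space (\<lambda>(c::'a::field) (f :: ('n, 'a) mpoly). mconst c * f)"
  by unfold_locales
     (rule poly_mapping_eqI,
      simp only: lookup_mconst_mult lookup_add distrib_left distrib_right mult.assoc mult_1_left)+

interpretation lin: vector_space "\<lambda>(c::'a::field) (f :: ('n, 'a) mpoly). mconst c * f"
  by (rule vector_space_mpoly)

definition lincomb :: "nat \<Rightarrow> (nat \<Rightarrow> 'a::comm_ring_1) \<Rightarrow> (nat \<Rightarrow> ('n, 'a) mpoly) \<Rightarrow> ('n, 'a) mpoly"
  where "lincomb r a f = (\<Sum>i<r. mconst (a i) * f i)"

lemma lookup_lincomb:
  "Poly_Mapping.lookup (lincomb r a f) \<nu> = (\<Sum>i<r. a i * Poly_Mapping.lookup (f i) \<nu>)"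
  by (simp add: lincomb_def lookup_sum lookup_mconst_mult)

lemma lincomb_rangeI: "x = lincomb r a f \<Longrightarrow> x \<in> range (\<lambda>a. lincomb r a f)"
  by (rule image_eqI[of x "\<lambda>a. lincomb r a f" a]) simp_all

text \<open>Bases are families indexed by \<open>{..<r}\<close>, because the determinants formed from them need an order on the
  basis elements.\<close>

definition lin_basis :: "nat \<Rightarrow> (nat \<Rightarrow> ('n, 'a::comm_ring_1) mpoly) \<Rightarrow> ('n, 'a) mpoly set \<Rightarrow> bool"
  where "lin_basis r f V \<longleftrightarrow>
    V = range (\<lambda>a. lincomb r a f) \<and> (\<forall>a. lincomb r a f = 0 \<longrightarrow> (\<forall>i<r. a i = 0))"

lemma lin_basis_range: "lin_basis r f V \<Longrightarrow> V = range (\<lambda>a. lincomb r a f)"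
  unfolding lin_basis_def by (rule conjunct1)

lemma lincomb_unit:
  assumes "i < r"
  shows "lincomb r (\<lambda>k. if k = i then 1 else 0) f = f i"
  by (rule poly_mapping_eqI)
     (use assms in \<open>simp add: lookup_lincomb if_distrib[of "\<lambda>x. x * _"] cong: if_cong\<close>)

lemma lin_basis_mem:
  assumes "lin_basis r f V" "i < r"
  shows "f i \<in> V"
proof -
  have "f i \<in> range (\<lambda>a. lincomb r a f)"
    by (subst lincomb_unit[OF assms(2), of f, symmetric]) (rule rangeI)
  then show ?thesis by (subst lin_basis_range[OF assms(1)])
qed

lemma lin_basis_dim:
  fixes f :: "nat \<Rightarrow> ('n, 'a::field) mpoly"
  assumes "lin_basis r f V"
  shows "lin.dim V = r"
proof -
  have V: "V = range (\<lambda>a. lincomb r a f)" and ind: "\<And>a i. lincomb r a f = 0 \<Longrightarrow> i < r \<Longrightarrow> a i = 0"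
    using assms by (auto simp: lin_basis_def)
  have inj: "inj_on f {..<r}"
  proof (rule inj_onI)
    fix i j assume ij: "i \<in> {..<r}" "j \<in> {..<r}" "f i = f j"
    show "i = j"
    proof (rule ccontr)
      assume "i \<noteq> j"
      have "lincomb r (\<lambda>k. (if k = i then 1 else 0) - (if k = j then 1 else 0)) f = f i - f j"
        using lincomb_unit[of i r f] lincomb_unit[of j r f] ij(1,2)
        by (intro poly_mapping_eqI) (simp add: lookup_lincomb left_diff_distrib sum_subtractf lookup_minus poly_mapping_eq_iff fun_eq_iff)
      then have "(if i = i then 1 else 0) - (if i = j then 1 else (0::'a)) = 0"
        using ind[of _ i] ij by fastforce
      with \<open>i \<noteq> j\<close> show False by simp
    qed
  qed
  have comb: "(\<Sum>v\<in>f ` {..<r}. mconst (u v) * v) = lincomb r (\<lambda>i. u (f i)) f" for u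
    by (simp add: sum.reindex[OF inj] lincomb_def)
  have "lin.span (f ` {..<r}) = range (\<lambda>u. lincomb r (\<lambda>i. u (f i)) f)"
    by (subst lin.span_finite) (simp_all add: comb)
  also have "\<dots> = V"
  proof
    show "V \<subseteq> range (\<lambda>u. lincomb r (\<lambda>i. u (f i)) f)"
    proof
      fix x assume "x \<in> V"
      then obtain a where a: "x = lincomb r a f" using V by blast
      have "lincomb r (\<lambda>i. (a \<circ> the_inv_into {..<r} f) (f i)) f = lincomb r a f"
        unfolding lincomb_def by (rule sum.cong) (simp_all add: the_inv_into_f_f[OF inj])
      then show "x \<in> range (\<lambda>u. lincomb r (\<lambda>i. u (f i)) f)" using a by (metis rangeI)
    qed
  qed (auto simp: V)
  finally have span: "lin.span (f ` {..<r}) = V" .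
  have "lin.independent (f ` {..<r})"
  proof (rule lin.independent_if_scalars_zero)
    fix u x assume "(\<Sum>x\<in>f ` {..<r}. mconst (u x) * x) = 0" "x \<in> f ` {..<r}"
    then show "u x = 0" using ind[of "\<lambda>i. u (f i)"] by (auto simp: comb)
  qed simp
  then have "lin.dim V = card (f ` {..<r})"
    using lin.dim_span_eq_card_independent span by metis
  then show ?thesis by (simp add: card_image[OF inj])
qed

text \<open>A family that is dual to the coordinates \<open>J\<close> is independent, so only spanning has to be checked.\<close>

lemma lin_basisI_dual:
  assumes "V = range (\<lambda>a. lincomb r a f)"
    and "\<And>i j. i < r \<Longrightarrow> j < r \<Longrightarrow> Poly_Mapping.lookup (f i) (J j) = (if i = j then 1 else 0)"
  shows "lin_basis r f V"
  unfolding lin_basis_def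
proof (intro conjI allI impI assms(1))
  fix a i assume a: "lincomb r a f = 0" and i: "i < r"
  have "0 = Poly_Mapping.lookup (lincomb r a f) (J i)" by (simp add: a)
  also have "\<dots> = (\<Sum>k<r. if k = i then a i else 0)"
    unfolding lookup_lincomb by (rule sum.cong) (use assms(2) i in auto)
  also have "\<dots> = a i" using i by simp
  finally show "a i = 0" by simp
qed

lemma lin_basis_dual_expand:
  assumes "lin_basis r f V" "x \<in> V"
    and dual: "\<And>i j. i < r \<Longrightarrow> j < r \<Longrightarrow> Poly_Mapping.lookup (f i) (J j) = (if i = j then 1 else 0)"
  shows "x = lincomb r (\<lambda>i. Poly_Mapping.lookup x (J i)) f"
proof -
  obtain a where a: "x = lincomb r a f" using assms(2) lin_basis_range[OF assms(1)] by auto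
  have "Poly_Mapping.lookup x (J i) = a i" if i: "i < r" for i
  proof -
    have "Poly_Mapping.lookup x (J i) = (\<Sum>k<r. if k = i then a i else 0)"
      unfolding a lookup_lincomb by (rule sum.cong) (use dual i in auto)
    then show ?thesis using i by simp
  qed
  then show ?thesis unfolding a lincomb_def by (intro sum.cong) auto
qed

text \<open>The size of the determinants below is the dimension of a space and hence a term, so they are taken
  over matrices with explicit dimensions.\<close>

definition det_fun :: "nat \<Rightarrow> (nat \<Rightarrow> nat \<Rightarrow> 'a::comm_ring_1) \<Rightarrow> 'a"
  where "det_fun r m = Determinant.det (Matrix.mat r r (\<lambda>(i, j). m i j))"

lemma det_fun_leibniz:
  "det_fun r m = (\<Sum>p | p permutes {0..<r}. of_int (sign p) * (\<Prod>i = 0..<r. m i (p i)))"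
proof -
  have "(\<Prod>i = 0..<r. Matrix.mat r r (\<lambda>(i, j). m i j) $$ (i, p i)) = (\<Prod>i = 0..<r. m i (p i))"
    if "p permutes {0..<r}" for p
    by (rule prod.cong[OF refl]) (use permutes_in_image[OF that] in \<open>simp add: Ball_def\<close>)
  then show ?thesis
    unfolding det_fun_def by (subst det_def'[of _ r]) (auto intro!: sum.cong)
qed

lemma det_fun_cong: "(\<And>i j. i < r \<Longrightarrow> j < r \<Longrightarrow> m i j = m' i j) \<Longrightarrow> det_fun r m = det_fun r m'"
  unfolding det_fun_def by (rule arg_cong[of _ _ Determinant.det]) (auto intro: eq_matI)

lemma det_fun_mult: "det_fun r (\<lambda>i j. \<Sum>k<r. m i k * m' k j) = det_fun r m * det_fun r m'"
proof -
  have "Matrix.mat r r (\<lambda>(i, j). \<Sum>k<r. m i k * m' k j) =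
      Matrix.mat r r (\<lambda>(i, j). m i j) * Matrix.mat r r (\<lambda>(i, j). m' i j)"
    by (rule eq_matI) (auto simp: scalar_prod_def lessThan_atLeast0)
  then show ?thesis unfolding det_fun_def by (simp add: det_mult[of _ r])
qed

lemma det_fun_one: "det_fun r (\<lambda>i j. if i = j then 1 else 0) = 1"
proof -
  have one: "Matrix.mat r r (\<lambda>(i, j). if i = j then 1 else 0) = 1\<^sub>m r" by (rule eq_matI) auto
  show ?thesis unfolding det_fun_def one by (rule det_one)
qed

lemma det_fun_replace_col:
  assumes "i < r"
  shows "det_fun r (\<lambda>k j. if j = i then v k else if k = j then 1 else 0) = v i"
proof -
  let ?v = "Matrix.vec r v"
  have "Matrix.mat r r (\<lambda>(k, j). if j = i then v k else if k = j then 1 else 0)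
      = replace_col (1\<^sub>m r) (1\<^sub>m r *\<^sub>v ?v) i"
    by (rule eq_matI) (auto simp: replace_col_def)
  then show ?thesis
    using cramer_lemma_mat[of "1\<^sub>m r" r ?v i] assms by (simp add: det_fun_def)
qed

lemma det_fun_inverse:
  fixes m :: "nat \<Rightarrow> nat \<Rightarrow> 'a::field"
  assumes "det_fun r m \<noteq> 0"
  shows "\<exists>w. \<forall>i<r. \<forall>j<r. (\<Sum>k<r. w i k * m k j) = (if i = j then 1 else 0) \<and>
    (\<Sum>k<r. m i k * w k j) = (if i = j then 1 else 0)"
proof -
  let ?M = "Matrix.mat r r (\<lambda>(i, j). m i j)"
  let ?w = "\<lambda>i j. adj_mat ?M $$ (i, j) / det_fun r m"
  have M: "?M \<in> carrier_mat r r" by simp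
  note adj = adj_mat[OF M]
  have a: "(\<Sum>k<r. adj_mat ?M $$ (i, k) * m k j) = (if i = j then det_fun r m else 0)"
    if "i < r" "j < r" for i j
  proof -
    have "(adj_mat ?M * ?M) $$ (i, j) = (\<Sum>k<r. adj_mat ?M $$ (i, k) * m k j)"
      using that adj(1) by (auto simp: scalar_prod_def lessThan_atLeast0 intro!: sum.cong)
    then have "\<dots> = (Determinant.det ?M \<cdot>\<^sub>m 1\<^sub>m r) $$ (i, j)" by (simp only: adj(3))
    also have "\<dots> = (if i = j then det_fun r m else 0)" using that by (simp add: det_fun_def)
    finally show ?thesis .
  qed
  have b: "(\<Sum>k<r. m i k * adj_mat ?M $$ (k, j)) = (if i = j then det_fun r m else 0)"
    if "i < r" "j < r" for i j
  proof -
    have "(?M * adj_mat ?M) $$ (i, j) = (\<Sum>k<r. m i k * adj_mat ?M $$ (k, j))"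
      using that adj(1) by (auto simp: scalar_prod_def lessThan_atLeast0 intro!: sum.cong)
    then have "\<dots> = (Determinant.det ?M \<cdot>\<^sub>m 1\<^sub>m r) $$ (i, j)" by (simp only: adj(2))
    also have "\<dots> = (if i = j then det_fun r m else 0)" using that by (simp add: det_fun_def)
    finally show ?thesis .
  qed
  show ?thesis
    by (rule exI[of _ ?w])
       (use a b assms in \<open>auto simp: sum_divide_distrib[symmetric] times_divide_eq_left times_divide_eq_right\<close>)
qed

text \<open>The maximal minors of the coefficient matrix of \<open>f\<close>. The columns are selected by a tuple \<open>J\<close> of monomials
  instead of a set; repetitions do no harm, as the minor is then zero, and reordering only changes
  signs.\<close>

definition pluecker :: "nat \<Rightarrow> (nat \<Rightarrow> ('n, 'a::comm_ring_1) mpoly) \<Rightarrow> (nat \<Rightarrow> ('n \<Rightarrow>\<^sub>0 nat)) \<Rightarrow> 'a"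
  where "pluecker r f J = det_fun r (\<lambda>i j. Poly_Mapping.lookup (f i) (J j))"

lemma pluecker_lincomb:
  assumes "\<And>i. i < r \<Longrightarrow> f' i = lincomb r (m i) f"
  shows "pluecker r f' J = det_fun r m * pluecker r f J"
  unfolding pluecker_def det_fun_mult[symmetric]
  by (rule det_fun_cong) (simp add: assms lookup_lincomb)

lemma pluecker_dual:
  assumes "\<And>i j. i < r \<Longrightarrow> j < r \<Longrightarrow> Poly_Mapping.lookup (f i) (J j) = (if i = j then 1 else 0)"
  shows "pluecker r f J = 1"
  unfolding pluecker_def by (subst det_fun_cong[OF assms]) (simp_all add: det_fun_one)

text \<open>Exchanging one column of the identity matrix gives a determinant with a single relevant entry. So the
  coefficients of a dual basis are themselves Pluecker coordinates.\<close>

lemma pluecker_dual_exchange: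
  assumes "\<And>i j. i < r \<Longrightarrow> j < r \<Longrightarrow> Poly_Mapping.lookup (f i) (J j) = (if i = j then 1 else 0)"
    and "i < r"
  shows "pluecker r f (J(i := \<nu>)) = Poly_Mapping.lookup (f i) \<nu>"
proof -
  have "pluecker r f (J(i := \<nu>)) =
      det_fun r (\<lambda>k j. if j = i then Poly_Mapping.lookup (f k) \<nu> else if k = j then 1 else 0)"
    unfolding pluecker_def by (rule det_fun_cong) (simp add: assms(1))
  then show ?thesis using det_fun_replace_col[OF assms(2), of "\<lambda>k. Poly_Mapping.lookup (f k) \<nu>"] by simp
qed

lemma lin_basis_change:
  assumes "lin_basis r f V" "lin_basis r f' V"
  shows "\<exists>m. \<forall>i<r. f' i = lincomb r (m i) f"
proof -
  have "f' i \<in> range (\<lambda>a. lincomb r a f)" if "i < r" for i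
    using lin_basis_mem[OF assms(2) that] unfolding lin_basis_range[OF assms(1)] .
  then have "\<forall>i. \<exists>a. i < r \<longrightarrow> f' i = lincomb r a f" by auto
  then show ?thesis by (rule choice)
qed

lemma pluecker_unique_up_to_scalar:
  fixes f :: "nat \<Rightarrow> ('n, 'a::field) mpoly"
  assumes "lin_basis r f V" "lin_basis r f' V" "pluecker r f' J0 \<noteq> 0"
  obtains c where "c \<noteq> 0" "\<And>J. pluecker r f' J = c * pluecker r f J"
proof -
  obtain m where m': "\<forall>i<r. f' i = lincomb r (m i) f"
    using lin_basis_change[OF assms(1,2)] by (rule exE)
  note m = m'[rule_format]
  have "pluecker r f' J = det_fun r m * pluecker r f J" for J by (rule pluecker_lincomb[OF m])
  then show ?thesis using that[of "det_fun r m"] assms(3) by auto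
qed

text \<open>Multiply the basis by the inverse of its minor at \<open>J\<close>.\<close>

lemma lin_basis_dual_exists:
  fixes f :: "nat \<Rightarrow> ('n, 'a::field) mpoly"
  assumes "lin_basis r f V" "pluecker r f J \<noteq> 0"
  obtains f' where "lin_basis r f' V"
    "\<And>i j. i < r \<Longrightarrow> j < r \<Longrightarrow> Poly_Mapping.lookup (f' i) (J j) = (if i = j then 1 else 0)"
proof -
  obtain w where w': "\<forall>i<r. \<forall>j<r. (\<Sum>k<r. w i k * Poly_Mapping.lookup (f k) (J j)) = (if i = j then 1 else 0) \<and>
      (\<Sum>k<r. Poly_Mapping.lookup (f i) (J k) * w k j) = (if i = j then 1 else 0)"
    using det_fun_inverse[OF assms(2)[unfolded pluecker_def]] by (rule exE)
  have w: "(\<Sum>k<r. w i k * Poly_Mapping.lookup (f k) (J j)) = (if i = j then 1 else 0)"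
      "(\<Sum>k<r. Poly_Mapping.lookup (f i) (J k) * w k j) = (if i = j then 1 else 0)"
      if "i < r" "j < r" for i j
    by (rule w'[rule_format, OF that, THEN conjunct1], rule w'[rule_format, OF that, THEN conjunct2])
  define f' where "f' i = lincomb r (w i) f" for i
  have dual: "Poly_Mapping.lookup (f' i) (J j) = (if i = j then 1 else 0)" if "i < r" "j < r" for i j
    using w(1)[OF that] by (simp add: f'_def lookup_lincomb)
  note V = lin_basis_range[OF assms(1)]
  have "V = range (\<lambda>a. lincomb r a f')"
  proof (rule equalityI)
    have collect: "lincomb r a f' = lincomb r (\<lambda>k. \<Sum>i<r. a i * w i k) f" for a
    proof (rule poly_mapping_eqI)
      fix \<nu>
      have "Poly_Mapping.lookup (lincomb r a f') \<nu> = (\<Sum>i<r. \<Sum>k<r. a i * w i k * Poly_Mapping.lookup (f k) \<nu>)"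
        by (simp only: lookup_lincomb f'_def sum_distrib_left mult.assoc)
      also have "\<dots> = (\<Sum>k<r. \<Sum>i<r. a i * w i k * Poly_Mapping.lookup (f k) \<nu>)" by (rule sum.swap)
      finally show "Poly_Mapping.lookup (lincomb r a f') \<nu> = Poly_Mapping.lookup (lincomb r (\<lambda>k. \<Sum>i<r. a i * w i k) f) \<nu>"
        by (simp add: lookup_lincomb sum_distrib_right)
    qed
    show "range (\<lambda>a. lincomb r a f') \<subseteq> V"
      by (rule image_subsetI, subst collect, subst V, rule rangeI)
    have expand: "lincomb r a f = lincomb r (\<lambda>k. \<Sum>i<r. a i * Poly_Mapping.lookup (f i) (J k)) f'" for a
    proof (rule poly_mapping_eqI)
      fix \<nu>
      have "Poly_Mapping.lookup (lincomb r (\<lambda>k. \<Sum>i<r. a i * Poly_Mapping.lookup (f i) (J k)) f') \<nu>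
          = (\<Sum>k<r. \<Sum>i<r. \<Sum>l<r. a i * (Poly_Mapping.lookup (f i) (J k) * w k l) * Poly_Mapping.lookup (f l) \<nu>)"
        by (simp only: lookup_lincomb f'_def sum_distrib_left sum_distrib_right mult.assoc)
           (intro sum.cong refl sum.swap)
      also have "\<dots> = (\<Sum>i<r. \<Sum>k<r. \<Sum>l<r. a i * (Poly_Mapping.lookup (f i) (J k) * w k l) * Poly_Mapping.lookup (f l) \<nu>)"
        by (rule sum.swap)
      also have "\<dots> = (\<Sum>i<r. \<Sum>l<r. \<Sum>k<r. a i * (Poly_Mapping.lookup (f i) (J k) * w k l) * Poly_Mapping.lookup (f l) \<nu>)"
        by (intro sum.cong refl sum.swap)
      also have "\<dots> = (\<Sum>i<r. \<Sum>l<r. a i * (\<Sum>k<r. Poly_Mapping.lookup (f i) (J k) * w k l) * Poly_Mapping.lookup (f l) \<nu>)"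
        by (simp add: sum_distrib_left sum_distrib_right)
      also have "\<dots> = (\<Sum>i<r. \<Sum>l<r. if i = l then a i * Poly_Mapping.lookup (f i) \<nu> else 0)"
        by (intro sum.cong refl) (simp add: w(2))
      also have "\<dots> = Poly_Mapping.lookup (lincomb r a f) \<nu>"
        by (simp add: lookup_lincomb)
      finally show "Poly_Mapping.lookup (lincomb r a f) \<nu> =
          Poly_Mapping.lookup (lincomb r (\<lambda>k. \<Sum>i<r. a i * Poly_Mapping.lookup (f i) (J k)) f') \<nu>" by simp
    qed
    show "V \<subseteq> range (\<lambda>a. lincomb r a f')" unfolding V by (rule image_subsetI, subst expand, rule rangeI)
  qed
  then have "lin_basis r f' V" using dual by (rule lin_basisI_dual)
  with dual show ?thesis using that by blast
qed

section \<open>Leading monomials and Hilbert functions\<close>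

lemma lin_basis_subspace:
  fixes f :: "nat \<Rightarrow> ('n, 'a::field) mpoly"
  assumes "lin_basis r f V"
  shows "lin.subspace V"
proof (subst lin_basis_range[OF assms], rule lin.subspaceI)
  have "lincomb r (\<lambda>_. 0) f = 0" by (rule poly_mapping_eqI) (simp add: lookup_lincomb)
  from this[symmetric] show "0 \<in> range (\<lambda>a. lincomb r a f)" by (rule lincomb_rangeI)
next
  fix x y assume "x \<in> range (\<lambda>a. lincomb r a f)" "y \<in> range (\<lambda>a. lincomb r a f)"
  then obtain a b where x: "x = lincomb r a f" and y: "y = lincomb r b f" by (elim imageE)
  have "x + y = lincomb r (\<lambda>i. a i + b i) f"
    unfolding x y
    by (rule poly_mapping_eqI) (simp only: lookup_lincomb lookup_add distrib_right sum.distrib)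
  then show "x + y \<in> range (\<lambda>a. lincomb r a f)" by (rule lincomb_rangeI)
next
  fix c x assume "x \<in> range (\<lambda>a. lincomb r a f)"
  then obtain a where x: "x = lincomb r a f" by (elim imageE)
  have "mconst c * x = lincomb r (\<lambda>i. c * a i) f"
    unfolding x
    by (rule poly_mapping_eqI) (simp only: lookup_lincomb lookup_mconst_mult sum_distrib_left mult.assoc)
  then show "mconst c * x \<in> range (\<lambda>a. lincomb r a f)" by (rule lincomb_rangeI)
qed

lemma lookup_single_mult:
  "Poly_Mapping.lookup (Poly_Mapping.single \<alpha> c * f) (\<alpha> + \<nu>) = (c :: 'a::comm_ring_1) * Poly_Mapping.lookup f \<nu>"
  for \<alpha> :: "'n \<Rightarrow>\<^sub>0 nat"
proof -
  have "Poly_Mapping.lookup (Poly_Mapping.single \<alpha> c * f) (\<alpha> + \<nu>)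
      = (\<Sum>l. (if l = \<alpha> then c * (\<Sum>q. Poly_Mapping.lookup f q when \<alpha> + \<nu> = l + q) else 0))"
    unfolding lookup_mult by (rule arg_cong[of _ _ Sum_any]) (auto simp: lookup_single when_def fun_eq_iff)
  also have "\<dots> = c * (\<Sum>q. Poly_Mapping.lookup f q when \<alpha> + \<nu> = \<alpha> + q)"
    by (simp add: Sum_any.delta)
  also have "(\<Sum>q. Poly_Mapping.lookup f q when \<alpha> + \<nu> = \<alpha> + q) = Poly_Mapping.lookup f \<nu>"
    by simp
  finally show ?thesis .
qed

lemma keys_single_mult:
  fixes f :: "('n, 'a::comm_ring_1) mpoly"
  assumes "\<mu> \<in> Poly_Mapping.keys (Poly_Mapping.single \<alpha> c * f)"
  obtains \<nu> where "\<nu> \<in> Poly_Mapping.keys f" "\<mu> = \<alpha> + \<nu>"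
  using assms keys_mult[of "Poly_Mapping.single \<alpha> c" f] by (auto split: if_splits)

text \<open>A monomial order given by an injective multiplicative weight in the natural numbers: compatibility
  with multiplication and well-foundedness then come for free from the order of the natural numbers.\<close>

locale multiplicative_weight =
  fixes N :: "('n::finite \<Rightarrow>\<^sub>0 nat) \<Rightarrow> nat"
  assumes weight_inject: "N \<alpha> = N \<beta> \<Longrightarrow> \<alpha> = \<beta>"
    and weight_add: "N (\<alpha> + \<beta>) = N \<alpha> * N \<beta>"
    and weight_pos: "0 < N \<alpha>"

text \<open>Send the variables to distinct primes; injectivity is unique factorisation.\<close>

lemma multiplicative_weight_exists: "\<exists>N :: ('n::finite \<Rightarrow>\<^sub>0 nat) \<Rightarrow> nat. multiplicative_weight N"
proof -
  obtain s :: "nat \<Rightarrow> nat" where s: "inj s" "range s \<subseteq> {p. prime p}"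
    using infinite_countable_subset[OF primes_infinite] by blast
  obtain e :: "'n \<Rightarrow> nat" where e: "inj e"
    using finite_imp_inj_to_nat_seg[of "UNIV :: 'n set"] by auto
  define p where "p i = s (e i)" for i
  have p: "inj p" using s(1) e by (simp add: p_def inj_def)
  have prime_p: "prime (p i)" for i using s(2) rangeI[of s "e i"] unfolding p_def by blast
  define N where "N \<nu> = (\<Prod>i\<in>UNIV. p i ^ Poly_Mapping.lookup \<nu> i)" for \<nu>
  have mult: "multiplicity (p j) (N \<nu>) = Poly_Mapping.lookup \<nu> j" for \<nu> j
  proof -
    have "N \<nu> = (\<Prod>q\<in>range p. q ^ Poly_Mapping.lookup \<nu> (inv_into UNIV p q))"
      unfolding N_def by (subst prod.reindex[OF p]) (simp add: inv_into_f_f[OF p UNIV_I])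
    moreover have "multiplicity (p j) (\<Prod>q\<in>range p. q ^ Poly_Mapping.lookup \<nu> (inv_into UNIV p q))
        = (if p j \<in> range p then Poly_Mapping.lookup \<nu> (inv_into UNIV p (p j)) else 0)"
      by (rule multiplicity_prod_prime_powers) (use prime_p in auto)
    ultimately show ?thesis by (simp add: inv_into_f_f[OF p UNIV_I])
  qed
  have "multiplicative_weight N"
  proof
    fix \<alpha> \<beta> assume eq: "N \<alpha> = N \<beta>"
    show "\<alpha> = \<beta>"
    proof (rule poly_mapping_eqI)
      fix i show "Poly_Mapping.lookup \<alpha> i = Poly_Mapping.lookup \<beta> i"
        using mult[of i \<alpha>] mult[of i \<beta>] by (simp add: eq)
    qed
  next
    show "N (\<alpha> + \<beta>) = N \<alpha> * N \<beta>" for \<alpha> \<beta>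
      by (simp add: N_def lookup_add power_add prod.distrib)
    show "0 < N \<alpha>" for \<alpha>
      unfolding N_def by (rule prod_pos) (use prime_p prime_gt_0_nat in auto)
  qed
  then show ?thesis by blast
qed

context multiplicative_weight
begin

definition lead_mono :: "('n, 'a::zero) mpoly \<Rightarrow> ('n \<Rightarrow>\<^sub>0 nat)"
  where "lead_mono f = (SOME \<nu>. \<nu> \<in> Poly_Mapping.keys f \<and> (\<forall>\<mu>\<in>Poly_Mapping.keys f. N \<mu> \<le> N \<nu>))"

definition lead_monos :: "('n, 'a::zero) mpoly set \<Rightarrow> ('n \<Rightarrow>\<^sub>0 nat) set"
  where "lead_monos V = lead_mono ` (V - {0})"

lemma lead_mono_props:
  fixes f :: "('n, 'a::zero) mpoly"
  assumes "f \<noteq> 0"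
  shows "lead_mono f \<in> Poly_Mapping.keys f" "\<And>\<mu>. \<mu> \<in> Poly_Mapping.keys f \<Longrightarrow> N \<mu> \<le> N (lead_mono f)"
proof -
  have ne: "Poly_Mapping.keys f \<noteq> {}" using assms by (auto simp: poly_mapping_eq_iff fun_eq_iff in_keys_iff)
  have "\<exists>\<nu>. \<nu> \<in> Poly_Mapping.keys f \<and> (\<forall>\<mu>\<in>Poly_Mapping.keys f. N \<mu> \<le> N \<nu>)"
  proof -
    have "Max (N ` Poly_Mapping.keys f) \<in> N ` Poly_Mapping.keys f" using ne by (intro Max_in) auto
    then obtain \<nu> where "\<nu> \<in> Poly_Mapping.keys f" "Max (N ` Poly_Mapping.keys f) = N \<nu>" by auto
    moreover have "N \<mu> \<le> Max (N ` Poly_Mapping.keys f)" if "\<mu> \<in> Poly_Mapping.keys f" for \<mu>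
      using that by (intro Max_ge) auto
    ultimately show ?thesis by auto
  qed
  from someI_ex[OF this] show "lead_mono f \<in> Poly_Mapping.keys f"
    "\<And>\<mu>. \<mu> \<in> Poly_Mapping.keys f \<Longrightarrow> N \<mu> \<le> N (lead_mono f)" unfolding lead_mono_def by auto
qed

lemma lead_mono_eqI:
  assumes "\<nu> \<in> Poly_Mapping.keys f" "\<And>\<mu>. \<mu> \<in> Poly_Mapping.keys f \<Longrightarrow> N \<mu> \<le> N \<nu>"
  shows "lead_mono f = \<nu>"
proof -
  have "f \<noteq> 0" using assms(1) by auto
  from lead_mono_props[OF this] assms show ?thesis by (intro weight_inject antisym) auto
qed

lemma lead_monos_subset: "(\<And>f. f \<in> V \<Longrightarrow> Poly_Mapping.keys f \<subseteq> E) \<Longrightarrow> lead_monos V \<subseteq> E"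
  using lead_mono_props(1) unfolding lead_monos_def by fastforce

text \<open>The elements of a reduced echelon form: starting from a normalised element with leading monomial \<open>b\<close>,
  clear its coefficients at the smaller leading monomials, whose reduced elements are available by
  induction on the weight.\<close>

lemma reduced_element_exists:
  fixes V :: "('n, 'a::field) mpoly set"
  assumes V: "lin.subspace V" and fin: "finite (lead_monos V)" and "b \<in> lead_monos V"
  shows "\<exists>F. F \<in> V \<and> (\<forall>c\<in>lead_monos V. Poly_Mapping.lookup F c = (if c = b then 1 else 0))"
  using \<open>b \<in> lead_monos V\<close>
proof (induction "N b" arbitrary: b rule: less_induct)
  case less
  obtain f where f: "f \<in> V" "f \<noteq> 0" "b = lead_mono f" using less.prems by (auto simp: lead_monos_def)
  define h where "h = mconst (inverse (Poly_Mapping.lookup f b)) * f"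
  have h: "h \<in> V" "Poly_Mapping.lookup h b = 1"
    using f lead_mono_props[OF f(2)] lin.subspace_scale[OF V f(1)]
    by (auto simp: h_def lookup_mconst_mult in_keys_iff)
  have h0: "Poly_Mapping.lookup h c = 0" if "N b < N c" for c
    using lead_mono_props(2)[OF f(2), of c] that f(3) by (auto simp: h_def lookup_mconst_mult in_keys_iff)
  define S where "S = {c \<in> lead_monos V. N c < N b}"
  have "\<forall>c\<in>S. \<exists>F. F \<in> V \<and> (\<forall>d\<in>lead_monos V. Poly_Mapping.lookup F d = (if d = c then 1 else 0))"
  proof
    fix c assume "c \<in> S"
    then have "N c < N b" "c \<in> lead_monos V" by (simp_all add: S_def)
    then show "\<exists>F. F \<in> V \<and> (\<forall>d\<in>lead_monos V. Poly_Mapping.lookup F d = (if d = c then 1 else 0))"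
      by (rule less.hyps)
  qed
  from bchoice[OF this] obtain F where
    F: "\<And>c. c \<in> S \<Longrightarrow> F c \<in> V" "\<And>c d. c \<in> S \<Longrightarrow> d \<in> lead_monos V \<Longrightarrow> Poly_Mapping.lookup (F c) d = (if d = c then 1 else 0)"
    by auto
  have finS: "finite S" using fin by (simp add: S_def)
  define G where "G = h - (\<Sum>c\<in>S. mconst (Poly_Mapping.lookup h c) * F c)"
  have "G \<in> V" unfolding G_def
    by (intro lin.subspace_diff[OF V] lin.subspace_sum[OF V] lin.subspace_scale[OF V] h F)
  moreover have "Poly_Mapping.lookup G d = (if d = b then 1 else 0)" if d: "d \<in> lead_monos V" for d
  proof -
    have "Poly_Mapping.lookup G d = Poly_Mapping.lookup h d
        - (\<Sum>c\<in>S. Poly_Mapping.lookup h c * Poly_Mapping.lookup (F c) d)"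
      by (simp add: G_def lookup_minus lookup_sum lookup_mconst_mult)
    also have "(\<Sum>c\<in>S. Poly_Mapping.lookup h c * Poly_Mapping.lookup (F c) d)
        = (\<Sum>c\<in>S. if d = c then Poly_Mapping.lookup h c else 0)"
      by (rule sum.cong) (use F(2) d in auto)
    also have "\<dots> = (if d \<in> S then Poly_Mapping.lookup h d else 0)"
      using finS by simp
    also have "Poly_Mapping.lookup h d - \<dots> = (if d = b then 1 else 0)"
    proof (cases "N d < N b")
      case True
      then show ?thesis using d by (auto simp: S_def)
    next
      case False
      then consider "d = b" | "N b < N d" using weight_inject[of b d] by fastforce
      then show ?thesis using h(2) h0 by cases (auto simp: S_def)
    qed
    finally show ?thesis .
  qed
  ultimately show ?case by blast
qed

text \<open>The reduced elements are a basis dual to the leading monomials: the difference between an element and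
  its expansion vanishes at all leading monomials, in particular at its own.\<close>

lemma lin_basis_lead_monos_exists:
  fixes V :: "('n, 'a::field) mpoly set"
  assumes V: "lin.subspace V" and fin: "finite (lead_monos V)"
  shows "\<exists>r f J. lin_basis r f V \<and> J ` {..<r} = lead_monos V \<and> J \<in> extensional {..<r} \<and> r = card (lead_monos V) \<and>
    (\<forall>i<r. \<forall>j<r. Poly_Mapping.lookup (f i) (J j) = (if i = j then 1 else 0))"
proof -
  have "\<forall>b\<in>lead_monos V. \<exists>F. F \<in> V \<and> (\<forall>c\<in>lead_monos V. Poly_Mapping.lookup F c = (if c = b then 1 else 0))"
    by (intro ballI reduced_element_exists[OF V fin])
  from bchoice[OF this] obtain F where
    F: "\<And>c. c \<in> lead_monos V \<Longrightarrow> F c \<in> V" "\<And>c d. c \<in> lead_monos V \<Longrightarrow> d \<in> lead_monos V \<Longrightarrow> Poly_Mapping.lookup (F c) d = (if d = c then 1 else 0)"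
    by auto
  define r where "r = card (lead_monos V)"
  obtain J0 where J0: "bij_betw J0 {0..<r} (lead_monos V)"
    using ex_bij_betw_nat_finite[OF fin] by (auto simp: r_def)
  define J where "J = restrict J0 {..<r}"
  have J: "J ` {..<r} = lead_monos V" "inj_on J {..<r}"
    using J0 by (auto simp: J_def bij_betw_def atLeast0LessThan inj_on_def)
  have JV: "J i \<in> lead_monos V" if "i < r" for i using J(1) that by auto
  define f where "f i = F (J i)" for i
  have dual: "Poly_Mapping.lookup (f i) (J j) = (if i = j then 1 else 0)" if "i < r" "j < r" for i j
    using that F(2)[OF JV JV, of i j] inj_onD[OF J(2), of i j] by (auto simp: f_def)
  have sub: "lincomb r a f \<in> V" for a unfolding lincomb_def
    by (intro lin.subspace_sum[OF V] lin.subspace_scale[OF V]) (simp add: f_def F(1) JV)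
  have "V = range (\<lambda>a. lincomb r a f)"
  proof (rule equalityI)
    show "range (\<lambda>a. lincomb r a f) \<subseteq> V" by (rule image_subsetI) (rule sub)
    show "V \<subseteq> range (\<lambda>a. lincomb r a f)"
    proof
      fix x assume x: "x \<in> V"
      define y where "y = x - lincomb r (\<lambda>i. Poly_Mapping.lookup x (J i)) f"
      have yV: "y \<in> V" unfolding y_def by (intro lin.subspace_diff[OF V] x sub)
      have y0: "Poly_Mapping.lookup y c = 0" if c: "c \<in> lead_monos V" for c
      proof -
        obtain j where j: "j < r" "c = J j" using c unfolding J(1)[symmetric] by auto
        have "(\<Sum>i<r. Poly_Mapping.lookup x (J i) * Poly_Mapping.lookup (f i) (J j)) =
            (\<Sum>i<r. if i = j then Poly_Mapping.lookup x (J i) else 0)"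
          by (rule sum.cong) (use dual j in auto)
        then show ?thesis using j by (simp add: y_def lookup_minus lookup_lincomb)
      qed
      have "y = 0"
      proof (rule ccontr)
        assume "y \<noteq> 0"
        then have "lead_mono y \<in> lead_monos V" using yV by (auto simp: lead_monos_def)
        then show False using y0 lead_mono_props(1)[OF \<open>y \<noteq> 0\<close>] by (simp add: in_keys_iff)
      qed
      then have "x = lincomb r (\<lambda>i. Poly_Mapping.lookup x (J i)) f" by (simp add: y_def)
      then show "x \<in> range (\<lambda>a. lincomb r a f)" by (rule lincomb_rangeI)
    qed
  qed
  then have "lin_basis r f V" using dual by (rule lin_basisI_dual)
  moreover have "J \<in> extensional {..<r}" by (simp add: J_def)
  ultimately show ?thesis using J(1) r_def dual
    by (intro exI[of _ r] exI[of _ f] exI[of _ J] conjI allI impI)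
qed

lemma card_lead_monos:
  fixes V :: "('n, 'a::field) mpoly set"
  assumes "lin.subspace V" "finite (lead_monos V)"
  shows "card (lead_monos V) = lin.dim V"
  using lin_basis_lead_monos_exists[OF assms] by (elim exE conjE) (simp only: lin_basis_dim)

end

lemma lin_basis_exists:
  fixes V :: "('n::finite, 'a::field) mpoly set"
  assumes "lin.subspace V" "finite E" "\<And>f. f \<in> V \<Longrightarrow> Poly_Mapping.keys f \<subseteq> E"
  obtains r f J where "lin_basis r f V" "J \<in> {..<r} \<rightarrow>\<^sub>E E" "pluecker r f J \<noteq> 0"
proof -
  obtain N :: "('n \<Rightarrow>\<^sub>0 nat) \<Rightarrow> nat" where "multiplicative_weight N" using multiplicative_weight_exists by blast
  then interpret multiplicative_weight N .
  have sub: "lead_monos V \<subseteq> E" by (rule lead_monos_subset) (rule assms(3))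
  then have fin: "finite (lead_monos V)" using assms(2) finite_subset by blast
  obtain r f J where *: "lin_basis r f V" "J ` {..<r} = lead_monos V" "J \<in> extensional {..<r}"
    "\<forall>i<r. \<forall>j<r. Poly_Mapping.lookup (f i) (J j) = (if i = j then 1 else 0)"
    using lin_basis_lead_monos_exists[OF assms(1) fin] by (elim exE conjE) (rule that; assumption)
  have "pluecker r f J = 1" by (rule pluecker_dual) (rule *(4)[rule_format])
  moreover have "J \<in> {..<r} \<rightarrow>\<^sub>E E" using *(2,3) sub by (auto simp: PiE_def)
  ultimately show ?thesis using that *(1) by simp
qed

text \<open>The reduced echelon basis has a minor equal to one, and minors of different bases are proportional.\<close>

lemma pluecker_nonzero_exists:
  fixes V :: "('n::finite, 'a::field) mpoly set"
  assumes "lin_basis r f V" "finite E" "\<And>f. f \<in> V \<Longrightarrow> Poly_Mapping.keys f \<subseteq> E"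
  obtains J where "J \<in> {..<r} \<rightarrow>\<^sub>E E" "pluecker r f J \<noteq> 0"
proof -
  obtain r' f' J where *: "lin_basis r' f' V" "J \<in> {..<r'} \<rightarrow>\<^sub>E E" "pluecker r' f' J \<noteq> 0"
    by (rule lin_basis_exists[OF lin_basis_subspace[OF assms(1)] assms(2,3)]) (assumption | rule that)+
  have r: "r' = r" using lin_basis_dim[OF assms(1)] lin_basis_dim[OF *(1)] by simp
  obtain c where "\<And>J. pluecker r f' J = c * pluecker r f J"
    by (rule pluecker_unique_up_to_scalar[OF assms(1) *(1)[unfolded r] *(3)[unfolded r]]) (rule that)
  then show ?thesis using that[of J] *(2,3) r by auto
qed

definition trunc :: "nat \<Rightarrow> ('n::finite, 'a::zero) mpoly \<Rightarrow> ('n, 'a) mpoly"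
  where "trunc d f = Poly_Mapping.mapp (\<lambda>\<nu> c. if mdeg \<nu> \<le> d then c else 0) f"

definition upto_degree :: "nat \<Rightarrow> ('n::finite, 'a::zero) mpoly set \<Rightarrow> ('n, 'a) mpoly set"
  where "upto_degree d V = {f \<in> V. Poly_Mapping.keys f \<subseteq> monos_upto d}"

lemma lookup_trunc: "Poly_Mapping.lookup (trunc d f) \<nu> = (if mdeg \<nu> \<le> d then Poly_Mapping.lookup f \<nu> else 0)"
  by (simp add: trunc_def lookup_mapp when_def in_keys_iff)

lemma keys_trunc: "Poly_Mapping.keys (trunc d f) = Poly_Mapping.keys f \<inter> monos_upto d"
  by (auto simp: in_keys_iff lookup_trunc monos_upto_def split: if_splits)

lemma trunc_id: "Poly_Mapping.keys f \<subseteq> monos_upto d \<Longrightarrow> trunc d f = f"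
  by (rule poly_mapping_eqI) (auto simp: lookup_trunc monos_upto_def in_keys_iff subset_iff)

text \<open>The form in which gradedness is used. It lets the homogeneous parts of degree at most \<open>d\<close> be treated
  together as one finite-dimensional space.\<close>

definition trunc_closed :: "('n::finite, 'a::zero) mpoly set \<Rightarrow> bool"
  where "trunc_closed V \<longleftrightarrow> (\<forall>f\<in>V. \<forall>d. trunc d f \<in> V)"

lemma ideal_imp_lin_subspace:
  fixes J :: "('n, 'a::field) mpoly set"
  assumes "ideal.subspace J"
  shows "lin.subspace J"
proof (rule lin.subspaceI)
  show "0 \<in> J" by (rule ideal.subspace_0[OF assms])
  show "x + y \<in> J" if "x \<in> J" "y \<in> J" for x y using that by (rule ideal.subspace_add[OF assms])
  show "mconst c * x \<in> J" if "x \<in> J" for c x using that by (rule ideal.subspace_scale[OF assms])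
qed

lemma upto_degree_subspace:
  fixes J :: "('n::finite, 'a::field) mpoly set"
  assumes "lin.subspace J"
  shows "lin.subspace (upto_degree d J)"
proof (rule lin.subspaceI)
  show "0 \<in> upto_degree d J" using lin.subspace_0[OF assms] by (simp add: upto_degree_def)
next
  fix x y assume "x \<in> upto_degree d J" "y \<in> upto_degree d J"
  then show "x + y \<in> upto_degree d J"
    using lin.subspace_add[OF assms, of x y] keys_add[of x y] by (auto simp: upto_degree_def)
next
  fix c x assume "x \<in> upto_degree d J"
  then show "mconst c * x \<in> upto_degree d J"
    using lin.subspace_scale[OF assms, of x c]
    by (auto simp: upto_degree_def subset_iff in_keys_iff lookup_mconst_mult)
qed

context multiplicative_weight
begin

lemma lead_mono_single_mult:
  fixes f :: "('n, 'a::comm_ring_1) mpoly"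
  assumes "f \<noteq> 0"
  shows "lead_mono (Poly_Mapping.single \<alpha> 1 * f) = \<alpha> + lead_mono f"
proof (rule lead_mono_eqI)
  show "\<alpha> + lead_mono f \<in> Poly_Mapping.keys (Poly_Mapping.single \<alpha> 1 * f)"
    using lead_mono_props(1)[OF assms] by (simp add: in_keys_iff lookup_single_mult)
  fix \<mu> assume "\<mu> \<in> Poly_Mapping.keys (Poly_Mapping.single \<alpha> 1 * f)"
  then obtain \<nu> where "\<nu> \<in> Poly_Mapping.keys f" "\<mu> = \<alpha> + \<nu>" by (rule keys_single_mult)
  then show "N \<mu> \<le> N (\<alpha> + lead_mono f)" using lead_mono_props(2)[OF assms] by (simp add: weight_add)
qed

lemma upset_lead_monos:
  fixes J :: "('n, 'a::comm_ring_1) mpoly set"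
  assumes "ideal.subspace J"
  shows "upset (lead_monos J)"
  unfolding upset_def
proof (intro ballI allI)
  fix \<alpha> \<beta> assume "\<alpha> \<in> lead_monos J"
  then obtain f where f: "f \<in> J" "f \<noteq> 0" "\<alpha> = lead_mono f" by (auto simp: lead_monos_def)
  let ?g = "Poly_Mapping.single \<beta> 1 * f"
  have "Poly_Mapping.lookup ?g (\<beta> + lead_mono f) \<noteq> 0"
    using lead_mono_props(1)[OF f(2)] by (simp add: in_keys_iff lookup_single_mult)
  then have "?g \<noteq> 0" by auto
  moreover have "?g \<in> J" using ideal.subspace_scale[OF assms f(1)] .
  ultimately have "lead_mono ?g \<in> lead_monos J" by (simp add: lead_monos_def)
  then show "\<alpha> + \<beta> \<in> lead_monos J" by (simp add: lead_mono_single_mult[OF f(2)] f(3) add.commute)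
qed

text \<open>Truncating an element at the degree of its leading monomial keeps
  this monomial and stays inside the ideal.\<close>

lemma lead_monos_upto_degree:
  fixes J :: "('n, 'a::zero) mpoly set"
  assumes "trunc_closed J"
  shows "lead_monos J \<inter> monos_upto d = lead_monos (upto_degree d J)"
proof (rule equalityI)
  show "lead_monos J \<inter> monos_upto d \<subseteq> lead_monos (upto_degree d J)"
  proof
    fix \<alpha> assume "\<alpha> \<in> lead_monos J \<inter> monos_upto d"
    then obtain f where f: "f \<in> J" "f \<noteq> 0" "\<alpha> = lead_mono f" "\<alpha> \<in> monos_upto d" by (auto simp: lead_monos_def)
    have k: "\<alpha> \<in> Poly_Mapping.keys (trunc d f)" using lead_mono_props(1)[OF f(2)] f by (simp add: keys_trunc)
    have "lead_mono (trunc d f) = \<alpha>"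
      by (rule lead_mono_eqI[OF k]) (use lead_mono_props(2)[OF f(2)] f(3) in \<open>auto simp: keys_trunc\<close>)
    moreover have "trunc d f \<noteq> 0" using k by auto
    moreover have "trunc d f \<in> upto_degree d J"
      using assms f(1) by (auto simp: trunc_closed_def upto_degree_def keys_trunc)
    ultimately show "\<alpha> \<in> lead_monos (upto_degree d J)" by (auto simp: lead_monos_def)
  qed
  have "lead_monos (upto_degree d J) \<subseteq> monos_upto d" by (rule lead_monos_subset) (simp add: upto_degree_def)
  then show "lead_monos (upto_degree d J) \<subseteq> lead_monos J \<inter> monos_upto d"
    by (auto simp: lead_monos_def upto_degree_def)
qed

text \<open>Polynomial division: subtracting a multiple of a low-degree element with a suitable leading monomial
  lowers the weight of the leading monomial of \<open>f\<close>.\<close>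

lemma ideal_subset_by_division:
  fixes J :: "('n, 'a::field) mpoly set"
  assumes J: "ideal.subspace J" "trunc_closed J" and J': "ideal.subspace J'"
    and gen: "\<And>\<alpha>. \<alpha> \<in> lead_monos J \<Longrightarrow> \<exists>\<beta>\<in>lead_monos J \<inter> monos_upto D. \<exists>\<gamma>. \<alpha> = \<beta> + \<gamma>"
    and sub: "upto_degree D J \<subseteq> J'"
  shows "J \<subseteq> J'"
proof
  fix f assume "f \<in> J"
  then show "f \<in> J'"
  proof (induction "N (lead_mono f)" arbitrary: f rule: less_induct)
    case less
    show ?case
    proof (cases "f = 0")
      case True
      then show ?thesis using ideal.subspace_0[OF J'] by simp
    next
      case False
      then have "lead_mono f \<in> lead_monos J" using less.prems by (simp add: lead_monos_def)
      then obtain \<beta> \<gamma> where \<beta>: "\<beta> \<in> lead_monos J \<inter> monos_upto D" "lead_mono f = \<beta> + \<gamma>" using gen by blast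
      then obtain h where h: "h \<in> upto_degree D J" "h \<noteq> 0" "\<beta> = lead_mono h"
        unfolding lead_monos_upto_degree[OF J(2)] by (auto simp: lead_monos_def)
      define c where "c = Poly_Mapping.lookup f (lead_mono f) / Poly_Mapping.lookup h \<beta>"
      define g where "g = Poly_Mapping.single \<gamma> c * h"
      have gJ: "g \<in> J" "g \<in> J'" unfolding g_def
        using h(1) sub ideal.subspace_scale[OF J(1)] ideal.subspace_scale[OF J'] by (auto simp: upto_degree_def)
      have hb: "Poly_Mapping.lookup h \<beta> \<noteq> 0" using lead_mono_props(1)[OF h(2)] h(3) by (simp add: in_keys_iff)
      have "Poly_Mapping.lookup g (lead_mono f) = c * Poly_Mapping.lookup h \<beta>"
        unfolding g_def \<beta>(2) add.commute[of \<beta>] by (rule lookup_single_mult)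
      then have lead: "Poly_Mapping.lookup (f - g) (lead_mono f) = 0" using hb by (simp add: lookup_minus c_def)
      have small: "N \<mu> < N (lead_mono f)" if \<mu>: "\<mu> \<in> Poly_Mapping.keys (f - g)" for \<mu>
      proof -
        have "N \<mu> \<le> N (lead_mono f)"
        proof (cases "\<mu> \<in> Poly_Mapping.keys f")
          case True
          then show ?thesis using lead_mono_props(2)[OF False] by simp
        next
          case False
          then have "\<mu> \<in> Poly_Mapping.keys g" using \<mu> by (simp add: in_keys_iff lookup_minus)
          then obtain \<nu> where "\<nu> \<in> Poly_Mapping.keys h" "\<mu> = \<gamma> + \<nu>"
            unfolding g_def by (rule keys_single_mult)
          then show ?thesis using lead_mono_props(2)[OF h(2)] h(3) \<beta>(2) by (simp add: weight_add mult.commute)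
        qed
        moreover have "\<mu> \<noteq> lead_mono f" using lead \<mu> by (auto simp: in_keys_iff)
        ultimately show ?thesis using weight_inject[of \<mu> "lead_mono f"] by fastforce
      qed
      have "f - g \<in> J'"
      proof (cases "f - g = 0")
        case True
        then show ?thesis using ideal.subspace_0[OF J'] by simp
      next
        case False
        then show ?thesis
          using less.hyps small[OF lead_mono_props(1)[OF False]] ideal.subspace_diff[OF J(1) less.prems gJ(1)] by blast
      qed
      then have "(f - g) + g \<in> J'" using gJ(2) by (rule ideal.subspace_add[OF J'])
      then show ?thesis by simp
    qed
  qed
qed

end

text \<open>The leading monomials of an ideal form an upward closed set with the same Hilbert function as the ideal,
  so the bound for such sets applies to all ideals with Hilbert function \<open>H\<close> at once.\<close>

theorem ideals_determined_up_to_degree: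
  fixes H :: "nat \<Rightarrow> nat"
  shows "\<exists>D. \<forall>J J' :: ('n::finite, 'a::field) mpoly set.
    ideal.subspace J \<and> trunc_closed J \<and> (\<forall>d. lin.dim (upto_degree d J) = H d) \<and>
    ideal.subspace J' \<and> trunc_closed J' \<and> (\<forall>d. lin.dim (upto_degree d J') = H d) \<and>
    upto_degree D J = upto_degree D J' \<longrightarrow> J = J'"
proof -
  obtain N :: "('n \<Rightarrow>\<^sub>0 nat) \<Rightarrow> nat" where "multiplicative_weight N" using multiplicative_weight_exists by blast
  then interpret multiplicative_weight N .
  obtain D where D: "\<forall>M :: ('n \<Rightarrow>\<^sub>0 nat) set. upset M \<and> (\<forall>d. card (M \<inter> monos_upto d) = H d) \<longrightarrow>
    (\<forall>\<alpha>\<in>M. \<exists>\<beta>\<in>M \<inter> monos_upto D. \<exists>\<gamma>. \<alpha> = \<beta> + \<gamma>)"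
    using upset_generation_degree_bound[of H] by (rule exE)
  have card: "card (lead_monos J \<inter> monos_upto d) = lin.dim (upto_degree d J)"
    if J: "ideal.subspace J" "trunc_closed J" for J :: "('n, 'a) mpoly set" and d
    unfolding lead_monos_upto_degree[OF J(2)]
  proof (rule card_lead_monos)
    show "lin.subspace (upto_degree d J)"
      by (intro upto_degree_subspace ideal_imp_lin_subspace J)
    have "lead_monos (upto_degree d J) \<subseteq> monos_upto d" by (rule lead_monos_subset) (simp add: upto_degree_def)
    then show "finite (lead_monos (upto_degree d J))" using finite_monos_upto finite_subset by blast
  qed
  have sub: "J \<subseteq> J'" if J: "ideal.subspace J" "trunc_closed J" "\<forall>d. lin.dim (upto_degree d J) = H d"
    and J': "ideal.subspace J'" and eq: "upto_degree D J = upto_degree D J'"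
    for J J' :: "('n, 'a) mpoly set"
  proof (rule ideal_subset_by_division[OF J(1,2) J'])
    show "upto_degree D J \<subseteq> J'" unfolding eq by (auto simp: upto_degree_def)
    have "upset (lead_monos J) \<and> (\<forall>d. card (lead_monos J \<inter> monos_upto d) = H d)"
      using upset_lead_monos[OF J(1)] card[OF J(1,2)] J(3) by simp
    then have "\<forall>\<alpha>\<in>lead_monos J. \<exists>\<beta>\<in>lead_monos J \<inter> monos_upto D. \<exists>\<gamma>. \<alpha> = \<beta> + \<gamma>" by (rule D[rule_format, THEN ballI])
    then show "\<exists>\<beta>\<in>lead_monos J \<inter> monos_upto D. \<exists>\<gamma>. \<alpha> = \<beta> + \<gamma>" if "\<alpha> \<in> lead_monos J" for \<alpha> using that by (rule bspec)
  qed
  show ?thesis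
  proof (intro exI[of _ D] allI impI)
    fix J J' :: "('n, 'a) mpoly set"
    assume *: "ideal.subspace J \<and> trunc_closed J \<and> (\<forall>d. lin.dim (upto_degree d J) = H d) \<and>
      ideal.subspace J' \<and> trunc_closed J' \<and> (\<forall>d. lin.dim (upto_degree d J') = H d) \<and>
      upto_degree D J = upto_degree D J'"
    have J: "ideal.subspace J" "trunc_closed J" "\<forall>d. lin.dim (upto_degree d J) = H d"
      and J': "ideal.subspace J'" "trunc_closed J'" "\<forall>d. lin.dim (upto_degree d J') = H d"
      and eq: "upto_degree D J = upto_degree D J'"
      using * by simp_all
    show "J = J'" by (intro equalityI sub[OF J J'(1) eq] sub[OF J' J(1) eq[symmetric]])
  qed
qed

section \<open>The complex of a minimum of affine functions\<close>

locale affine_family =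
  fixes F :: "'i set" and c :: "'i \<Rightarrow> real" and u :: "'i \<Rightarrow> 'a::euclidean_space"
  assumes finite_F: "finite F" and F_nonempty: "F \<noteq> {}"
begin

definition aff :: "'i \<Rightarrow> 'a \<Rightarrow> real"
  where "aff a x = c a + inner (u a) x"

definition active :: "'a \<Rightarrow> 'i set"
  where "active x = {a \<in> F. \<forall>b\<in>F. aff a x \<le> aff b x}"

text \<open>This is the closure of the set of points with the same active functions as \<open>x\<close>, see
  \<open>closure_class\<close>.\<close>

definition cell :: "'a \<Rightarrow> 'a set"
  where "cell x = {y. active x \<subseteq> active y}"

lemma active_nonempty: "active x \<noteq> {}"
proof -
  obtain a where "a \<in> F" "\<And>b. b \<in> F \<Longrightarrow> aff a x \<le> aff b x"
    using ex_min_if_finite[of "(\<lambda>a. aff a x) ` F"] finite_F F_nonempty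
    by (auto simp: not_less)
  then show ?thesis unfolding active_def by blast
qed

lemma aff_convex: "aff a ((1 - s) *\<^sub>R x + s *\<^sub>R y) = (1 - s) * aff a x + s * aff a y"
  by (simp add: aff_def inner_add_right algebra_simps)

text \<open>If \<open>a\<close> is active at both ends, then \<open>b - a\<close> is nonnegative at both ends for every \<open>b\<close>, and a convex combination with
  positive weights of two nonnegative numbers vanishes only if both do.\<close>

lemma active_convex:
  assumes "active x \<inter> active y \<noteq> {}" "0 < s" "s < 1"
  shows "active ((1 - s) *\<^sub>R x + s *\<^sub>R y) = active x \<inter> active y"
proof
  show "active x \<inter> active y \<subseteq> active ((1 - s) *\<^sub>R x + s *\<^sub>R y)"
    using assms by (auto simp: active_def aff_convex intro!: add_mono mult_left_mono)
  show "active ((1 - s) *\<^sub>R x + s *\<^sub>R y) \<subseteq> active x \<inter> active y"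
  proof
    fix b assume b: "b \<in> active ((1 - s) *\<^sub>R x + s *\<^sub>R y)"
    obtain a where a: "a \<in> active x" "a \<in> active y" using assms(1) by blast
    have bF: "b \<in> F" using b by (simp add: active_def)
    have 1: "aff a x \<le> aff b x" "aff a y \<le> aff b y" using a bF by (auto simp: active_def)
    have 2: "(1 - s) * aff b x + s * aff b y \<le> (1 - s) * aff a x + s * aff a y"
      using a b by (simp add: active_def aff_convex)
    have "(1 - s) * aff a x \<le> (1 - s) * aff b x" "s * aff a y \<le> s * aff b y"
      using 1 assms by (auto intro: mult_left_mono)
    then have "(1 - s) * aff b x = (1 - s) * aff a x" "s * aff b y = s * aff a y"
      using 2 by linarith+
    then have "aff b x = aff a x" "aff b y = aff a y" using assms by auto
    then show "b \<in> active x \<inter> active y" using a bF by (simp add: active_def)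
  qed
qed

lemma polyhedron_cell: "polyhedron (cell x)"
proof -
  have eq: "cell x = (\<Inter>(a, b) \<in> active x \<times> F. {y. inner (u a - u b) y \<le> c b - c a})"
    by (auto simp: cell_def active_def aff_def algebra_simps inner_diff_left)
  have "finite (active x)" using finite_F by (auto simp: active_def)
  then show ?thesis unfolding eq using finite_F
    by (intro polyhedron_Inter) (auto simp: polyhedron_halfspace_le)
qed

text \<open>Every point \<open>y\<close> of the cell is a limit of points of the class, namely of the points on the segment from \<open>x\<close>
  to \<open>y\<close> other than \<open>y\<close>, where exactly the functions active at both ends are active.\<close>

lemma closure_class: "closure {y. active y = active x} = cell x"
proof
  have "closed (cell x)" using polyhedron_cell polyhedron_imp_closed by blast
  moreover have "{y. active y = active x} \<subseteq> cell x" by (auto simp: cell_def)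
  ultimately show "closure {y. active y = active x} \<subseteq> cell x" by (rule closure_minimal[rotated])
  show "cell x \<subseteq> closure {y. active y = active x}"
  proof
    fix y assume y: "y \<in> cell x"
    then have sub: "active x \<subseteq> active y" by (simp add: cell_def)
    define p where "p n = (1 - inverse (real (Suc (Suc n)))) *\<^sub>R y + inverse (real (Suc (Suc n))) *\<^sub>R x" for n
    have "active (p n) = active y \<inter> active x" for n
      unfolding p_def
      by (rule active_convex) (use sub active_nonempty in \<open>auto simp: field_simps\<close>)
    then have "p n \<in> {y. active y = active x}" for n using sub by auto
    moreover have "p \<longlonglongrightarrow> (1 - 0) *\<^sub>R y + 0 *\<^sub>R x"
      unfolding p_def
      by (intro tendsto_intros LIMSEQ_Suc[OF LIMSEQ_inverse_real_of_nat])
    ultimately show "y \<in> closure {y. active y = active x}"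
      unfolding closure_sequential by (intro exI[of _ p]) auto
  qed
qed

lemma convex_superlevel: "convex {y. B \<subseteq> active y}"
proof (cases "B = {}")
  case False
  show ?thesis
  proof (rule convexI)
    fix y z :: 'a and v w :: real
    assume *: "y \<in> {y. B \<subseteq> active y}" "z \<in> {y. B \<subseteq> active y}" "0 \<le> v" "0 \<le> w" "v + w = 1"
    then have v: "v = 1 - w" by simp
    consider "w = 0" | "w = 1" | "0 < w" "w < 1" using * by linarith
    then show "v *\<^sub>R y + w *\<^sub>R z \<in> {y. B \<subseteq> active y}"
    proof cases
      case 3
      have "active ((1 - w) *\<^sub>R y + w *\<^sub>R z) = active y \<inter> active z"
        by (rule active_convex) (use * 3 False in auto)
      with * v show ?thesis by auto
    qed (use * v in auto)
  qed
qed simp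

text \<open>On an open segment inside a cell the active functions are those active at both ends. So if all
  functions in \<open>B\<close> are active at an interior point, they are active at the ends.\<close>

lemma superlevel_face_of_cell: "{z \<in> cell x. B \<subseteq> active z} face_of cell x"
  unfolding face_of_def
proof (intro conjI ballI impI)
  have "{z \<in> cell x. B \<subseteq> active z} = {z. active x \<union> B \<subseteq> active z}" by (auto simp: cell_def)
  then show "convex {z \<in> cell x. B \<subseteq> active z}" using convex_superlevel by metis
next
  fix p q z assume pq: "p \<in> cell x" "q \<in> cell x" and z: "z \<in> {z \<in> cell x. B \<subseteq> active z}"
    and seg: "z \<in> open_segment p q"
  obtain s where s: "0 < s" "s < 1" "z = (1 - s) *\<^sub>R p + s *\<^sub>R q"
    using seg by (auto simp: in_segment)
  have "active z = active p \<inter> active q" unfolding s(3)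
    by (rule active_convex) (use s pq active_nonempty[of x] in \<open>auto simp: cell_def\<close>)
  then show "p \<in> {z \<in> cell x. B \<subseteq> active z}" "q \<in> {z \<in> cell x. B \<subseteq> active z}"
    using z pq by auto
qed auto

lemma cell_antimono: "x \<in> cell w \<Longrightarrow> cell x \<subseteq> cell w"
  by (auto simp: cell_def)

text \<open>A nonempty face \<open>T\<close> is the cell of any relative interior point \<open>x\<close> of it. Points of \<open>cell x\<close> belong to \<open>T\<close>
  because the segment from such a point to \<open>x\<close> can be prolonged a little beyond \<open>x\<close> inside the big cell: the
  functions that are inactive at \<open>x\<close> leave some room. Conversely, segments from points of \<open>T\<close> to \<open>x\<close> can be
  prolonged inside \<open>T\<close>, and the functions active at \<open>x\<close> are active at both ends.\<close>

lemma face_of_cell_is_cell: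
  assumes F: "T face_of cell w" "T \<noteq> {}"
  shows "\<exists>x. T = cell x"
proof -
  have conv: "convex T" using F(1) face_of_imp_convex by blast
  obtain x where x: "x \<in> rel_interior T"
    using rel_interior_eq_empty[OF conv] F(2) by blast
  have xT: "x \<in> T" using x rel_interior_subset by blast
  have Tw: "T \<subseteq> cell w" using F(1) face_of_imp_subset by blast
  have xw: "x \<in> cell w" using xT Tw by blast
  have "cell x \<subseteq> T"
  proof
    fix y assume y: "y \<in> cell x"
    show "y \<in> T"
    proof (cases "y = x")
      case False
      have "\<exists>e>0. \<forall>b\<in>F. \<forall>a\<in>active w. 0 \<le> (1 + e) * (aff b x - aff a x) - e * (aff b y - aff a y)"
      proof -
        have "\<forall>p\<in>F \<times> active w. eventually (\<lambda>e. 0 \<le> (1 + e) * (aff (fst p) x - aff (snd p) x)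
              - e * (aff (fst p) y - aff (snd p) y)) (at_right (0::real))"
        proof
          fix p assume p: "p \<in> F \<times> active w"
          obtain b a where ba: "p = (b, a)" by (cases p)
          have b: "b \<in> F" and a: "a \<in> active x" "a \<in> active y"
            using p xw y by (auto simp: ba cell_def)
          show "eventually (\<lambda>e. 0 \<le> (1 + e) * (aff (fst p) x - aff (snd p) x)
              - e * (aff (fst p) y - aff (snd p) y)) (at_right (0::real))"
          proof (cases "b \<in> active x")
            case True
            then have "b \<in> active y" using y by (auto simp: cell_def)
            then have "aff b x = aff a x" "aff b y = aff a y"
              using a b True by (auto simp: active_def intro: antisym)
            then show ?thesis by (simp add: ba)
          next
            case False
            then have "aff b x > aff a x" using a b
              by (auto simp: active_def not_le)
            moreover have "((\<lambda>e. (1 + e) * (aff b x - aff a x) - e * (aff b y - aff a y))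
              \<longlongrightarrow> (1 + 0) * (aff b x - aff a x) - 0 * (aff b y - aff a y)) (at_right (0::real))"
              by (intro tendsto_intros)
            ultimately have "eventually (\<lambda>e. 0 < (1 + e) * (aff b x - aff a x) - e * (aff b y - aff a y)) (at_right (0::real))"
              by (intro order_tendstoD(1)) auto
            then show ?thesis by (auto simp: ba elim!: eventually_mono)
          qed
        qed
        then have "eventually (\<lambda>e. \<forall>p\<in>F \<times> active w. 0 \<le> (1 + e) * (aff (fst p) x - aff (snd p) x)
              - e * (aff (fst p) y - aff (snd p) y)) (at_right (0::real))"
          by (intro eventually_ball_finite) (use finite_F in \<open>auto simp: active_def\<close>)
        then have "eventually (\<lambda>e. 0 < e \<and> (\<forall>p\<in>F \<times> active w. 0 \<le> (1 + e) * (aff (fst p) x - aff (snd p) x)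
              - e * (aff (fst p) y - aff (snd p) y))) (at_right (0::real))"
          by (intro eventually_conj eventually_at_right_less)
        then have "\<exists>e. 0 < e \<and> (\<forall>p\<in>F \<times> active w. 0 \<le> (1 + e) * (aff (fst p) x - aff (snd p) x)
              - e * (aff (fst p) y - aff (snd p) y))"
          using eventually_happens' trivial_limit_at_right_real by blast
        then show ?thesis by force
      qed
      then obtain e where e: "e > 0"
        "\<And>a b. a \<in> active w \<Longrightarrow> b \<in> F \<Longrightarrow> 0 \<le> (1 + e) * (aff b x - aff a x) - e * (aff b y - aff a y)"
        by blast
      \<comment> \<open>\<open>x\<close> lies strictly between \<open>y\<close> and \<open>z\<close>.\<close>
      define z where "z = (1 + e) *\<^sub>R x - e *\<^sub>R y"
      have affz: "aff b z = (1 + e) * aff b x - e * aff b y" for b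
        by (simp add: aff_def z_def inner_diff_right algebra_simps)
      have zw: "z \<in> cell w"
        using e(2) by (auto simp: cell_def active_def affz algebra_simps)
      define s where "s = e / (1 + e)"
      have "x = (1 - s) *\<^sub>R z + s *\<^sub>R y"
      proof -
        have "(1 + e) *\<^sub>R ((1 - s) *\<^sub>R z + s *\<^sub>R y) = (1 + e) *\<^sub>R x"
          using e(1) by (simp add: s_def z_def scaleR_add_right scaleR_scaleR field_simps)
        then show ?thesis using e(1) by simp
      qed
      moreover have "z \<noteq> y"
      proof
        assume "z = y"
        then have "(1 + e) *\<^sub>R (x - y) = 0" by (simp add: z_def algebra_simps)
        with e(1) \<open>y \<noteq> x\<close> show False by simp
      qed
      ultimately have "x \<in> open_segment z y"
        using e(1) unfolding in_segment by (intro conjI exI[of _ s]) (auto simp: s_def field_simps)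
      moreover have "y \<in> cell w" using y xw cell_antimono by blast
      ultimately show ?thesis using F(1) zw xT unfolding face_of_def by blast
    qed (use xT in simp)
  qed
  moreover have "T \<subseteq> cell x"
  proof
    fix y assume y: "y \<in> T"
    obtain e where e: "e > 1" "(1 - e) *\<^sub>R y + e *\<^sub>R x \<in> T"
      using convex_rel_interior_if[OF conv x] y
      by (metis hull_inc order_refl)
    define z where "z = (1 - e) *\<^sub>R y + e *\<^sub>R x"
    define s where "s = 1 / e"
    have xs: "x = (1 - s) *\<^sub>R y + s *\<^sub>R z"
    proof -
      have "(1 - s) + s * (1 - e) = 0" "s * e = 1" using e(1) by (simp_all add: s_def field_simps)
      moreover have "(1 - s) *\<^sub>R y + s *\<^sub>R z = ((1 - s) + s * (1 - e)) *\<^sub>R y + (s * e) *\<^sub>R x"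
        by (simp add: z_def scaleR_add_right scaleR_add_left)
      ultimately show ?thesis by simp
    qed
    have "active w \<subseteq> active y" "active w \<subseteq> active z"
      using y e(2) Tw by (auto simp: cell_def z_def)
    then have "active x = active y \<inter> active z"
      by (subst xs, intro active_convex) (use active_nonempty[of w] e(1) in \<open>auto simp: s_def\<close>)
    then show "y \<in> cell x" by (auto simp: cell_def)
  qed
  ultimately show ?thesis by blast
qed

theorem polyhedral_complex_cells: "polyhedral_complex (range cell)"
  unfolding polyhedral_complex_def
proof (intro conjI ballI allI impI)
  have "range cell \<subseteq> (\<lambda>B. {y. B \<subseteq> active y}) ` Pow F"
    by (force simp: cell_def[abs_def] active_def)
  then show "finite (range cell)" using finite_F finite_subset by blast
next
  fix P assume "P \<in> range cell"
  then obtain x where P: "P = cell x" by blast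
  show "polyhedron P" by (simp add: P polyhedron_cell)
  show "P \<noteq> {}" by (auto simp: P cell_def)
next
  fix P T assume "P \<in> range cell" "T face_of P \<and> T \<noteq> {}"
  then show "T \<in> range cell" using face_of_cell_is_cell by blast
next
  have *: "cell x \<inter> cell y face_of cell x" for x y
    using superlevel_face_of_cell[of x "active y"] by (simp add: cell_def Int_def)
  fix P Q assume "P \<in> range cell" "Q \<in> range cell"
  then show "P \<inter> Q face_of P" "P \<inter> Q face_of Q" using * by (auto, metis Int_commute)
qed

end

lemma polyhedral_subcomplex:
  assumes "polyhedral_complex \<F>"
  shows "polyhedral_complex {P \<in> \<F>. P \<subseteq> X}"
  unfolding polyhedral_complex_def
proof (intro conjI ballI allI impI)
  show "finite {P \<in> \<F>. P \<subseteq> X}" using assms by (simp add: polyhedral_complex_def)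
next
  fix P assume "P \<in> {P \<in> \<F>. P \<subseteq> X}"
  then show "polyhedron P" "P \<noteq> {}" using assms by (simp_all add: polyhedral_complex_def)
next
  fix P F assume "P \<in> {P \<in> \<F>. P \<subseteq> X}" "F face_of P \<and> F \<noteq> {}"
  then show "F \<in> {P \<in> \<F>. P \<subseteq> X}"
    using assms face_of_imp_subset[of F P] by (auto simp: polyhedral_complex_def)
next
  fix P Q assume "P \<in> {P \<in> \<F>. P \<subseteq> X}" "Q \<in> {P \<in> \<F>. P \<subseteq> X}"
  then show "P \<inter> Q face_of P" "P \<inter> Q face_of Q"
    using assms by (simp_all add: polyhedral_complex_def)
qed

section \<open>Initial ideals as reductions\<close>

text \<open>The inequality \<open>w \<le> v(a)\<close> with the convention that the valuation of zero is infinite.\<close>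

definition val_ge :: "real \<Rightarrow> 'k::zero hahn \<Rightarrow> bool"
  where "val_ge w a \<longleftrightarrow> (\<forall>e. hcoeff a e \<noteq> 0 \<longrightarrow> w \<le> e)"

lemma val_geD: "val_ge w a \<Longrightarrow> e < w \<Longrightarrow> hcoeff a e = 0"
  unfolding val_ge_def by (meson not_le)

lemma val_ge_0 [simp]: "val_ge w 0"
  by (simp add: val_ge_def)

lemma val_ge_add: "val_ge w a \<Longrightarrow> val_ge w b \<Longrightarrow> val_ge w (a + b)" for a :: "'k::comm_monoid_add hahn"
  unfolding val_ge_def by (metis add.right_neutral hcoeff_add)

lemma val_ge_sum: "(\<And>x. x \<in> A \<Longrightarrow> val_ge w (f x)) \<Longrightarrow> val_ge w (sum f A)"
  for f :: "_ \<Rightarrow> 'k::comm_ring_1 hahn"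
  by (induction A rule: infinite_finite_induct) (simp_all add: val_ge_add)

text \<open>Lower bounds of valuations add up, and the coefficients at these bounds multiply: at the sum of the bounds
  only one pair of exponents can contribute.\<close>

lemma val_ge_mult:
  fixes a :: "'k::comm_ring_1 hahn"
  assumes "val_ge w a" "val_ge w' b"
  shows "val_ge (w + w') (a * b)" "hcoeff (a * b) (w + w') = hcoeff a w * hcoeff b w'"
proof -
  show "val_ge (w + w') (a * b)" unfolding val_ge_def
  proof (intro allI impI)
    fix e assume "hcoeff (a * b) e \<noteq> 0"
    then obtain x where "hcoeff a x \<noteq> 0" "hcoeff b (e - x) \<noteq> 0" by (rule hcoeff_mult_nonzero)
    then have "w \<le> x" "w' \<le> e - x" using assms by (auto simp: val_ge_def)
    then show "w + w' \<le> e" by simp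
  qed
  have "{x. hcoeff a x \<noteq> 0 \<and> hcoeff b (w + w' - x) \<noteq> 0} \<subseteq> {w}"
    using assms by (force simp: val_ge_def)
  from hcoeff_mult'[OF _ this] show "hcoeff (a * b) (w + w') = hcoeff a w * hcoeff b w'" by simp
qed

lemma val_ge_prod:
  fixes a :: "nat \<Rightarrow> 'k::comm_ring_1 hahn"
  assumes "\<And>i. i < r \<Longrightarrow> val_ge (w i) (a i)"
  shows "val_ge (\<Sum>i = 0..<r. w i) (\<Prod>i = 0..<r. a i) \<and>
    hcoeff (\<Prod>i = 0..<r. a i) (\<Sum>i = 0..<r. w i) = (\<Prod>i = 0..<r. hcoeff (a i) (w i))"
  using assms
proof (induction r)
  case 0
  then show ?case by (simp add: val_ge_def hcoeff_1)
next
  case (Suc r)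
  then show ?case using val_ge_mult[of "\<Sum>i = 0..<r. w i" "\<Prod>i = 0..<r. a i" "w r" "a r"] by simp
qed

lemma val_ge_iff: "a \<noteq> 0 \<Longrightarrow> val_ge w a \<longleftrightarrow> w \<le> hval a"
  unfolding val_ge_def using hval_props by (meson order_trans)

lemma val_ge_lead_iff: "val_ge w a \<Longrightarrow> hcoeff a w \<noteq> 0 \<longleftrightarrow> a \<noteq> 0 \<and> hval a = w"
  using val_ge_iff[of a w] hval_props[of a] by (metis hcoeff_0 order_antisym)

lemma hval_mult:
  fixes a :: "'k::field hahn"
  assumes "a \<noteq> 0" "b \<noteq> 0"
  shows "hval (a * b) = hval a + hval b"
proof -
  have "val_ge (hval a) a" "val_ge (hval b) b" using assms by (simp_all add: val_ge_iff)
  from val_ge_mult[OF this] hval_props(1)[OF assms(1)] hval_props(1)[OF assms(2)]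
  show ?thesis using val_ge_lead_iff[of "hval a + hval b" "a * b"] by simp
qed

lemma hval_1: "hval (1 :: 'k::field hahn) = 0"
  using val_ge_lead_iff[of 0 "1 :: 'k hahn"] by (simp add: val_ge_def hcoeff_1)

text \<open>Residues commute with determinants after rescaling rows and columns by powers of \<open>t\<close>. Every term of the
  Leibniz formula has the same lower bound \<open>W\<close> for its valuation.\<close>

lemma det_fun_lead:
  fixes m :: "nat \<Rightarrow> nat \<Rightarrow> 'k::comm_ring_1 hahn"
  assumes "\<And>i j. i < r \<Longrightarrow> j < r \<Longrightarrow> val_ge (x i - y j) (m i j)"
  defines "W \<equiv> (\<Sum>i = 0..<r. x i) - (\<Sum>j = 0..<r. y j)"
  shows "val_ge W (det_fun r m)"
    "hcoeff (det_fun r m) W = det_fun r (\<lambda>i j. hcoeff (m i j) (x i - y j))"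
proof -
  have sgn: "hcoeff (of_int (sign p) * a) e = of_int (sign p) * hcoeff a e" for p and a :: "'k hahn" and e
    by (simp add: sign_def)
  have W: "(\<Sum>i = 0..<r. x i - y (p i)) = W" if "p permutes {0..<r}" for p
    using sum.permute[OF that, of y] by (simp add: W_def sum_subtractf o_def)
  have *: "val_ge W (\<Prod>i = 0..<r. m i (p i)) \<and>
      hcoeff (\<Prod>i = 0..<r. m i (p i)) W = (\<Prod>i = 0..<r. hcoeff (m i (p i)) (x i - y (p i)))"
    if p: "p permutes {0..<r}" for p
  proof -
    have "p i < r" if "i < r" for i using permutes_in_image[OF p, of i] that by simp
    then show ?thesis
      using val_ge_prod[of r "\<lambda>i. x i - y (p i)" "\<lambda>i. m i (p i)"] assms(1) by (simp add: W[OF p])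
  qed
  show "val_ge W (det_fun r m)" unfolding det_fun_leibniz
  proof (rule val_ge_sum)
    fix p assume "p \<in> {p. p permutes {0..<r}}"
    then have "val_ge W (\<Prod>i = 0..<r. m i (p i))" using * by simp
    then show "val_ge W (of_int (sign p) * (\<Prod>i = 0..<r. m i (p i)))"
      by (auto simp: val_ge_def sgn sign_def split: if_splits)
  qed
  show "hcoeff (det_fun r m) W = det_fun r (\<lambda>i j. hcoeff (m i j) (x i - y j))"
    unfolding det_fun_leibniz hcoeff_sum sgn by (rule sum.cong) (use * in auto)
qed

definition dot_exponent :: "real ^ 'n \<Rightarrow> ('n::finite \<Rightarrow>\<^sub>0 nat) \<Rightarrow> real"
  where "dot_exponent \<omega> \<nu> = (\<Sum>i\<in>UNIV. vec_nth \<omega> i * real (Poly_Mapping.lookup \<nu> i))"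

lemma dot_exponent_add: "dot_exponent \<omega> (\<alpha> + \<beta>) = dot_exponent \<omega> \<alpha> + dot_exponent \<omega> \<beta>"
  by (simp add: dot_exponent_def lookup_add distrib_left sum.distrib)

text \<open>The polynomials whose coefficients have nonnegative valuation after the substitution
  \<open>x\<^sub>i \<mapsto> t^\<omega>\<^sub>i x\<^sub>i\<close>; they form a ring on which \<open>reduce \<omega>\<close> is a ring homomorphism.\<close>

definition weight_ring :: "real ^ 'n \<Rightarrow> ('n::finite, 'k::zero hahn) mpoly set"
  where "weight_ring \<omega> = {f. \<forall>\<nu>. val_ge (- dot_exponent \<omega> \<nu>) (Poly_Mapping.lookup f \<nu>)}"

definition reduce :: "real ^ 'n \<Rightarrow> ('n::finite, 'k::zero hahn) mpoly \<Rightarrow> ('n, 'k) mpoly"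
  where "reduce \<omega> f = Poly_Mapping.mapp (\<lambda>\<nu> a. hcoeff a (- dot_exponent \<omega> \<nu>)) f"

lemma lookup_reduce: "Poly_Mapping.lookup (reduce \<omega> f) \<nu> = hcoeff (Poly_Mapping.lookup f \<nu>) (- dot_exponent \<omega> \<nu>)"
  by (auto simp: reduce_def lookup_mapp when_def in_keys_iff)

lemma tpow_add: "(tpow a :: 'k::comm_ring_1 hahn) * tpow b = tpow (a + b)"
  by (auto simp: hahn_eq_iff hcoeff_mult_single_left hcoeff_single)

lemma tpow_0: "(tpow 0 :: 'k::comm_ring_1 hahn) = 1"
  by (simp add: one_hahn_def)

lemma tpow_power: "(tpow a :: 'k::comm_ring_1 hahn) ^ n = tpow (a * real n)"
  by (induction n) (simp_all add: tpow_0 tpow_add algebra_simps)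

lemma prod_tpow: "(\<Prod>i\<in>A. tpow (a i) :: 'k::comm_ring_1 hahn) = tpow (\<Sum>i\<in>A. a i)"
  by (induction A rule: infinite_finite_induct) (simp_all add: tpow_0 tpow_add)

lemma single_power:
  "Poly_Mapping.single \<alpha> (c :: 'a::comm_ring_1) ^ n = Poly_Mapping.single (\<Sum>_<n. \<alpha>) (c ^ n)"
  for \<alpha> :: "'b::comm_monoid_add" and n :: nat
  by (induction n) (simp_all add: mult_single add.commute sum.lessThan_Suc)

lemma prod_single:
  "(\<Prod>i\<in>A. Poly_Mapping.single (\<alpha> i) (c i :: 'a::comm_ring_1)) = Poly_Mapping.single (\<Sum>i\<in>A. \<alpha> i) (\<Prod>i\<in>A. c i)"
  for \<alpha> :: "_ \<Rightarrow> 'b::comm_monoid_add"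
  by (induction A rule: infinite_finite_induct) (simp_all add: mult_single)

lemma monomial_eq_sum: "(\<Sum>i\<in>UNIV. \<Sum>_<Poly_Mapping.lookup \<nu> i. Poly_Mapping.single i (1::nat)) = \<nu>"
  for \<nu> :: "'n::finite \<Rightarrow>\<^sub>0 nat"
proof (rule poly_mapping_eqI)
  fix j
  have "Poly_Mapping.lookup (\<Sum>i\<in>UNIV. \<Sum>_<Poly_Mapping.lookup \<nu> i. Poly_Mapping.single i (1::nat)) j
      = (\<Sum>i\<in>UNIV. if i = j then Poly_Mapping.lookup \<nu> j else 0)"
    unfolding lookup_sum by (rule sum.cong) (auto simp: lookup_single when_def)
  then show "Poly_Mapping.lookup (\<Sum>i\<in>UNIV. \<Sum>_<Poly_Mapping.lookup \<nu> i. Poly_Mapping.single i (1::nat)) j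
      = Poly_Mapping.lookup \<nu> j" by simp
qed

lemma msubst_scaling_monomial:
  "(\<Prod>i\<in>UNIV. (mconst (tpow (vec_nth \<omega> i)) * mvar i) ^ Poly_Mapping.lookup \<nu> i)
    = Poly_Mapping.single \<nu> (tpow (dot_exponent \<omega> \<nu>) :: 'k::comm_ring_1 hahn)"
proof -
  have "(mconst (tpow (vec_nth \<omega> i)) * mvar i) ^ k =
      Poly_Mapping.single (\<Sum>_<k. Poly_Mapping.single i (1::nat)) (tpow (vec_nth \<omega> i * real k) :: 'k hahn)" for i k
    by (simp only: mconst_def mvar_def mult_single single_power tpow_power add_0 mult_1_right)
  then show ?thesis by (simp only: prod_single prod_tpow monomial_eq_sum dot_exponent_def)
qed

lemma sum_single_lookup:
  assumes "finite A" "Poly_Mapping.keys f \<subseteq> A"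
  shows "(\<Sum>\<nu>\<in>A. Poly_Mapping.single \<nu> (Poly_Mapping.lookup f \<nu>)) = f"
proof (rule poly_mapping_eqI)
  fix \<mu>
  have "Poly_Mapping.lookup (\<Sum>\<nu>\<in>A. Poly_Mapping.single \<nu> (Poly_Mapping.lookup f \<nu>)) \<mu>
      = (\<Sum>\<nu>\<in>A. if \<nu> = \<mu> then Poly_Mapping.lookup f \<mu> else 0)"
    unfolding lookup_sum by (rule sum.cong) (auto simp: lookup_single when_def)
  then show "Poly_Mapping.lookup (\<Sum>\<nu>\<in>A. Poly_Mapping.single \<nu> (Poly_Mapping.lookup f \<nu>)) \<mu>
      = Poly_Mapping.lookup f \<mu>" using assms by (auto simp: in_keys_iff)
qed

lemma lookup_msubst_scaling:
  "Poly_Mapping.lookup (msubst (\<lambda>i. mconst (tpow (vec_nth \<omega> i)) * mvar i) f) \<nu>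
    = tpow (dot_exponent \<omega> \<nu>) * (Poly_Mapping.lookup f \<nu> :: 'k::comm_ring_1 hahn)"
proof -
  have "Poly_Mapping.lookup (msubst (\<lambda>i. mconst (tpow (vec_nth \<omega> i)) * mvar i) f) \<nu>
     = (\<Sum>\<mu>\<in>Poly_Mapping.keys f. if \<mu> = \<nu> then Poly_Mapping.lookup f \<nu> * tpow (dot_exponent \<omega> \<nu>) else 0)"
    unfolding msubst_def lookup_sum msubst_scaling_monomial lookup_mconst_mult
    by (rule sum.cong) (auto simp: lookup_single when_def)
  then show ?thesis by (auto simp: mult.commute in_keys_iff)
qed

lemma lookup_map_zero:
  "f 0 = 0 \<Longrightarrow> Poly_Mapping.lookup (Poly_Mapping.map f p) \<nu> = f (Poly_Mapping.lookup p \<nu>)"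
  by (simp add: map.rep_eq when_def)

text \<open>Scaling by a power of \<open>t\<close> moves the tropical weight to zero, where initial form and reduction agree.\<close>

lemma initial_form_eq_reduce:
  assumes "f \<noteq> 0"
  shows "initial_form \<omega> f = reduce \<omega> (mconst (tpow (- tropical_weight \<omega> f)) * f)"
proof (rule poly_mapping_eqI)
  fix \<nu>
  show "Poly_Mapping.lookup (initial_form \<omega> f) \<nu> =
      Poly_Mapping.lookup (reduce \<omega> (mconst (tpow (- tropical_weight \<omega> f)) * f)) \<nu>"
    by (simp only: initial_form_def if_not_P[OF assms] lookup_map_zero[of "\<lambda>a. hcoeff a 0", OF hcoeff_0] lookup_reduce
        lookup_mconst_mult lookup_msubst_scaling hcoeff_mult_single_left mult_1_left)
       (simp add: algebra_simps)
qed

lemma tropical_weight_le: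
  assumes "\<nu> \<in> Poly_Mapping.keys f"
  shows "tropical_weight \<omega> f \<le> hval (Poly_Mapping.lookup f \<nu>) + dot_exponent \<omega> \<nu>"
  unfolding tropical_weight_def dot_exponent_def by (rule Min_le) (use assms in auto)

lemma val_ge_tropical_weight: "val_ge (tropical_weight \<omega> f - dot_exponent \<omega> \<nu>) (Poly_Mapping.lookup f \<nu>)"
proof (cases "Poly_Mapping.lookup f \<nu> = 0")
  case False
  then show ?thesis using tropical_weight_le[of \<nu> f \<omega>] by (simp add: val_ge_iff in_keys_iff)
qed simp

lemma val_ge_single: "val_ge w (hsingle w c)"
  by (auto simp: val_ge_def hcoeff_single)

lemma reduce_add: "reduce \<omega> (f + g) = reduce \<omega> f + reduce \<omega> (g :: ('n::finite, 'k::comm_ring_1 hahn) mpoly)"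
  by (rule poly_mapping_eqI) (simp add: lookup_reduce lookup_add)

lemma reduce_0: "reduce \<omega> 0 = 0"
  by (rule poly_mapping_eqI) (simp add: lookup_reduce)

text \<open>Multiplication by a term over the residue field lifts to the weight ring. This makes the image of an
  ideal under \<open>reduce \<omega>\<close> an ideal.\<close>

lemma weight_ring_single_mult:
  fixes f :: "('n::finite, 'k::comm_ring_1 hahn) mpoly" and \<alpha> :: "'n \<Rightarrow>\<^sub>0 nat" and c :: 'k
  assumes "f \<in> weight_ring \<omega>"
  defines "g \<equiv> Poly_Mapping.single \<alpha> (hsingle (- dot_exponent \<omega> \<alpha>) c) * f"
  shows "g \<in> weight_ring \<omega>" "reduce \<omega> g = Poly_Mapping.single \<alpha> c * reduce \<omega> f"
proof -
  have *: "val_ge (- dot_exponent \<omega> \<mu>) (Poly_Mapping.lookup g \<mu>) \<and>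
    Poly_Mapping.lookup (reduce \<omega> g) \<mu> = Poly_Mapping.lookup (Poly_Mapping.single \<alpha> c * reduce \<omega> f) \<mu>" for \<mu>
  proof (cases "\<exists>\<nu>. \<mu> = \<alpha> + \<nu>")
    case True
    then obtain \<nu> where \<mu>: "\<mu> = \<alpha> + \<nu>" by blast
    have f: "val_ge (- dot_exponent \<omega> \<nu>) (Poly_Mapping.lookup f \<nu>)" using assms by (simp add: weight_ring_def)
    show ?thesis
      using val_ge_mult[OF val_ge_single[of "- dot_exponent \<omega> \<alpha>" c] f]
      by (simp add: \<mu> g_def lookup_reduce lookup_single_mult dot_exponent_add hcoeff_single)
  next
    case False
    then have "\<mu> \<notin> Poly_Mapping.keys g" "\<mu> \<notin> Poly_Mapping.keys (Poly_Mapping.single \<alpha> c * reduce \<omega> f)"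
      unfolding g_def by (metis keys_single_mult)+
    then show ?thesis by (simp add: in_keys_iff lookup_reduce)
  qed
  show "g \<in> weight_ring \<omega>" unfolding weight_ring_def using * by simp
  show "reduce \<omega> g = Poly_Mapping.single \<alpha> c * reduce \<omega> f" by (rule poly_mapping_eqI) (use * in simp)
qed

text \<open>The reductions of the elements of an ideal form an ideal by themselves, and each is zero or an initial form: for an
  element of the weight ring with positive tropical weight the reduction is zero, and for tropical
  weight zero it is the initial form.\<close>

theorem initial_ideal_eq_reduce:
  fixes I :: "('n::finite, 'k::field hahn) mpoly set"
  assumes I: "ideal.subspace I"
  shows "initial_ideal \<omega> I = reduce \<omega> ` (I \<inter> weight_ring \<omega>)"
proof
  have zero: "0 \<in> I \<inter> weight_ring \<omega>" using ideal.subspace_0[OF I] by (simp add: weight_ring_def)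
  show "initial_ideal \<omega> I \<subseteq> reduce \<omega> ` (I \<inter> weight_ring \<omega>)"
    unfolding initial_ideal_def
  proof (rule ideal.span_minimal)
    show "initial_form \<omega> ` I \<subseteq> reduce \<omega> ` (I \<inter> weight_ring \<omega>)"
    proof (rule image_subsetI)
      fix f assume f: "f \<in> I"
      show "initial_form \<omega> f \<in> reduce \<omega> ` (I \<inter> weight_ring \<omega>)"
      proof (cases "f = 0")
        case True
        show ?thesis by (rule image_eqI[OF _ zero]) (simp add: True initial_form_def reduce_0)
      next
        case False
        let ?g = "mconst (tpow (- tropical_weight \<omega> f)) * f"
        have "val_ge (- dot_exponent \<omega> \<nu>) (Poly_Mapping.lookup ?g \<nu>)" for \<nu>
          using val_ge_mult(1)[OF val_ge_single[of "- tropical_weight \<omega> f" 1] val_ge_tropical_weight[of \<omega> f \<nu>]]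
          by (simp add: lookup_mconst_mult)
        then have "?g \<in> I \<inter> weight_ring \<omega>" using ideal.subspace_scale[OF I f] by (simp add: weight_ring_def)
        then show ?thesis unfolding initial_form_eq_reduce[OF False] by (rule imageI)
      qed
    qed
    show "ideal.subspace (reduce \<omega> ` (I \<inter> weight_ring \<omega>))"
    proof -
      have add: "x + y \<in> reduce \<omega> ` (I \<inter> weight_ring \<omega>)"
        if xy: "x \<in> reduce \<omega> ` (I \<inter> weight_ring \<omega>)" "y \<in> reduce \<omega> ` (I \<inter> weight_ring \<omega>)" for x y
      proof -
        obtain f g where fg: "f \<in> I \<inter> weight_ring \<omega>" "g \<in> I \<inter> weight_ring \<omega>" "x = reduce \<omega> f" "y = reduce \<omega> g"
          using xy by (elim imageE)
        have "f + g \<in> I \<inter> weight_ring \<omega>"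
          using fg(1,2) ideal.subspace_add[OF I] by (auto simp: weight_ring_def lookup_add intro: val_ge_add)
        then show ?thesis unfolding fg(3,4) reduce_add[symmetric] by (rule imageI)
      qed
      have zero': "0 \<in> reduce \<omega> ` (I \<inter> weight_ring \<omega>)"
        by (rule image_eqI[OF _ zero]) (simp add: reduce_0)
      have single: "Poly_Mapping.single \<alpha> c * x \<in> reduce \<omega> ` (I \<inter> weight_ring \<omega>)"
        if x: "x \<in> reduce \<omega> ` (I \<inter> weight_ring \<omega>)" for \<alpha> c x
      proof -
        obtain f where f: "f \<in> I \<inter> weight_ring \<omega>" "x = reduce \<omega> f" using x by (elim imageE)
        have fw: "f \<in> weight_ring \<omega>" using f(1) by simp
        have "Poly_Mapping.single \<alpha> (hsingle (- dot_exponent \<omega> \<alpha>) c) * f \<in> I \<inter> weight_ring \<omega>"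
          using weight_ring_single_mult(1)[OF fw] ideal.subspace_scale[OF I] f(1) by simp
        then show ?thesis unfolding f(2) weight_ring_single_mult(2)[OF fw, symmetric] by (rule imageI)
      qed
      show ?thesis
      proof (rule ideal.subspaceI)
        fix s x :: "('n, 'k) mpoly" assume x: "x \<in> reduce \<omega> ` (I \<inter> weight_ring \<omega>)"
        have "(\<Sum>\<nu>\<in>A. Poly_Mapping.single \<nu> (Poly_Mapping.lookup s \<nu>) * x) \<in> reduce \<omega> ` (I \<inter> weight_ring \<omega>)"
          for A :: "('n \<Rightarrow>\<^sub>0 nat) set"
        proof (induction A rule: infinite_finite_induct)
          case (insert \<nu> A)
          show ?case unfolding sum.insert[OF insert.hyps] by (rule add[OF single[OF x] insert.IH])
        qed (simp_all only: sum.infinite sum.empty zero' not_False_eq_True)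
        from this[of "Poly_Mapping.keys s"]
        show "s * x \<in> reduce \<omega> ` (I \<inter> weight_ring \<omega>)"
          unfolding sum_distrib_right[symmetric] by (simp only: sum_single_lookup[OF finite_keys subset_refl])
      qed (fact zero', fact add)
    qed
  qed
  show "reduce \<omega> ` (I \<inter> weight_ring \<omega>) \<subseteq> initial_ideal \<omega> I"
  proof (rule image_subsetI)
    fix f assume f: "f \<in> I \<inter> weight_ring \<omega>"
    show "reduce \<omega> f \<in> initial_ideal \<omega> I"
    proof (cases "f = 0")
      case True
      then show ?thesis unfolding initial_ideal_def by (simp only: reduce_0 ideal.span_zero)
    next
      case False
      have "tropical_weight \<omega> f \<ge> 0"
      proof -
        have "0 \<le> hval (Poly_Mapping.lookup f \<nu>) + dot_exponent \<omega> \<nu>" if "\<nu> \<in> Poly_Mapping.keys f" for \<nu>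
          using f that val_ge_iff[of "Poly_Mapping.lookup f \<nu>" "- dot_exponent \<omega> \<nu>"]
          by (simp add: weight_ring_def in_keys_iff)
        moreover have "Poly_Mapping.keys f \<noteq> {}" using False by simp
        ultimately show ?thesis unfolding tropical_weight_def dot_exponent_def[symmetric] by simp
      qed
      then consider "tropical_weight \<omega> f = 0" | "tropical_weight \<omega> f > 0" by linarith
      then show ?thesis
      proof cases
        case 1
        then have "initial_form \<omega> f = reduce \<omega> f"
          unfolding initial_form_eq_reduce[OF False] by (simp add: tpow_0 mconst_def)
        then show ?thesis unfolding initial_ideal_def using f by (metis IntD1 ideal.span_base imageI)
      next
        case 2
        have "reduce \<omega> f = 0"
          by (rule poly_mapping_eqI)
             (use 2 val_geD[OF val_ge_tropical_weight[of \<omega> f]] in \<open>simp add: lookup_reduce\<close>)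
        then show ?thesis unfolding initial_ideal_def by (simp only: ideal.span_zero)
      qed
    qed
  qed
qed

lemma initial_ideal_subspace: "ideal.subspace (initial_ideal \<omega> I)"
  unfolding initial_ideal_def by (rule ideal.subspace_span)

lemma trunc_weight_ring: "f \<in> weight_ring \<omega> \<Longrightarrow> trunc d f \<in> weight_ring \<omega>"
  by (simp add: weight_ring_def lookup_trunc)

lemma trunc_reduce: "trunc d (reduce \<omega> f) = reduce \<omega> (trunc d f)"
  by (rule poly_mapping_eqI) (simp add: lookup_trunc lookup_reduce)

lemma trunc_closed_initial_ideal:
  fixes I :: "('n::finite, 'k::field hahn) mpoly set"
  assumes I: "ideal.subspace I" "trunc_closed I"
  shows "trunc_closed (initial_ideal \<omega> I)"
  unfolding trunc_closed_def initial_ideal_eq_reduce[OF I(1)]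
proof (intro ballI allI)
  fix x d assume "x \<in> reduce \<omega> ` (I \<inter> weight_ring \<omega>)"
  then obtain f where f: "f \<in> I \<inter> weight_ring \<omega>" "x = reduce \<omega> f" by (elim imageE)
  have "trunc d f \<in> I \<inter> weight_ring \<omega>"
    using f(1) I(2) by (simp add: trunc_closed_def trunc_weight_ring)
  then show "trunc d x \<in> reduce \<omega> ` (I \<inter> weight_ring \<omega>)"
    unfolding f(2) trunc_reduce by (rule imageI)
qed

text \<open>An element of the initial ideal of low degree lifts to the truncation of any of its lifts.\<close>

lemma upto_degree_initial_ideal:
  fixes I :: "('n::finite, 'k::field hahn) mpoly set"
  assumes I: "ideal.subspace I" "trunc_closed I"
  shows "upto_degree d (initial_ideal \<omega> I) = reduce \<omega> ` (upto_degree d I \<inter> weight_ring \<omega>)"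
  unfolding initial_ideal_eq_reduce[OF I(1)]
proof (rule equalityI; rule subsetI)
  fix x assume x: "x \<in> upto_degree d (reduce \<omega> ` (I \<inter> weight_ring \<omega>))"
  then obtain f where f: "f \<in> I \<inter> weight_ring \<omega>" "x = reduce \<omega> f" by (auto simp: upto_degree_def)
  have "x = trunc d x" using x by (simp add: upto_degree_def trunc_id)
  then have eq: "x = reduce \<omega> (trunc d f)" by (simp add: f(2) trunc_reduce)
  have "trunc d f \<in> upto_degree d I \<inter> weight_ring \<omega>"
    using f(1) I(2) by (simp add: trunc_closed_def trunc_weight_ring upto_degree_def keys_trunc)
  then show "x \<in> reduce \<omega> ` (upto_degree d I \<inter> weight_ring \<omega>)" unfolding eq by (rule imageI)
next
  fix x assume "x \<in> reduce \<omega> ` (upto_degree d I \<inter> weight_ring \<omega>)"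
  then obtain f where f: "f \<in> upto_degree d I \<inter> weight_ring \<omega>" "x = reduce \<omega> f" by (elim imageE)
  have "Poly_Mapping.keys x \<subseteq> Poly_Mapping.keys f"
    unfolding f(2) reduce_def by (rule keys_mapp_subset)
  then show "x \<in> upto_degree d (reduce \<omega> ` (I \<inter> weight_ring \<omega>))"
    using f by (auto simp: upto_degree_def)
qed

section \<open>Reductions and minimal Pluecker coordinates\<close>

definition exponent_sum :: "nat \<Rightarrow> (nat \<Rightarrow> ('n::finite \<Rightarrow>\<^sub>0 nat)) \<Rightarrow> real ^ 'n"
  where "exponent_sum r J = (\<chi> i. \<Sum>j<r. real (Poly_Mapping.lookup (J j) i))"

lemma inner_exponent_sum: "inner (exponent_sum r J) \<omega> = (\<Sum>j<r. dot_exponent \<omega> (J j))"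
proof -
  have "inner (exponent_sum r J) \<omega> = (\<Sum>i\<in>UNIV. \<Sum>j<r. vec_nth \<omega> i * real (Poly_Mapping.lookup (J j) i))"
    by (simp add: inner_vec_def exponent_sum_def sum_distrib_left mult.commute)
  also have "\<dots> = (\<Sum>j<r. \<Sum>i\<in>UNIV. vec_nth \<omega> i * real (Poly_Mapping.lookup (J j) i))" by (rule sum.swap)
  finally show ?thesis by (simp only: dot_exponent_def)
qed

lemma dot_exponent_sum_exchange:
  fixes i r :: nat
  assumes "i < r"
  shows "(\<Sum>j<r. dot_exponent \<omega> ((J(i := e)) j)) = (\<Sum>j<r. dot_exponent \<omega> (J j)) - dot_exponent \<omega> (J i) + dot_exponent \<omega> e"
proof -
  have i: "i \<in> {..<r}" "finite {..<r}" using assms by auto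
  have "(\<Sum>j\<in>{..<r} - {i}. dot_exponent \<omega> ((J(i := e)) j)) = (\<Sum>j\<in>{..<r} - {i}. dot_exponent \<omega> (J j))"
    by (rule sum.cong) auto
  then show ?thesis
    using sum.remove[OF i(2,1), of "\<lambda>j. dot_exponent \<omega> ((J(i := e)) j)"] sum.remove[OF i(2,1), of "\<lambda>j. dot_exponent \<omega> (J j)"]
    by simp
qed

text \<open>A finite-dimensional space of polynomials over the field of series. The minimised affine functions are
  the valuations of its nonzero Pluecker coordinates, shifted by the weight of their monomials.\<close>

locale subspace_over_hahn =
  fixes r :: nat and f :: "nat \<Rightarrow> ('n::finite, 'k::field hahn) mpoly"
    and V :: "('n, 'k hahn) mpoly set" and E :: "('n \<Rightarrow>\<^sub>0 nat) set"
  assumes basis: "lin_basis r f V" and finite_E: "finite E"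
    and keys_V: "g \<in> V \<Longrightarrow> Poly_Mapping.keys g \<subseteq> E"
begin

definition bases :: "(nat \<Rightarrow> ('n \<Rightarrow>\<^sub>0 nat)) set"
  where "bases = {J \<in> {..<r} \<rightarrow>\<^sub>E E. pluecker r f J \<noteq> 0}"

sublocale affine_family bases "\<lambda>J. hval (pluecker r f J)" "exponent_sum r"
proof
  have "finite ({..<r} \<rightarrow>\<^sub>E E)" using finite_E by (intro finite_PiE) auto
  then show "finite bases" by (simp add: bases_def)
  obtain J where "J \<in> {..<r} \<rightarrow>\<^sub>E E" "pluecker r f J \<noteq> 0"
    by (rule pluecker_nonzero_exists[OF basis finite_E keys_V]) (assumption | rule that)+
  then show "bases \<noteq> {}" by (auto simp: bases_def)
qed

lemma aff_bases: "aff J \<omega> = hval (pluecker r f J) + (\<Sum>j<r. dot_exponent \<omega> (J j))"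
  by (simp add: aff_def inner_exponent_sum)

text \<open>The initial space of \<open>V\<close> at \<open>\<omega>\<close>.\<close>

definition reduction :: "real ^ 'n \<Rightarrow> ('n, 'k) mpoly set"
  where "reduction \<omega> = reduce \<omega> ` (V \<inter> weight_ring \<omega>)"

text \<open>A basis that is dual to a tuple \<open>J\<close> of monomials represents \<open>V\<close> by its values at \<open>J\<close>. If \<open>J\<close> is a minimiser at
  \<open>\<omega>\<close>, the suitably scaled dual basis reduces to a basis of the initial space.\<close>

context
  fixes J f'
  assumes J: "J \<in> bases" and f': "lin_basis r f' V"
    and dual: "\<And>i j. i < r \<Longrightarrow> j < r \<Longrightarrow> Poly_Mapping.lookup (f' i) (J j) = (if i = j then 1 else 0)"
begin

lemma pluecker_f': obtains c where "c \<noteq> 0" "\<And>J'. pluecker r f' J' = c * pluecker r f J'"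
proof (rule pluecker_unique_up_to_scalar[OF basis f'])
  show "pluecker r f' J \<noteq> 0" using pluecker_dual[OF dual] by simp
qed (rule that)

text \<open>Passing to the dual basis multiplies all Pluecker coordinates by one scalar, so it shifts all affine
  functions by one constant \<open>d\<close>.\<close>

lemma aff_f':
  obtains d where "aff J \<omega> = d + (\<Sum>j<r. dot_exponent \<omega> (J j))"
    "\<And>J'. pluecker r f' J' \<noteq> 0 \<Longrightarrow> aff J' \<omega> = d + hval (pluecker r f' J') + (\<Sum>j<r. dot_exponent \<omega> (J' j))"
    "\<And>J'. pluecker r f' J' \<noteq> 0 \<longleftrightarrow> pluecker r f J' \<noteq> 0"
proof -
  obtain c where c: "c \<noteq> 0" "\<And>J'. pluecker r f' J' = c * pluecker r f J'" by (rule pluecker_f') (rule that)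
  have nz: "pluecker r f' J' \<noteq> 0 \<longleftrightarrow> pluecker r f J' \<noteq> 0" for J' by (simp add: c)
  have v: "hval (pluecker r f' J') = hval c + hval (pluecker r f J')" if "pluecker r f' J' \<noteq> 0" for J'
    using hval_mult[OF c(1), of "pluecker r f J'"] that nz by (simp add: c(2))
  have "pluecker r f' J = 1" by (rule pluecker_dual[OF dual])
  then have "0 = hval c + hval (pluecker r f J)" using v[of J] by (simp add: hval_1)
  then have "aff J \<omega> = - hval c + (\<Sum>j<r. dot_exponent \<omega> (J j))" by (simp add: aff_bases)
  moreover have "aff J' \<omega> = - hval c + hval (pluecker r f' J') + (\<Sum>j<r. dot_exponent \<omega> (J' j))"
    if "pluecker r f' J' \<noteq> 0" for J'
    using v[OF that] by (simp add: aff_bases)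
  ultimately show ?thesis using nz by (rule that)
qed

lemma exchange_PiE: "i < r \<Longrightarrow> e \<in> E \<Longrightarrow> J(i := e) \<in> {..<r} \<rightarrow>\<^sub>E E"
  using J by (auto simp: bases_def PiE_def extensional_def)

text \<open>The coefficients of the dual basis are the Pluecker coordinates at the exchanges \<open>J(i := e)\<close>, so this
  inequality is the minimality of \<open>J\<close> among its exchanges.\<close>

lemma val_ge_dual_basis:
  assumes act: "J \<in> active \<omega>" and i: "i < r"
  shows "val_ge (dot_exponent \<omega> (J i) - dot_exponent \<omega> e) (Poly_Mapping.lookup (f' i) e)"
proof (cases "Poly_Mapping.lookup (f' i) e = 0")
  case False
  then have "e \<in> E" using keys_V[OF lin_basis_mem[OF f' i]] by (auto simp: in_keys_iff)
  obtain d where d: "aff J \<omega> = d + (\<Sum>j<r. dot_exponent \<omega> (J j))"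
    "\<And>J'. pluecker r f' J' \<noteq> 0 \<Longrightarrow> aff J' \<omega> = d + hval (pluecker r f' J') + (\<Sum>j<r. dot_exponent \<omega> (J' j))"
    "\<And>J'. pluecker r f' J' \<noteq> 0 \<longleftrightarrow> pluecker r f J' \<noteq> 0" by (rule aff_f'[of \<omega>]) (rule that)
  have ex: "pluecker r f' (J(i := e)) = Poly_Mapping.lookup (f' i) e" by (rule pluecker_dual_exchange[OF dual i])
  then have nz: "pluecker r f' (J(i := e)) \<noteq> 0" using False by simp
  then have "J(i := e) \<in> bases" using exchange_PiE[OF i \<open>e \<in> E\<close>] d(3) by (simp add: bases_def)
  then have "aff J \<omega> \<le> aff (J(i := e)) \<omega>" using act by (simp add: active_def)
  then have "dot_exponent \<omega> (J i) - dot_exponent \<omega> e \<le> hval (Poly_Mapping.lookup (f' i) e)"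
    unfolding d(1) d(2)[OF nz] dot_exponent_sum_exchange[OF i] ex by linarith
  then show ?thesis by (simp only: val_ge_iff[OF False])
qed simp

text \<open>The scaling makes the coefficient of \<open>f' i\<close> at \<open>J i\<close>, which is one, reduce to one.\<close>

definition reduced_basis :: "real ^ 'n \<Rightarrow> nat \<Rightarrow> ('n, 'k) mpoly"
  where "reduced_basis \<omega> i = reduce \<omega> (mconst (tpow (- dot_exponent \<omega> (J i))) * f' i)"

lemma lookup_reduced_basis:
  "Poly_Mapping.lookup (reduced_basis \<omega> i) e = hcoeff (Poly_Mapping.lookup (f' i) e) (dot_exponent \<omega> (J i) - dot_exponent \<omega> e)"
  by (simp add: reduced_basis_def lookup_reduce lookup_mconst_mult hcoeff_mult_single_left)

lemma reduced_basis_dual: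
  "i < r \<Longrightarrow> j < r \<Longrightarrow> Poly_Mapping.lookup (reduced_basis \<omega> i) (J j) = (if i = j then 1 else 0)"
  by (simp add: lookup_reduced_basis dual hcoeff_1)

lemma reduce_lincomb:
  assumes act: "J \<in> active \<omega>" and a: "\<And>i. i < r \<Longrightarrow> val_ge (- dot_exponent \<omega> (J i)) (a i)"
  shows "lincomb r a f' \<in> V \<inter> weight_ring \<omega>"
    "reduce \<omega> (lincomb r a f') = lincomb r (\<lambda>i. hcoeff (a i) (- dot_exponent \<omega> (J i))) (reduced_basis \<omega>)"
proof -
  have *: "val_ge (- dot_exponent \<omega> e) (a i * Poly_Mapping.lookup (f' i) e)"
      "hcoeff (a i * Poly_Mapping.lookup (f' i) e) (- dot_exponent \<omega> e) =
        hcoeff (a i) (- dot_exponent \<omega> (J i)) * Poly_Mapping.lookup (reduced_basis \<omega> i) e" if "i < r" for i e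
  proof -
    have s: "- dot_exponent \<omega> (J i) + (dot_exponent \<omega> (J i) - dot_exponent \<omega> e) = - dot_exponent \<omega> e" by simp
    note m = val_ge_mult[OF a[OF that] val_ge_dual_basis[OF act that, of e], unfolded s]
    show "val_ge (- dot_exponent \<omega> e) (a i * Poly_Mapping.lookup (f' i) e)" by (rule m(1))
    show "hcoeff (a i * Poly_Mapping.lookup (f' i) e) (- dot_exponent \<omega> e) =
        hcoeff (a i) (- dot_exponent \<omega> (J i)) * Poly_Mapping.lookup (reduced_basis \<omega> i) e"
      unfolding lookup_reduced_basis by (rule m(2))
  qed
  have "lincomb r a f' \<in> weight_ring \<omega>"
    unfolding weight_ring_def by (auto simp: lookup_lincomb intro!: val_ge_sum *(1))
  moreover have "lincomb r a f' \<in> V" by (subst lin_basis_range[OF f']) (rule lincomb_rangeI, rule refl)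
  ultimately show "lincomb r a f' \<in> V \<inter> weight_ring \<omega>" by blast
  show "reduce \<omega> (lincomb r a f') = lincomb r (\<lambda>i. hcoeff (a i) (- dot_exponent \<omega> (J i))) (reduced_basis \<omega>)"
  proof (rule poly_mapping_eqI)
    fix e
    show "Poly_Mapping.lookup (reduce \<omega> (lincomb r a f')) e =
        Poly_Mapping.lookup (lincomb r (\<lambda>i. hcoeff (a i) (- dot_exponent \<omega> (J i))) (reduced_basis \<omega>)) e"
      unfolding lookup_reduce lookup_lincomb hcoeff_sum by (rule sum.cong) (use *(2) in auto)
  qed
qed

text \<open>The coordinates of an element with respect to the dual basis are its coefficients at \<open>J\<close>; for an
  element of the weight ring they have residues, and these are the coordinates of the reduction. Any
  coordinates over the residue field lift.\<close>

lemma lin_basis_reduced: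
  assumes act: "J \<in> active \<omega>"
  shows "lin_basis r (reduced_basis \<omega>) (reduction \<omega>)"
proof (rule lin_basisI_dual)
  show "reduction \<omega> = range (\<lambda>a. lincomb r a (reduced_basis \<omega>))"
  proof (rule equalityI)
    show "reduction \<omega> \<subseteq> range (\<lambda>a. lincomb r a (reduced_basis \<omega>))"
      unfolding reduction_def
    proof (rule image_subsetI)
      fix x assume x: "x \<in> V \<inter> weight_ring \<omega>"
      have "val_ge (- dot_exponent \<omega> (J i)) (Poly_Mapping.lookup x (J i))" for i using x by (simp add: weight_ring_def)
      note red = reduce_lincomb(2)[OF act, of "\<lambda>i. Poly_Mapping.lookup x (J i)", OF this]
      have eq: "x = lincomb r (\<lambda>i. Poly_Mapping.lookup x (J i)) f'"
        by (rule lin_basis_dual_expand[OF f' _ dual]) (use x in auto)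
      show "reduce \<omega> x \<in> range (\<lambda>a. lincomb r a (reduced_basis \<omega>))"
        by (subst eq, rule lincomb_rangeI, rule red)
    qed
    show "range (\<lambda>a. lincomb r a (reduced_basis \<omega>)) \<subseteq> reduction \<omega>"
    proof (rule image_subsetI)
      fix b :: "nat \<Rightarrow> 'k"
      have a: "val_ge (- dot_exponent \<omega> (J i)) (hsingle (- dot_exponent \<omega> (J i)) (b i))" for i by (rule val_ge_single)
      have "lincomb r b (reduced_basis \<omega>) = reduce \<omega> (lincomb r (\<lambda>i. hsingle (- dot_exponent \<omega> (J i)) (b i)) f')"
        by (subst reduce_lincomb(2)[OF act a]) (simp add: hcoeff_single)
      then show "lincomb r b (reduced_basis \<omega>) \<in> reduction \<omega>"
        unfolding reduction_def using reduce_lincomb(1)[OF act a] by (rule image_eqI)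
    qed
  qed
qed (rule reduced_basis_dual)

text \<open>The Pluecker coordinate of the reduced basis at \<open>J'\<close> is the coefficient of that of \<open>f'\<close> at the exponent at
  which the affine functions of \<open>J\<close> and \<open>J'\<close> agree, so it is nonzero if and only if \<open>J'\<close> is a minimiser too.\<close>

lemma active_iff_pluecker_reduced:
  assumes act: "J \<in> active \<omega>" and J': "J' \<in> {..<r} \<rightarrow>\<^sub>E E"
  shows "J' \<in> active \<omega> \<longleftrightarrow> pluecker r (reduced_basis \<omega>) J' \<noteq> 0"
proof -
  let ?w = "(\<Sum>j<r. dot_exponent \<omega> (J j)) - (\<Sum>j<r. dot_exponent \<omega> (J' j))"
  obtain d where d: "aff J \<omega> = d + (\<Sum>j<r. dot_exponent \<omega> (J j))"
    "\<And>J'. pluecker r f' J' \<noteq> 0 \<Longrightarrow> aff J' \<omega> = d + hval (pluecker r f' J') + (\<Sum>j<r. dot_exponent \<omega> (J' j))"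
    "\<And>J'. pluecker r f' J' \<noteq> 0 \<longleftrightarrow> pluecker r f J' \<noteq> 0" by (rule aff_f'[of \<omega>]) (rule that)
  have ge: "val_ge (dot_exponent \<omega> (J i) - dot_exponent \<omega> (J' j)) (Poly_Mapping.lookup (f' i) (J' j))" if "i < r" "j < r" for i j
    by (rule val_ge_dual_basis[OF act that(1)])
  have lead: "val_ge ?w (pluecker r f' J')"
      "hcoeff (pluecker r f' J') ?w = pluecker r (reduced_basis \<omega>) J'"
    using det_fun_lead[of r "\<lambda>i. dot_exponent \<omega> (J i)" "\<lambda>j. dot_exponent \<omega> (J' j)" "\<lambda>i j. Poly_Mapping.lookup (f' i) (J' j)", OF ge]
    by (simp_all add: pluecker_def lookup_reduced_basis lessThan_atLeast0)
  have "pluecker r (reduced_basis \<omega>) J' \<noteq> 0 \<longleftrightarrow> pluecker r f' J' \<noteq> 0 \<and> hval (pluecker r f' J') = ?w"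
    using val_ge_lead_iff[OF lead(1)] lead(2) by simp
  also have "\<dots> \<longleftrightarrow> pluecker r f J' \<noteq> 0 \<and> aff J' \<omega> = aff J \<omega>"
    using d by auto
  also have "\<dots> \<longleftrightarrow> J' \<in> bases \<and> aff J' \<omega> = aff J \<omega>" using J' by (simp add: bases_def)
  also have "\<dots> \<longleftrightarrow> J' \<in> active \<omega>" using act by (auto simp: active_def intro: order.antisym)
  finally show ?thesis by simp
qed

text \<open>The reduced basis depends on \<open>\<omega>\<close> only through the set of minimisers, because a coefficient of the dual basis
  survives, with its leading coefficient, exactly if the corresponding exchange is a minimiser.\<close>

lemma lookup_reduced_basis_active:
  assumes act: "J \<in> active \<omega>" and i: "i < r"
  shows "Poly_Mapping.lookup (reduced_basis \<omega> i) e =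
    (if e \<in> E \<and> J(i := e) \<in> active \<omega> then hcoeff (Poly_Mapping.lookup (f' i) e) (hval (Poly_Mapping.lookup (f' i) e)) else 0)"
proof (cases "e \<in> E")
  case True
  have d: "Poly_Mapping.lookup (reduced_basis \<omega> k) (J j) = (if k = j then 1 else 0)"
    if "k < r" "j < r" for k j using that by (rule reduced_basis_dual)
  have "J(i := e) \<in> active \<omega> \<longleftrightarrow> Poly_Mapping.lookup (reduced_basis \<omega> i) e \<noteq> 0"
    using active_iff_pluecker_reduced[OF act exchange_PiE[OF i True]]
      pluecker_dual_exchange[OF d i, of e] by simp
  moreover have "hval (Poly_Mapping.lookup (f' i) e) = dot_exponent \<omega> (J i) - dot_exponent \<omega> e"
    if "Poly_Mapping.lookup (reduced_basis \<omega> i) e \<noteq> 0"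
    using val_ge_lead_iff[OF val_ge_dual_basis[OF act i, of e]] that by (simp add: lookup_reduced_basis)
  ultimately show ?thesis using True by (auto simp: lookup_reduced_basis)
next
  case False
  then have "Poly_Mapping.lookup (f' i) e = 0" using keys_V[OF lin_basis_mem[OF f' i]] by (auto simp: in_keys_iff)
  then show ?thesis using False by (simp add: lookup_reduced_basis)
qed

end

lemma dual_basis_exists:
  assumes "J \<in> bases"
  obtains f' where "lin_basis r f' V"
    "\<And>i j. i < r \<Longrightarrow> j < r \<Longrightarrow> Poly_Mapping.lookup (f' i) (J j) = (if i = j then 1 else 0)"
proof -
  have "pluecker r f J \<noteq> 0" using assms by (simp add: bases_def)
  from lin_basis_dual_exists[OF basis this] show ?thesis using that by blast
qed

lemma dim_reduction: "lin.dim (reduction \<omega>) = r"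
proof -
  obtain J where J: "J \<in> active \<omega>" using active_nonempty by blast
  then have Jb: "J \<in> bases" by (simp add: active_def)
  obtain f' where f': "lin_basis r f' V"
    "\<And>i j. i < r \<Longrightarrow> j < r \<Longrightarrow> Poly_Mapping.lookup (f' i) (J j) = (if i = j then 1 else 0)"
    by (rule dual_basis_exists[OF Jb]) (rule that)
  show ?thesis by (rule lin_basis_dim[OF lin_basis_reduced[OF Jb f' J]])
qed

text \<open>From left to right, the minimisers are the tuples at which the Pluecker coordinates of the reduction do
  not vanish, and these tuples do not depend on the basis of the reduction. From right to left, the
  reductions have the same reduced basis at a common minimiser.\<close>

theorem reduction_eq_iff: "reduction \<omega> = reduction \<omega>' \<longleftrightarrow> active \<omega> = active \<omega>'"
proof
  assume eq: "reduction \<omega> = reduction \<omega>'"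
  obtain J where J: "J \<in> active \<omega>" using active_nonempty by blast
  obtain J' where J': "J' \<in> active \<omega>'" using active_nonempty by blast
  have Jb: "J \<in> bases" "J' \<in> bases" using J J' by (simp_all add: active_def)
  obtain f1 where f1: "lin_basis r f1 V"
    "\<And>i j. i < r \<Longrightarrow> j < r \<Longrightarrow> Poly_Mapping.lookup (f1 i) (J j) = (if i = j then 1 else 0)"
    by (rule dual_basis_exists[OF Jb(1)]) (rule that)
  obtain f2 where f2: "lin_basis r f2 V"
    "\<And>i j. i < r \<Longrightarrow> j < r \<Longrightarrow> Poly_Mapping.lookup (f2 i) (J' j) = (if i = j then 1 else 0)"
    by (rule dual_basis_exists[OF Jb(2)]) (rule that)
  let ?u1 = "reduced_basis J f1 \<omega>" and ?u2 = "reduced_basis J' f2 \<omega>'"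
  have b1: "lin_basis r ?u1 (reduction \<omega>)" by (rule lin_basis_reduced[OF Jb(1) f1 J])
  have b2: "lin_basis r ?u2 (reduction \<omega>)" unfolding eq by (rule lin_basis_reduced[OF Jb(2) f2 J'])
  have "pluecker r ?u2 J' \<noteq> 0"
    using active_iff_pluecker_reduced[OF Jb(2) f2 J', of J'] J' Jb(2) by (simp add: bases_def)
  obtain c where c: "c \<noteq> 0" "\<And>K. pluecker r ?u2 K = c * pluecker r ?u1 K"
    by (rule pluecker_unique_up_to_scalar[OF b1 b2 \<open>pluecker r ?u2 J' \<noteq> 0\<close>]) (rule that)
  have "K \<in> active \<omega> \<longleftrightarrow> K \<in> active \<omega>'" for K
  proof (cases "K \<in> {..<r} \<rightarrow>\<^sub>E E")
    case True
    note 1 = active_iff_pluecker_reduced[OF Jb(1) f1 J True]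
    note 2 = active_iff_pluecker_reduced[OF Jb(2) f2 J' True]
    show ?thesis using 1 2 by (simp add: c)
  next
    case False
    then have "K \<notin> bases" by (simp add: bases_def)
    then show ?thesis by (simp add: active_def)
  qed
  then show "active \<omega> = active \<omega>'" by blast
next
  assume eq: "active \<omega> = active \<omega>'"
  obtain J where J: "J \<in> active \<omega>" using active_nonempty by blast
  then have J': "J \<in> active \<omega>'" by (simp only: eq)
  have Jb: "J \<in> bases" using J by (simp add: active_def)
  obtain f' where f': "lin_basis r f' V"
    "\<And>i j. i < r \<Longrightarrow> j < r \<Longrightarrow> Poly_Mapping.lookup (f' i) (J j) = (if i = j then 1 else 0)"
    by (rule dual_basis_exists[OF Jb]) (rule that)
  have "reduced_basis J f' \<omega> i = reduced_basis J f' \<omega>' i" if "i < r" for i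
    by (rule poly_mapping_eqI)
       (simp only: lookup_reduced_basis_active[OF Jb f' J that] lookup_reduced_basis_active[OF Jb f' J' that] eq)
  then have "lincomb r a (reduced_basis J f' \<omega>) = lincomb r a (reduced_basis J f' \<omega>')" for a
    unfolding lincomb_def by (intro sum.cong) auto
  then show "reduction \<omega> = reduction \<omega>'"
    by (simp only: lin_basis_range[OF lin_basis_reduced[OF Jb f' J]] lin_basis_range[OF lin_basis_reduced[OF Jb f' J']])
qed

end

section \<open>Constant changes of coordinates\<close>

definition mono_eval :: "('n::finite \<Rightarrow> ('n, 'a::comm_ring_1) mpoly) \<Rightarrow> ('n \<Rightarrow>\<^sub>0 nat) \<Rightarrow> ('n, 'a) mpoly"
  where "mono_eval s \<nu> = (\<Prod>i\<in>UNIV. s i ^ Poly_Mapping.lookup \<nu> i)"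

lemma mono_eval_add: "mono_eval s (\<alpha> + \<beta>) = mono_eval s \<alpha> * mono_eval s \<beta>"
  by (simp add: mono_eval_def lookup_add power_add prod.distrib)

lemma mconst_add: "mconst (a + b) = mconst a + mconst b"
  by (simp add: mconst_def single_add)

lemma mconst_mult: "mconst (a * b) = mconst a * mconst (b :: 'a::comm_ring_1)"
  by (simp add: mconst_def mult_single)

lemma mconst_0: "mconst 0 = 0"
  by (simp add: mconst_def)

lemma mconst_1: "mconst 1 = (1 :: ('n, 'a::comm_ring_1) mpoly)"
  by (simp add: mconst_def)

lemma mconst_sum: "mconst (sum f A) = (\<Sum>x\<in>A. mconst (f x))"
  by (induction A rule: infinite_finite_induct) (simp_all add: mconst_add mconst_0)

text \<open>Enlarging the range of the defining sum makes additivity a statement about sums over a common index set.\<close>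

lemma msubst_superset:
  assumes "finite A" "Poly_Mapping.keys f \<subseteq> A"
  shows "msubst s f = (\<Sum>\<nu>\<in>A. mconst (Poly_Mapping.lookup f \<nu>) * mono_eval s \<nu>)"
  unfolding msubst_def mono_eval_def[symmetric]
  by (rule sum.mono_neutral_left) (use assms in \<open>auto simp: in_keys_iff mconst_0\<close>)

lemma msubst_add: "msubst s (f + g) = msubst s f + msubst s g"
proof -
  have A: "finite (Poly_Mapping.keys f \<union> Poly_Mapping.keys g)" by simp
  have "msubst s (f + g) = (\<Sum>\<nu>\<in>Poly_Mapping.keys f \<union> Poly_Mapping.keys g. mconst (Poly_Mapping.lookup (f + g) \<nu>) * mono_eval s \<nu>)"
    by (rule msubst_superset[OF A keys_add])
  then show ?thesis
    by (simp only: msubst_superset[OF A Un_upper1] msubst_superset[OF A Un_upper2]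
        lookup_add mconst_add distrib_right sum.distrib)
qed

lemma msubst_0: "msubst s 0 = 0"
  by (simp add: msubst_def)

lemma msubst_sum: "msubst s (sum f A) = (\<Sum>x\<in>A. msubst s (f x))"
  by (induction A rule: infinite_finite_induct) (simp_all add: msubst_0 msubst_add)

lemma msubst_single: "msubst s (Poly_Mapping.single \<nu> c) = mconst c * mono_eval s \<nu>"
  by (subst msubst_superset[of "{\<nu>}"]) simp_all

lemma mult_eq_sum_single:
  fixes f g :: "('n, 'a::comm_ring_1) mpoly"
  shows "f * g = (\<Sum>\<alpha>\<in>Poly_Mapping.keys f. \<Sum>\<beta>\<in>Poly_Mapping.keys g.
    Poly_Mapping.single (\<alpha> + \<beta>) (Poly_Mapping.lookup f \<alpha> * Poly_Mapping.lookup g \<beta>))"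
proof -
  have "f * g = (\<Sum>\<alpha>\<in>Poly_Mapping.keys f. Poly_Mapping.single \<alpha> (Poly_Mapping.lookup f \<alpha>)) *
      (\<Sum>\<beta>\<in>Poly_Mapping.keys g. Poly_Mapping.single \<beta> (Poly_Mapping.lookup g \<beta>))"
    by (simp only: sum_single_lookup[OF finite_keys subset_refl])
  then show ?thesis by (simp only: sum_product mult_single)
qed

lemma msubst_mult: "msubst s (f * g) = msubst s f * msubst s g"
proof -
  have "msubst s (f * g) = (\<Sum>\<alpha>\<in>Poly_Mapping.keys f. \<Sum>\<beta>\<in>Poly_Mapping.keys g.
      (mconst (Poly_Mapping.lookup f \<alpha>) * mono_eval s \<alpha>) * (mconst (Poly_Mapping.lookup g \<beta>) * mono_eval s \<beta>))"
    unfolding mult_eq_sum_single[of f g] msubst_sum msubst_single mono_eval_add mconst_mult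
    by (intro sum.cong refl) (simp only: ac_simps)
  then show ?thesis
    by (simp only: sum_product msubst_superset[OF finite_keys subset_refl])
qed

lemma mono_eval_0: "mono_eval s 0 = 1"
  by (simp add: mono_eval_def)

lemma msubst_mconst: "msubst s (mconst c) = mconst c"
  by (subst mconst_def) (simp add: msubst_single mono_eval_0)

lemma msubst_mvar: "msubst s (mvar i) = s i"
proof -
  have "mono_eval s (Poly_Mapping.single i 1) = (\<Prod>j\<in>UNIV. if j = i then s i else 1)"
    unfolding mono_eval_def by (rule prod.cong) (auto simp: lookup_single when_def)
  then show ?thesis by (simp add: mvar_def msubst_single mconst_1)
qed

lemma msubst_power: "msubst s (f ^ k) = msubst s f ^ k"
proof (induction k)
  case 0
  show ?case using msubst_mconst[of s 1] by (simp add: mconst_1)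
qed (simp add: msubst_mult)

lemma msubst_prod: "msubst s (prod f A) = (\<Prod>x\<in>A. msubst s (f x))"
proof (induction A rule: infinite_finite_induct)
  case (insert x F)
  then show ?case by (simp add: msubst_mult)
qed (use msubst_mconst[of s 1] in \<open>simp_all add: mconst_1\<close>)

lemma msubst_msubst: "msubst s (msubst s' f) = msubst (\<lambda>i. msubst s (s' i)) f"
  unfolding msubst_def[of s' f] msubst_def[of _ f]
  by (simp only: msubst_sum msubst_mult msubst_mconst msubst_prod msubst_power)

lemma msubst_id:
  fixes f :: "('n::finite, 'a::comm_ring_1) mpoly"
  shows "msubst mvar f = f"
proof -
  have mono: "mono_eval mvar \<nu> = (Poly_Mapping.single \<nu> 1 :: ('n, 'a) mpoly)" for \<nu>
  proof -
    have "(mvar i :: ('n, 'a) mpoly) ^ k = Poly_Mapping.single (\<Sum>_<k. Poly_Mapping.single i (1::nat)) 1" for i k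
      by (simp only: mvar_def single_power power_one)
    then show ?thesis by (simp only: mono_eval_def prod_single monomial_eq_sum prod.neutral_const)
  qed
  have "mconst c * mono_eval mvar \<nu> = Poly_Mapping.single \<nu> c" for c :: 'a and \<nu> :: "'n \<Rightarrow>\<^sub>0 nat"
    by (simp add: mono mconst_def mult_single)
  then show ?thesis
    by (simp only: msubst_superset[OF finite_keys subset_refl] sum_single_lookup[OF finite_keys subset_refl])
qed

lemma hsingle_add: "hsingle w (a + b) = hsingle w a + hsingle w (b :: 'k::comm_ring_1)"
  by (simp add: hahn_eq_iff hcoeff_single)

lemma hsingle_0: "hsingle w 0 = 0"
  by (simp add: hahn_eq_iff hcoeff_single)

lemma hsingle_mult: "hsingle v a * hsingle w b = hsingle (v + w) (a * b :: 'k::comm_ring_1)"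
  by (auto simp: hahn_eq_iff hcoeff_mult_single_left hcoeff_single)

lemma hsingle_sum: "hsingle w (sum f A) = (\<Sum>x\<in>A. hsingle w (f x :: 'k::comm_ring_1))"
  by (induction A rule: infinite_finite_induct) (simp_all add: hsingle_0 hsingle_add)

definition linear_form :: "'k::field ^ 'n ^ 'n \<Rightarrow> 'n \<Rightarrow> ('n::finite, 'k hahn) mpoly"
  where "linear_form g i = (\<Sum>j\<in>UNIV. mconst (hsingle 0 (vec_nth (vec_nth g j) i)) * mvar j)"

lemma linear_action_eq: "linear_action g = msubst (linear_form g)"
  unfolding linear_action_def linear_form_def[abs_def] ..

lemma linear_action_add: "linear_action g (x + y) = linear_action g x + linear_action g y"
  by (simp only: linear_action_eq msubst_add)

lemma linear_action_mult: "linear_action g (x * y) = linear_action g x * linear_action g y"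
  by (simp only: linear_action_eq msubst_mult)

lemma linear_action_lincomb:
  "linear_action g (lincomb r a f) = lincomb r a (\<lambda>i. linear_action g (f i))"
  by (simp only: lincomb_def linear_action_eq msubst_sum msubst_mult msubst_mconst)

lemma linear_action_0: "linear_action g 0 = 0"
  by (simp only: linear_action_eq msubst_0)

lemma linear_action_comp: "linear_action g (linear_action h f) = linear_action (g ** h) f"
proof -
  have "msubst (linear_form g) (linear_form h i) = linear_form (g ** h) i" for i
  proof -
    have "msubst (linear_form g) (linear_form h i) =
        (\<Sum>j\<in>UNIV. \<Sum>k\<in>UNIV. mconst (hsingle 0 (vec_nth (vec_nth g k) j * vec_nth (vec_nth h j) i)) * mvar k)"
      unfolding linear_form_def[of h] msubst_sum msubst_mult msubst_mconst msubst_mvar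
      by (intro sum.cong refl)
         (simp only: linear_form_def sum_distrib_left mult.assoc[symmetric] mconst_mult[symmetric]
            hsingle_mult add_0 mult.commute[of "vec_nth (vec_nth h _) i"])
    also have "\<dots> = (\<Sum>k\<in>UNIV. \<Sum>j\<in>UNIV. mconst (hsingle 0 (vec_nth (vec_nth g k) j * vec_nth (vec_nth h j) i)) * mvar k)"
      by (rule sum.swap)
    also have "\<dots> = linear_form (g ** h) i"
      by (simp add: linear_form_def matrix_matrix_mult_def hsingle_sum mconst_sum sum_distrib_right)
    finally show ?thesis .
  qed
  then show ?thesis by (simp only: linear_action_eq msubst_msubst)
qed

lemma linear_action_one:
  fixes f :: "('n::finite, 'k::field hahn) mpoly"
  shows "linear_action (Finite_Cartesian_Product.mat 1) f = f"
proof -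
  have "linear_form (Finite_Cartesian_Product.mat 1) i = (mvar i :: ('n, 'k hahn) mpoly)" for i :: 'n
  proof -
    have "linear_form (Finite_Cartesian_Product.mat 1) i = (\<Sum>j\<in>UNIV. if j = i then mvar i else (0 :: ('n, 'k hahn) mpoly))"
      unfolding linear_form_def
      by (rule sum.cong) (auto simp: Finite_Cartesian_Product.mat_def hsingle_0 mconst_0 mconst_1 one_hahn_def[symmetric])
    then show ?thesis by simp
  qed
  then have "linear_form (Finite_Cartesian_Product.mat 1) = (mvar :: 'n \<Rightarrow> ('n, 'k hahn) mpoly)" by (rule ext)
  then show ?thesis by (simp only: linear_action_eq msubst_id)
qed

lemma linear_action_inverse:
  assumes "invertible g"
  obtains h where "\<And>f. linear_action g (linear_action h f) = f" "\<And>f. linear_action h (linear_action g f) = f"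
proof -
  obtain h where "g ** h = Finite_Cartesian_Product.mat 1" "h ** g = Finite_Cartesian_Product.mat 1"
    using assms unfolding invertible_def by blast
  then show ?thesis using that[of h] by (simp add: linear_action_comp linear_action_one)
qed

lemma lookup_linear_action:
  "Poly_Mapping.lookup (linear_action g f) \<mu> =
    (\<Sum>\<nu>\<in>Poly_Mapping.keys f. Poly_Mapping.lookup f \<nu> * Poly_Mapping.lookup (mono_eval (linear_form g) \<nu>) \<mu>)"
  by (simp only: linear_action_eq msubst_superset[OF finite_keys subset_refl] lookup_sum lookup_mconst_mult)

text \<open>Forms of degree \<open>d\<close> with coefficients in the residue field. A constant matrix maps monomials to such
  forms; homogeneity makes the action compatible with truncation, and constancy keeps the coefficients of
  images in a fixed finite-dimensional space over the residue field.\<close>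

definition constant_form :: "nat \<Rightarrow> ('n::finite, 'k::field hahn) mpoly \<Rightarrow> bool"
  where "constant_form d f \<longleftrightarrow>
    (\<forall>\<mu>. (\<exists>c. Poly_Mapping.lookup f \<mu> = hsingle 0 c) \<and> (Poly_Mapping.lookup f \<mu> \<noteq> 0 \<longrightarrow> mdeg \<mu> = d))"

lemma sum_in_range_hsingle:
  fixes a :: "'x \<Rightarrow> 'k::field hahn"
  assumes "\<And>x. x \<in> A \<Longrightarrow> a x \<in> range (hsingle 0)"
  shows "sum a A \<in> range (hsingle 0)"
  using assms
proof (induction A rule: infinite_finite_induct)
  case (insert x A)
  then obtain b c where "a x = hsingle 0 b" "sum a A = hsingle 0 c" by (metis image_iff insertCI)
  then have "sum a (insert x A) = hsingle 0 (b + c)" using insert.hyps by (simp add: hsingle_add)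
  then show ?case by simp
qed (auto simp: hsingle_0[of 0, symmetric])

lemma constant_form_mult:
  assumes f: "constant_form d f" and g: "constant_form e g"
  shows "constant_form (d + e) (f * g)"
  unfolding constant_form_def
proof (intro allI conjI impI)
  fix \<mu>
  have "Poly_Mapping.lookup (f * g) \<mu> \<in> range (hsingle 0)"
    unfolding mult_eq_sum_single[of f g] lookup_sum
  proof (intro sum_in_range_hsingle)
    fix \<alpha> \<beta>
    obtain a b where "Poly_Mapping.lookup f \<alpha> = hsingle 0 a" "Poly_Mapping.lookup g \<beta> = hsingle 0 b"
      using f g unfolding constant_form_def by blast
    then have "Poly_Mapping.lookup (Poly_Mapping.single (\<alpha> + \<beta>) (Poly_Mapping.lookup f \<alpha> * Poly_Mapping.lookup g \<beta>)) \<mu>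
        = hsingle 0 (if \<alpha> + \<beta> = \<mu> then a * b else 0)"
      by (simp add: lookup_single when_def hsingle_mult hsingle_0)
    then show "Poly_Mapping.lookup (Poly_Mapping.single (\<alpha> + \<beta>) (Poly_Mapping.lookup f \<alpha> * Poly_Mapping.lookup g \<beta>)) \<mu>
        \<in> range (hsingle 0)" by simp
  qed
  then show "\<exists>c. Poly_Mapping.lookup (f * g) \<mu> = hsingle 0 c" by blast
  assume "Poly_Mapping.lookup (f * g) \<mu> \<noteq> 0"
  then have "\<mu> \<in> Poly_Mapping.keys (f * g)" by (simp add: in_keys_iff)
  then obtain \<alpha> \<beta> where "\<alpha> \<in> Poly_Mapping.keys f" "\<beta> \<in> Poly_Mapping.keys g" "\<mu> = \<alpha> + \<beta>"
    using keys_mult[of f g] by blast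
  then show "mdeg \<mu> = d + e" using f g by (simp add: constant_form_def in_keys_iff mdeg_add)
qed

lemma constant_form_1: "constant_form 0 (1 :: ('n::finite, 'k::field hahn) mpoly)"
  unfolding constant_form_def
proof (intro allI conjI impI)
  fix \<mu> :: "'n \<Rightarrow>\<^sub>0 nat"
  have "Poly_Mapping.lookup 1 \<mu> = hsingle 0 (if \<mu> = 0 then 1 else 0 :: 'k)"
    by (simp add: lookup_one when_def one_hahn_def hsingle_0)
  then show "\<exists>c. Poly_Mapping.lookup 1 \<mu> = hsingle 0 (c :: 'k)" by blast
  show "Poly_Mapping.lookup 1 \<mu> \<noteq> (0 :: 'k hahn) \<Longrightarrow> mdeg \<mu> = 0"
    by (auto simp: lookup_one when_def mdeg_def split: if_splits)
qed

lemma constant_form_power: "constant_form d f \<Longrightarrow> constant_form (d * k) (f ^ k)"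
  by (induction k) (simp_all add: constant_form_1 constant_form_mult)

lemma constant_form_prod:
  assumes "\<And>x. x \<in> A \<Longrightarrow> constant_form (d x) (f x)"
  shows "constant_form (\<Sum>x\<in>A. d x) (\<Prod>x\<in>A. f x)"
  using assms
proof (induction A rule: infinite_finite_induct)
  case (insert x A)
  show ?case unfolding sum.insert[OF insert.hyps] prod.insert[OF insert.hyps]
    by (intro constant_form_mult insert.prems insert.IH) auto
qed (simp_all only: sum.infinite prod.infinite sum.empty prod.empty constant_form_1 not_False_eq_True)

lemma constant_form_linear_form: "constant_form 1 (linear_form g i)"
  unfolding constant_form_def
proof (intro allI conjI impI)
  fix \<mu>
  have l: "Poly_Mapping.lookup (linear_form g i) \<mu> =
      (\<Sum>j\<in>UNIV. hsingle 0 (if \<mu> = Poly_Mapping.single j 1 then vec_nth (vec_nth g j) i else 0))"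
    unfolding linear_form_def lookup_sum lookup_mconst_mult
    by (rule sum.cong) (auto simp: mvar_def lookup_single when_def hsingle_0)
  show "\<exists>c. Poly_Mapping.lookup (linear_form g i) \<mu> = hsingle 0 c"
    unfolding l hsingle_sum[symmetric] by (rule exI, rule refl)
  assume nz: "Poly_Mapping.lookup (linear_form g i) \<mu> \<noteq> 0"
  have "\<exists>j. \<mu> = Poly_Mapping.single j 1"
  proof (rule ccontr)
    assume "\<nexists>j. \<mu> = Poly_Mapping.single j 1"
    then have "Poly_Mapping.lookup (linear_form g i) \<mu> = 0" unfolding l by (simp add: hsingle_0)
    with nz show False by simp
  qed
  then obtain j where "\<mu> = Poly_Mapping.single j 1" by (rule exE)
  then show "mdeg \<mu> = 1" by (simp add: mdeg_def lookup_single when_def)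
qed

lemma constant_form_mono_eval: "constant_form (mdeg \<nu>) (mono_eval (linear_form g) \<nu>)"
proof -
  have "constant_form (1 * k) (linear_form g i ^ k)" for i k
    by (rule constant_form_power[OF constant_form_linear_form])
  then show ?thesis
    using constant_form_prod[of UNIV "\<lambda>i. Poly_Mapping.lookup \<nu> i" "\<lambda>i. linear_form g i ^ Poly_Mapping.lookup \<nu> i"]
    by (simp add: mdeg_def mono_eval_def)
qed

text \<open>Only monomials of degree \<open>mdeg \<mu>\<close> contribute to the coefficient of the image at \<open>\<mu>\<close>.\<close>

lemma linear_action_trunc: "linear_action g (trunc d f) = trunc d (linear_action g f)"
proof (rule poly_mapping_eqI)
  fix \<mu>
  let ?c = "\<lambda>\<nu>. Poly_Mapping.lookup (mono_eval (linear_form g) \<nu>) \<mu>"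
  have deg: "?c \<nu> = 0" if "mdeg \<nu> \<noteq> mdeg \<mu>" for \<nu>
  proof -
    have "?c \<nu> \<noteq> 0 \<longrightarrow> mdeg \<mu> = mdeg \<nu>"
      using constant_form_mono_eval[of \<nu> g] unfolding constant_form_def by (elim allE[of _ \<mu>] conjE)
    with that show ?thesis by auto
  qed
  have "Poly_Mapping.lookup (linear_action g (trunc d f)) \<mu> =
      (\<Sum>\<nu>\<in>Poly_Mapping.keys f. Poly_Mapping.lookup (trunc d f) \<nu> * ?c \<nu>)"
    unfolding lookup_linear_action
    by (rule sum.mono_neutral_left) (auto simp: keys_trunc lookup_trunc in_keys_iff monos_upto_def)
  also have "\<dots> = (\<Sum>\<nu>\<in>Poly_Mapping.keys f. if mdeg \<mu> \<le> d then Poly_Mapping.lookup f \<nu> * ?c \<nu> else 0)"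
  proof (rule sum.cong[OF refl])
    fix \<nu>
    show "Poly_Mapping.lookup (trunc d f) \<nu> * ?c \<nu> = (if mdeg \<mu> \<le> d then Poly_Mapping.lookup f \<nu> * ?c \<nu> else 0)"
      using deg[of \<nu>] by (cases "mdeg \<nu> = mdeg \<mu>") (simp_all add: lookup_trunc)
  qed
  also have "\<dots> = Poly_Mapping.lookup (trunc d (linear_action g f)) \<mu>"
    by (simp add: lookup_trunc lookup_linear_action)
  finally show "Poly_Mapping.lookup (linear_action g (trunc d f)) \<mu> = Poly_Mapping.lookup (trunc d (linear_action g f)) \<mu>" .
qed

lemma linear_action_ideal:
  assumes g: "invertible g" and I: "ideal.subspace I"
  shows "ideal.subspace (linear_action g ` I)"
proof (rule ideal.subspaceI)
  show "0 \<in> linear_action g ` I"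
    by (rule image_eqI[OF _ ideal.subspace_0[OF I]]) (simp only: linear_action_0)
next
  fix x y assume "x \<in> linear_action g ` I" "y \<in> linear_action g ` I"
  then obtain a b where ab: "a \<in> I" "b \<in> I" "x = linear_action g a" "y = linear_action g b" by (elim imageE)
  show "x + y \<in> linear_action g ` I"
    by (rule image_eqI[OF _ ideal.subspace_add[OF I ab(1,2)]]) (simp only: ab linear_action_add)
next
  fix c x assume "x \<in> linear_action g ` I"
  then obtain a where a: "a \<in> I" "x = linear_action g a" by (elim imageE)
  obtain h where h: "\<And>f. linear_action g (linear_action h f) = f"
    by (rule linear_action_inverse[OF g]) (rule that)
  show "c * x \<in> linear_action g ` I"
    by (rule image_eqI[OF _ ideal.subspace_scale[OF I a(1), of "linear_action h c"]])
       (simp only: a linear_action_mult h)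
qed

lemma linear_action_trunc_closed:
  assumes "trunc_closed I"
  shows "trunc_closed (linear_action g ` I)"
  using assms by (auto simp: trunc_closed_def linear_action_trunc[symmetric])

lemma upto_degree_linear_action:
  assumes g: "invertible g" and I: "trunc_closed I"
  shows "upto_degree d (linear_action g ` I) = linear_action g ` upto_degree d I"
proof (rule equalityI; rule subsetI)
  fix y assume y: "y \<in> upto_degree d (linear_action g ` I)"
  then obtain x where x: "x \<in> I" "y = linear_action g x" by (auto simp: upto_degree_def)
  have "y = trunc d y" using y by (simp add: upto_degree_def trunc_id)
  then have "y = linear_action g (trunc d x)" unfolding linear_action_trunc x(2)[symmetric] .
  moreover have "trunc d x \<in> upto_degree d I" using x(1) I by (simp add: upto_degree_def keys_trunc trunc_closed_def)
  ultimately show "y \<in> linear_action g ` upto_degree d I" by (rule image_eqI)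
next
  fix y assume "y \<in> linear_action g ` upto_degree d I"
  then obtain x where x: "x \<in> upto_degree d I" "y = linear_action g x" by (elim imageE)
  have "trunc d x = x" using x(1) by (simp add: upto_degree_def trunc_id)
  then have "y = trunc d y" unfolding x(2) linear_action_trunc[symmetric] by (simp only:)
  then have "Poly_Mapping.keys y \<subseteq> monos_upto d" using keys_trunc[of d y] by auto
  then show "y \<in> upto_degree d (linear_action g ` I)" using x by (auto simp: upto_degree_def)
qed

lemma lin_basis_linear_action:
  assumes g: "invertible g" and f: "lin_basis r f V"
  shows "lin_basis r (\<lambda>i. linear_action g (f i)) (linear_action g ` V)"
  unfolding lin_basis_def
proof (intro conjI allI impI)
  show "linear_action g ` V = range (\<lambda>a. lincomb r a (\<lambda>i. linear_action g (f i)))"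
    by (subst lin_basis_range[OF f]) (simp only: image_image linear_action_lincomb)
next
  fix a i assume a: "lincomb r a (\<lambda>i. linear_action g (f i)) = 0" and i: "i < r"
  obtain h where h: "\<And>f. linear_action h (linear_action g f) = f"
    by (rule linear_action_inverse[OF g]) (rule that)
  have "linear_action h (linear_action g (lincomb r a f)) = linear_action h 0"
    by (simp only: linear_action_lincomb a)
  then have "lincomb r a f = 0" by (simp only: h linear_action_0)
  then show "a i = 0" using f i unfolding lin_basis_def by blast
qed

section \<open>Valuations on finite-dimensional spaces of series\<close>

lemma vector_space_hahn: "vector_space (\<lambda>(c :: 'k::field) (a :: 'k hahn). hsingle 0 c * a)"
  by unfold_locales
     (simp_all only: distrib_left hsingle_add distrib_right mult.assoc[symmetric] hsingle_mult add_0
        one_hahn_def[symmetric] mult_1_left)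

interpretation hahn: vector_space "\<lambda>(c :: 'k::field) (a :: 'k hahn). hsingle 0 c * a"
  by (rule vector_space_hahn)

lemma hval_diff_distinct:
  fixes a b :: "'k::field hahn"
  assumes "a \<noteq> 0" "b \<noteq> 0" "hval a \<noteq> hval b"
  shows "a - b \<noteq> 0 \<and> hval (a - b) \<in> {hval a, hval b}"
proof -
  let ?w = "min (hval a) (hval b)"
  have va: "val_ge ?w a" "val_ge ?w b" using assms by (simp_all add: val_ge_iff)
  then have ge: "val_ge ?w (a - b)" unfolding val_ge_def by (metis diff_zero hcoeff_diff)
  have "hcoeff (a - b) ?w \<noteq> 0"
  proof (cases "hval a < hval b")
    case True
    then have "hcoeff b (hval a) = 0" using hval_props(2)[OF assms(2)] by (metis not_le)
    then show ?thesis using hval_props(1)[OF assms(1)] True by (simp add: min_def)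
  next
    case False
    then have "hval b < hval a" using assms(3) by simp
    then have "hcoeff a (hval b) = 0" using hval_props(2)[OF assms(1)] by (metis not_le)
    then show ?thesis using hval_props(1)[OF assms(2)] False by (simp add: min_def)
  qed
  then have "a - b \<noteq> 0 \<and> hval (a - b) = ?w" using val_ge_lead_iff[OF ge] by blast
  then show ?thesis by (auto simp: min_def)
qed

lemma hval_scale:
  fixes a :: "'k::field hahn"
  assumes "c \<noteq> 0" "a \<noteq> 0"
  shows "hsingle 0 c * a \<noteq> 0" "hval (hsingle 0 c * a) = hval a"
proof -
  have "hcoeff (hsingle 0 c * a) (hval a) \<noteq> 0"
    using assms hval_props(1)[OF assms(2)] by (simp add: hcoeff_mult_single_left)
  moreover have "val_ge (hval a) (hsingle 0 c * a)"
    using hval_props(2)[OF assms(2)] by (auto simp: val_ge_def hcoeff_mult_single_left)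
  ultimately show "hsingle 0 c * a \<noteq> 0" "hval (hsingle 0 c * a) = hval a"
    using val_ge_lead_iff by blast+
qed

text \<open>Adding one generator adds at most one valuation: if \<open>y\<close> and \<open>z\<close> both had new and different valuations, a
  combination \<open>z - c y\<close> with constant \<open>c \<noteq> 0\<close> would lie in the smaller space, and its valuation would be
  that of \<open>y\<close> or of \<open>z\<close>.\<close>

lemma finite_hval_span:
  fixes X :: "'k::field hahn set"
  assumes "finite X"
  shows "finite (hval ` (hahn.span X - {0}))"
  using assms
proof (induction X)
  case empty
  show ?case by simp
next
  case (insert x X)
  let ?S = "hval ` (hahn.span X - {0})" and ?T = "hval ` (hahn.span (insert x X) - {0})"
  show ?case
  proof (cases "?T \<subseteq> ?S")
    case True
    then show ?thesis using insert.IH finite_subset by blast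
  next
    case False
    then obtain y where y: "y \<in> hahn.span (insert x X)" "y \<noteq> 0" "hval y \<notin> ?S" by blast
    obtain k where k: "y - hsingle 0 k * x \<in> hahn.span X"
      using y(1) unfolding hahn.span_insert by blast
    have k0: "k \<noteq> 0"
    proof
      assume "k = 0"
      then have "y \<in> hahn.span X" using k by (simp add: hsingle_0)
      then show False using y by blast
    qed
    have "?T \<subseteq> insert (hval y) ?S"
    proof
      fix w assume "w \<in> ?T"
      then obtain z where z: "z \<in> hahn.span (insert x X)" "z \<noteq> 0" "w = hval z" by blast
      obtain l where l: "z - hsingle 0 l * x \<in> hahn.span X"
        using z(1) unfolding hahn.span_insert by blast
      show "w \<in> insert (hval y) ?S"
      proof (rule ccontr)
        assume w: "w \<notin> insert (hval y) ?S"
        then have l0: "l \<noteq> 0" using l z by (auto simp: hsingle_0)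
        define u where "u = hsingle 0 (l / k) * y"
        have u: "u \<noteq> 0" "hval u = hval y" unfolding u_def by (rule hval_scale; use l0 k0 y(2) in simp)+
        have "(z - hsingle 0 l * x) - hsingle 0 (l / k) * (y - hsingle 0 k * x) \<in> hahn.span X"
          by (intro hahn.span_diff hahn.span_scale l k)
        also have "(z - hsingle 0 l * x) - hsingle 0 (l / k) * (y - hsingle 0 k * x) = z - u"
          using k0 by (simp add: u_def right_diff_distrib mult.assoc[symmetric] hsingle_mult)
        finally have zu: "z - u \<in> hahn.span X" .
        have d: "z - u \<noteq> 0 \<and> hval (z - u) \<in> {hval z, hval u}"
          by (rule hval_diff_distinct) (use z u w in auto)
        have "hval (z - u) \<in> ?S" by (rule imageI) (use zu d in simp)
        moreover have "hval (z - u) = w \<or> hval (z - u) = hval y" using d u(2) z(3) by auto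
        ultimately show False using w y(3) by auto
      qed
    qed
    then show ?thesis using insert.IH finite_subset finite_insert by blast
  qed
qed

lemma hahn_span_mult:
  fixes A B :: "'k::field hahn set"
  assumes "a \<in> hahn.span A" "b \<in> hahn.span B"
  shows "a * b \<in> hahn.span ((\<lambda>(x, y). x * y) ` (A \<times> B))" (is "_ \<in> ?S")
proof -
  have 1: "x * b \<in> ?S" if "x \<in> A" for x
    using assms(2)
  proof (induction rule: hahn.span_induct_alt)
    case (step c y z)
    have xy: "x * y \<in> ?S" using that step(1) by (intro hahn.span_base) force
    have "x * (hsingle 0 c * y + z) = hsingle 0 c * (x * y) + x * z"
      by (simp only: distrib_left mult.left_commute)
    then show ?case by (simp only: hahn.span_add[OF hahn.span_scale[OF xy] step(2)])
  qed (simp add: hahn.span_zero)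
  show ?thesis using assms(1)
  proof (induction rule: hahn.span_induct_alt)
    case (step c y z)
    have "(hsingle 0 c * y + z) * b = hsingle 0 c * (y * b) + z * b"
      by (simp only: distrib_right mult.assoc)
    then show ?case by (simp only: hahn.span_add[OF hahn.span_scale[OF 1[OF step(1)]] step(2)])
  qed (simp add: hahn.span_zero)
qed

text \<open>The space spanned by the \<open>r\<close>-fold products of elements of \<open>X\<close> contains all products in the Leibniz formula.\<close>

lemma det_fun_span:
  fixes X :: "'k::field hahn set"
  assumes "finite X"
  shows "\<exists>Y. finite Y \<and> (\<forall>m. (\<forall>i<r. \<forall>j<r. m i j \<in> hahn.span X) \<longrightarrow> det_fun r m \<in> hahn.span Y)"
proof -
  have prod: "\<exists>Y. finite Y \<and> (\<forall>a. (\<forall>i<k. a i \<in> hahn.span X) \<longrightarrow> (\<Prod>i = 0..<k. a i) \<in> hahn.span Y)" for k :: nat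
  proof (induction k)
    case 0
    show ?case by (rule exI[of _ "{1}"]) (simp add: hahn.span_base)
  next
    case (Suc k)
    then obtain Y where Y: "finite Y" "\<And>a. \<forall>i<k. a i \<in> hahn.span X \<Longrightarrow> (\<Prod>i = 0..<k. a i) \<in> hahn.span Y" by blast
    show ?case
    proof (intro exI conjI allI impI)
      show "finite ((\<lambda>(x, y). x * y) ` (Y \<times> X))" using Y(1) assms by simp
      fix a assume a: "\<forall>i<Suc k. a i \<in> hahn.span X"
      then have "(\<Prod>i = 0..<k. a i) \<in> hahn.span Y" by (intro Y(2)) simp
      then show "(\<Prod>i = 0..<Suc k. a i) \<in> hahn.span ((\<lambda>(x, y). x * y) ` (Y \<times> X))"
        using hahn_span_mult[of _ Y "a k" X] a by simp
    qed
  qed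
  obtain Y where Y: "finite Y" "\<And>a. \<forall>i<r. a i \<in> hahn.span X \<Longrightarrow> (\<Prod>i = 0..<r. a i) \<in> hahn.span Y"
    using prod[of r] by blast
  have "det_fun r m \<in> hahn.span Y" if m: "\<forall>i<r. \<forall>j<r. m i j \<in> hahn.span X" for m
    unfolding det_fun_leibniz
  proof (rule hahn.span_sum)
    fix p assume "p \<in> {p. p permutes {0..<r}}"
    then have p: "p permutes {0..<r}" by simp
    have "p i < r" if "i < r" for i using permutes_in_image[OF p, of i] that by simp
    then have "(\<Prod>i = 0..<r. m i (p i)) \<in> hahn.span Y" using m by (intro Y(2)) simp
    then show "of_int (sign p) * (\<Prod>i = 0..<r. m i (p i)) \<in> hahn.span Y"
      by (simp add: sign_def hahn.span_neg)
  qed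
  with Y(1) show ?thesis by blast
qed

lemma lookup_linear_action_span:
  assumes "\<And>\<nu>. \<nu> \<in> Poly_Mapping.keys f \<Longrightarrow> Poly_Mapping.lookup f \<nu> \<in> X"
  shows "Poly_Mapping.lookup (linear_action g f) \<mu> \<in> hahn.span X"
  unfolding lookup_linear_action
proof (rule hahn.span_sum)
  fix \<nu> assume \<nu>: "\<nu> \<in> Poly_Mapping.keys f"
  obtain c where "Poly_Mapping.lookup (mono_eval (linear_form g) \<nu>) \<mu> = hsingle 0 c"
    using constant_form_mono_eval[of \<nu> g] unfolding constant_form_def by blast
  then show "Poly_Mapping.lookup f \<nu> * Poly_Mapping.lookup (mono_eval (linear_form g) \<nu>) \<mu> \<in> hahn.span X"
    using hahn.span_scale[OF hahn.span_base[OF assms[OF \<nu>]], of c] by (simp add: mult.commute)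
qed

text \<open>The coefficients of \<open>g(f\<^sub>i)\<close> are combinations of those of \<open>f\<^sub>i\<close> over the residue field, whatever \<open>g\<close> and \<open>J\<close>
  are.\<close>

lemma finite_hval_pluecker_orbit:
  fixes f :: "nat \<Rightarrow> ('n::finite, 'k::field hahn) mpoly"
  shows "finite {hval (pluecker r (\<lambda>i. linear_action g (f i)) J) | g J.
    pluecker r (\<lambda>i. linear_action g (f i)) J \<noteq> 0}"
proof -
  define X where "X = (\<Union>i<r. Poly_Mapping.lookup (f i) ` Poly_Mapping.keys (f i))"
  have X: "finite X" by (simp add: X_def)
  obtain Y where Y: "finite Y" "\<And>m. \<forall>i<r. \<forall>j<r. m i j \<in> hahn.span X \<Longrightarrow> det_fun r m \<in> hahn.span Y"
    using det_fun_span[OF X, of r] by blast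
  have "pluecker r (\<lambda>i. linear_action g (f i)) J \<in> hahn.span Y" for g J
    unfolding pluecker_def
  proof (rule Y(2), intro allI impI)
    fix i j assume "i < r"
    then show "Poly_Mapping.lookup (linear_action g (f i)) (J j) \<in> hahn.span X"
      by (intro lookup_linear_action_span) (auto simp: X_def)
  qed
  then have "{hval (pluecker r (\<lambda>i. linear_action g (f i)) J) | g J.
    pluecker r (\<lambda>i. linear_action g (f i)) J \<noteq> 0} \<subseteq> hval ` (hahn.span Y - {0})" by blast
  then show ?thesis using finite_hval_span[OF Y(1)] by (rule finite_subset)
qed

section \<open>Finitely many tropical varieties\<close>

lemma graded_ideal_trunc_closed:
  assumes "graded_ideal I"
  shows "trunc_closed I"
  unfolding trunc_closed_def
proof (intro ballI allI)
  fix f d assume f: "f \<in> I"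
  have I: "ideal.subspace I" and comp: "\<And>e. hom_component e f \<in> I"
    using assms f by (auto simp: graded_ideal_def)
  have "trunc d f = (\<Sum>e\<le>d. hom_component e f)"
  proof (rule poly_mapping_eqI)
    fix \<nu>
    have "Poly_Mapping.lookup (hom_component e f) \<nu> = (if e = mdeg \<nu> then Poly_Mapping.lookup f \<nu> else 0)" for e
      by (auto simp: hom_component_def lookup_mapp when_def in_keys_iff mdeg_def)
    then show "Poly_Mapping.lookup (trunc d f) \<nu> = Poly_Mapping.lookup (\<Sum>e\<le>d. hom_component e f) \<nu>"
      by (simp add: lookup_trunc lookup_sum)
  qed
  then show "trunc d f \<in> I" using ideal.subspace_sum[OF I comp] by simp
qed

text \<open>The cells of the minimum of the affine functions indexed by \<open>B\<close> with constant terms \<open>v\<close>. Writing the Groebner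
  complex as a function of \<open>B\<close> and \<open>v\<close> alone reduces finiteness to counting these data.\<close>

definition argmin_cells ::
    "nat \<Rightarrow> (nat \<Rightarrow> ('n::finite \<Rightarrow>\<^sub>0 nat)) set \<Rightarrow> ((nat \<Rightarrow> ('n \<Rightarrow>\<^sub>0 nat)) \<Rightarrow> real) \<Rightarrow> (real ^ 'n) set set"
  where "argmin_cells r B v =
    (let A = (\<lambda>\<omega>. {J \<in> B. \<forall>J'\<in>B. v J + inner (exponent_sum r J) \<omega> \<le> v J' + inner (exponent_sum r J') \<omega>})
     in range (\<lambda>\<omega>. {\<omega>'. A \<omega> \<subseteq> A \<omega>'}))"

context subspace_over_hahn
begin

lemma range_cell_eq: "range cell = argmin_cells r bases (restrict (\<lambda>J. hval (pluecker r f J)) bases)"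
  unfolding argmin_cells_def Let_def
proof (rule arg_cong[of _ _ range], rule ext)
  fix \<omega>
  have "active w = {J \<in> bases. \<forall>J'\<in>bases.
      restrict (\<lambda>J. hval (pluecker r f J)) bases J + inner (exponent_sum r J) w
      \<le> restrict (\<lambda>J. hval (pluecker r f J)) bases J' + inner (exponent_sum r J') w}" for w
    unfolding active_def by (rule Collect_cong) (simp add: aff_def cong: conj_cong ball_cong)
  then show "cell \<omega> = {\<omega>'. {J \<in> bases. \<forall>J'\<in>bases.
      restrict (\<lambda>J. hval (pluecker r f J)) bases J + inner (exponent_sum r J) \<omega>
      \<le> restrict (\<lambda>J. hval (pluecker r f J)) bases J' + inner (exponent_sum r J') \<omega>}
    \<subseteq> {J \<in> bases. \<forall>J'\<in>bases.
      restrict (\<lambda>J. hval (pluecker r f J)) bases J + inner (exponent_sum r J) \<omega>'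
      \<le> restrict (\<lambda>J. hval (pluecker r f J)) bases J' + inner (exponent_sum r J') \<omega>'}}"
    unfolding cell_def by (simp only:)
qed

end

text \<open>If initial ideals are determined by their part of degree at most \<open>D\<close>, the classes of weights with the
  same initial ideal are the classes of weights with the same minimisers.\<close>

lemma groebner_complex_eq_argmin_cells:
  fixes I :: "('n::finite, 'k::field hahn) mpoly set"
  assumes I: "ideal.subspace I" "trunc_closed I"
    and f: "lin_basis r f (upto_degree D I)"
    and determined: "\<And>\<omega> \<omega>'. upto_degree D (initial_ideal \<omega> I) = upto_degree D (initial_ideal \<omega>' I) \<Longrightarrow>
      initial_ideal \<omega> I = initial_ideal \<omega>' I"
  defines "B \<equiv> {J \<in> {..<r} \<rightarrow>\<^sub>E monos_upto D. pluecker r f J \<noteq> 0}"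
  shows "polyhedral_complex (groebner_complex I)"
    "groebner_complex I = argmin_cells r B (restrict (\<lambda>J. hval (pluecker r f J)) B)"
proof -
  interpret subspace_over_hahn r f "upto_degree D I" "monos_upto D"
    by unfold_locales (use f finite_monos_upto in \<open>auto simp: upto_degree_def\<close>)
  have red: "upto_degree D (initial_ideal \<omega> I) = reduction \<omega>" for \<omega>
    unfolding reduction_def by (rule upto_degree_initial_ideal[OF I])
  have iff: "initial_ideal \<omega>' I = initial_ideal \<omega> I \<longleftrightarrow> active \<omega>' = active \<omega>" for \<omega> \<omega>'
    using determined[of \<omega>' \<omega>] reduction_eq_iff[of \<omega>' \<omega>] unfolding red[symmetric] by auto
  have "groebner_complex I = range cell"
    unfolding groebner_complex_def iff closure_class by (simp add: full_SetCompr_eq)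
  then show "polyhedral_complex (groebner_complex I)"
    "groebner_complex I = argmin_cells r B (restrict (\<lambda>J. hval (pluecker r f J)) B)"
    using polyhedral_complex_cells range_cell_eq by (simp_all add: B_def bases_def)
qed

theorem corollary8p9:
  fixes I :: "('n::finite, 'k::alg_closed_field hahn) mpoly set"
  assumes "graded_ideal I"
  shows "\<exists>\<F>s :: (real ^ 'n) set set set.
    finite \<F>s \<and> (\<forall>\<F>\<in>\<F>s. polyhedral_complex \<F>) \<and>
    (\<forall>g :: 'k ^ 'n ^ 'n. invertible g \<longrightarrow> tropical_variety (linear_action g ` I) \<in> \<F>s)"
proof -
  have I: "ideal.subspace I" "trunc_closed I"
    using assms graded_ideal_trunc_closed by (auto simp: graded_ideal_def)
  define H where "H d = lin.dim (upto_degree d I)" for d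
  have basis_exists: "\<exists>f. lin_basis (H d) f (upto_degree d I)" for d
  proof -
    have "lin.subspace (upto_degree d I)" by (intro upto_degree_subspace ideal_imp_lin_subspace I)
    then obtain r f J where "lin_basis r f (upto_degree d I)"
      by (rule lin_basis_exists[OF _ finite_monos_upto[of d]]) (auto simp: upto_degree_def intro: that)
    then show ?thesis using lin_basis_dim unfolding H_def by blast
  qed
  have dim: "lin.dim (upto_degree d (initial_ideal \<omega> (linear_action g ` I))) = H d"
    if g: "invertible g" for g :: "'k ^ 'n ^ 'n" and d \<omega>
  proof -
    let ?J = "linear_action g ` I"
    have J: "ideal.subspace ?J" "trunc_closed ?J"
      by (rule linear_action_ideal[OF g I(1)], rule linear_action_trunc_closed[OF I(2)])
    obtain f where f: "lin_basis (H d) f (upto_degree d I)" using basis_exists by (rule exE)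
    interpret subspace_over_hahn "H d" "\<lambda>i. linear_action g (f i)" "upto_degree d ?J" "monos_upto d"
    proof
      show "lin_basis (H d) (\<lambda>i. linear_action g (f i)) (upto_degree d ?J)"
        unfolding upto_degree_linear_action[OF g I(2)] by (rule lin_basis_linear_action[OF g f])
    qed (simp_all add: finite_monos_upto upto_degree_def)
    show ?thesis unfolding upto_degree_initial_ideal[OF J] reduction_def[symmetric] by (rule dim_reduction)
  qed
  obtain D where D: "\<forall>J J' :: ('n, 'k) mpoly set.
    ideal.subspace J \<and> trunc_closed J \<and> (\<forall>d. lin.dim (upto_degree d J) = H d) \<and>
    ideal.subspace J' \<and> trunc_closed J' \<and> (\<forall>d. lin.dim (upto_degree d J') = H d) \<and>
    upto_degree D J = upto_degree D J' \<longrightarrow> J = J'"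
    using ideals_determined_up_to_degree[of H] by (rule exE)
  obtain f where f: "lin_basis (H D) f (upto_degree D I)" using basis_exists by (rule exE)
  define r where "r = H D"
  define P where "P g = pluecker r (\<lambda>i. linear_action g (f i))" for g :: "'k ^ 'n ^ 'n"
  define B where "B g = {J \<in> {..<r} \<rightarrow>\<^sub>E monos_upto D. P g J \<noteq> 0}" for g
  define v where "v g = restrict (\<lambda>J. hval (P g J)) (B g)" for g
  have complex: "polyhedral_complex (groebner_complex (linear_action g ` I))"
      "groebner_complex (linear_action g ` I) = argmin_cells r (B g) (v g)"
    if g: "invertible g" for g
  proof -
    let ?J = "linear_action g ` I"
    have J: "ideal.subspace ?J" "trunc_closed ?J"
      by (rule linear_action_ideal[OF g I(1)], rule linear_action_trunc_closed[OF I(2)])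
    have b: "lin_basis r (\<lambda>i. linear_action g (f i)) (upto_degree D ?J)"
      unfolding upto_degree_linear_action[OF g I(2)] r_def by (rule lin_basis_linear_action[OF g f])
    have "initial_ideal \<omega> ?J = initial_ideal \<omega>' ?J"
      if "upto_degree D (initial_ideal \<omega> ?J) = upto_degree D (initial_ideal \<omega>' ?J)" for \<omega> \<omega>'
      by (rule D[rule_format], intro conjI allI initial_ideal_subspace trunc_closed_initial_ideal J dim[OF g] that)
    note * = groebner_complex_eq_argmin_cells[OF J b this]
    show "polyhedral_complex (groebner_complex ?J)" by (rule *(1))
    show "groebner_complex ?J = argmin_cells r (B g) (v g)" unfolding v_def B_def P_def by (rule *(2))
  qed
  \<comment> \<open>The pairs \<open>(B g, v g)\<close> range over the finite set \<open>T\<close>: \<open>B g\<close> is a set of tuples of low-degree monomials, and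
    \<open>v g\<close> takes values in \<open>W\<close>, which does not depend on \<open>g\<close>.\<close>
  define W where "W = {hval (P g J) | g J. P g J \<noteq> 0}"
  have "finite W" unfolding W_def P_def by (rule finite_hval_pluecker_orbit)
  define T where "T = (SIGMA B:Pow ({..<r} \<rightarrow>\<^sub>E (monos_upto D :: ('n \<Rightarrow>\<^sub>0 nat) set)). B \<rightarrow>\<^sub>E W)"
  have fin: "finite ({..<r} \<rightarrow>\<^sub>E (monos_upto D :: ('n \<Rightarrow>\<^sub>0 nat) set))"
    by (intro finite_PiE) (simp_all add: finite_monos_upto)
  have "finite T" unfolding T_def
    using fin \<open>finite W\<close> by (intro finite_SigmaI finite_PiE) (auto intro: finite_subset)
  have "(B g, v g) \<in> T" for g
    unfolding T_def by (auto simp: B_def v_def W_def)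
  then have "groebner_complex (linear_action g ` I) \<in> (\<lambda>(B, v). argmin_cells r B v) ` T" if "invertible g" for g
    using complex(2)[OF that] by (intro image_eqI[of _ _ "(B g, v g)"]) simp_all
  then have "(\<lambda>g. groebner_complex (linear_action g ` I)) ` {g. invertible g} \<subseteq> (\<lambda>(B, v). argmin_cells r B v) ` T"
    by (intro image_subsetI) (simp only: mem_Collect_eq)
  then have finG: "finite ((\<lambda>g. groebner_complex (linear_action g ` I)) ` {g. invertible g})"
    by (rule finite_subset) (rule finite_imageI[OF \<open>finite T\<close>])
  define Fs where "Fs = (\<lambda>g. tropical_variety (linear_action g ` I)) ` {g. invertible g}"
  have "Fs \<subseteq> (\<Union>G\<in>(\<lambda>g. groebner_complex (linear_action g ` I)) ` {g. invertible g}. Pow G)"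
    by (auto simp: Fs_def tropical_variety_def)
  moreover have "finite (\<Union>G\<in>(\<lambda>g. groebner_complex (linear_action g ` I)) ` {g. invertible g}. Pow G)"
    using complex(1) by (intro finite_UN_I[OF finG]) (auto simp: polyhedral_complex_def)
  ultimately have "finite Fs" by (rule finite_subset)
  moreover have "polyhedral_complex \<F>" if mem: "\<F> \<in> Fs" for \<F>
  proof -
    obtain g where "invertible g" "\<F> = tropical_variety (linear_action g ` I)"
      using mem by (auto simp: Fs_def)
    then show ?thesis unfolding tropical_variety_def by (simp only: polyhedral_subcomplex[OF complex(1)])
  qed
  ultimately show ?thesis by (intro exI[of _ Fs]) (simp add: Fs_def)
qed

end
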